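(* Suppose that $\Omega$ is a bounded open set in $\mathbb O^2$, and let $K$ be a compact subset of $\Omega$ such that $\Omega\setminus K$ is connected. Then for each octonionic pluriharmonic function $f$ on $\Omega\setminus K$ there is an octonionic pluriharmonic function $F$ on $\Omega$ such that $F=f$ in $\Omega\setminus K$.
   Context: $\mathbb O$ is the real octonion algebra with basis $e_0=1,e_1,\dots,e_7$, $e_a^2=-1$, $e_ae_b=-e_be_a$ for $a\ne b$ in $\{1,\dots,7\}$, and conjugation $\bar e_0=e_0$, $\bar e_a=-e_a$ for $a\ge1$; writing $\mathbb O=\mathbb H\oplus\mathbb H e_4$, the product is $(a,b)(c,d)=(ac-\bar d b,\,da+b\bar c)$. Points of $\mathbb O^2\cong\mathbb R^{16}$ are $(x_1,x_2)$, $x_j=\sum_{a=0}^7x_j^ae_a$. For an $\mathbb O$-valued function $F$, $\partial_{\bar j}F=\sum_ae_a\,\partial F/\partial x_j^a$ and $\partial_jF=\sum_a\bar e_a\,\partial F/\partial x_j^a$; $\Delta_j=\sum_{a=0}^7\partial^2/\partial(x_j^a)^2$. A real-valued $C^2$ function $f$ on an open set is octonionic pluriharmonic (OPH) if $$\mathcal D_0f=\begin{pmatrix}\Delta_1f&\partial_{\bar1}\partial_2f\\ \partial_{\bar2}\partial_1f&\Delta_2f\end{pmatrix}=0$$ at every point of that set. *)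

theory Defs
  imports "HOL-Analysis.Analysis"
begin

text \<open>
  Quaternions and octonions are built by the Cayley--Dickson product
  \<open>(a, b)(c, d) = (a c - d\<^sup>* b, d a + b c\<^sup>*)\<close>, starting from \<open>complex\<close>. The carriers are iterated
  products, so that the norm, inner product and topology are the standard Euclidean ones.
  A quaternion \<open>(z, w)\<close> stands for \<open>z + w j\<close>; thus \<open>1, i, j, k\<close> are
  \<open>(1, 0), (\<i>, 0), (0, 1), (0, \<i>)\<close>. An octonion \<open>(a, b)\<close> stands for \<open>a + b e\<^sub>4\<close>.
\<close>

type_synonym quat = "complex \<times> complex"
type_synonym octonion = "quat \<times> quat"

definition qcnj :: "quat \<Rightarrow> quat" where
  "qcnj p = (cnj (fst p), - snd p)"

definition qmult :: "quat \<Rightarrow> quat \<Rightarrow> quat"  (infixl \<open>\<cdot>\<^sub>q\<close> 70) where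
  "p \<cdot>\<^sub>q q = (fst p * fst q - cnj (snd q) * snd p, snd q * fst p + snd p * cnj (fst q))"

definition ocnj :: "octonion \<Rightarrow> octonion" where
  "ocnj x = (qcnj (fst x), - snd x)"

definition omult :: "octonion \<Rightarrow> octonion \<Rightarrow> octonion"  (infixl \<open>\<cdot>\<^sub>o\<close> 70) where
  "x \<cdot>\<^sub>o y = (fst x \<cdot>\<^sub>q fst y - qcnj (snd y) \<cdot>\<^sub>q snd x, snd y \<cdot>\<^sub>q fst x + snd x \<cdot>\<^sub>q qcnj (fst y))"

text \<open>The basis \<open>e\<^sub>0, \<dots>, e\<^sub>7\<close>, with \<open>e\<^sub>1, e\<^sub>2, e\<^sub>3 = i, j, k\<close> and \<open>e\<^sub>4\<^sub>+\<^sub>a = e\<^sub>a e\<^sub>4\<close>.\<close>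

definition oe :: "nat \<Rightarrow> octonion" where
  "oe a = [((1, 0), (0, 0)), ((\<i>, 0), (0, 0)), ((0, 1), (0, 0)), ((0, \<i>), (0, 0)),
           ((0, 0), (1, 0)), ((0, 0), (\<i>, 0)), ((0, 0), (0, 1)), ((0, 0), (0, \<i>))] ! a"

definition oct_of_real :: "real \<Rightarrow> octonion" where
  "oct_of_real r = r *\<^sub>R oe 0"

lemma less_8_cases: "a < 8 \<Longrightarrow> a \<in> {0, 1, 2, 3, 4, 5, 6, 7::nat}"
  by auto

lemmas oct_unit_simps = oe_def omult_def ocnj_def qmult_def qcnj_def zero_prod_def numeral_eq_Suc

lemma oe_Basis: "oe ` {..<8} = Basis"
proof -
  have "{..<8::nat} = {0, 1, 2, 3, 4, 5, 6, 7}" by auto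
  then show ?thesis
    by (auto simp: Basis_prod_def Basis_complex_def oe_def numeral_eq_Suc zero_prod_def)
qed

lemma oe_inj: "inj_on oe {..<8}"
proof -
  have "card (Basis :: octonion set) = 8" by simp
  then show ?thesis by (intro eq_card_imp_inj_on) (simp_all add: oe_Basis)
qed

lemma oe_0_left: "oe 0 \<cdot>\<^sub>o x = x" and oe_0_right: "x \<cdot>\<^sub>o oe 0 = x"
  by (simp_all add: oct_unit_simps prod_eq_iff)

lemma ocnj_oe: "a < 8 \<Longrightarrow> ocnj (oe a) = (if a = 0 then oe a else - oe a)"
  by (drule less_8_cases) (auto simp: oct_unit_simps)

lemma oe_square: "a \<in> {1..7} \<Longrightarrow> oe a \<cdot>\<^sub>o oe a = - oe 0"
proof -
  assume "a \<in> {1..7}"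
  then have "a \<in> {1, 2, 3, 4, 5, 6, 7}" by auto
  then show ?thesis by (auto simp: oct_unit_simps)
qed

lemma oe_anticommute:
  assumes "a \<in> {1..7}" "b \<in> {1..7}" "a \<noteq> b"
  shows "oe a \<cdot>\<^sub>o oe b = - (oe b \<cdot>\<^sub>o oe a)"
proof -
  have "a \<in> {1, 2, 3, 4, 5, 6, 7}" "b \<in> {1, 2, 3, 4, 5, 6, 7}" using assms by auto
  with \<open>a \<noteq> b\<close> show ?thesis by (auto simp: oct_unit_simps)
qed

lemma oe_mult_table:
  "oe 1 \<cdot>\<^sub>o oe 2 = oe 3" "oe 1 \<cdot>\<^sub>o oe 4 = oe 5" "oe 2 \<cdot>\<^sub>o oe 4 = oe 6" "oe 3 \<cdot>\<^sub>o oe 4 = oe 7"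
  by (simp_all add: oct_unit_simps)

text \<open>The index \<open>j\<close> ranges over the two-element type \<open>2\<close>, whose elements are \<open>1\<close> and \<open>2\<close> (equal to \<open>0\<close>).\<close>

definition slot :: "2 \<Rightarrow> octonion \<Rightarrow> octonion \<times> octonion" where
  "slot j v = (if j = 1 then (v, 0) else (0, v))"

text \<open>The partial derivative of \<open>F\<close> in the real coordinate \<open>x\<^sub>j\<^sup>a\<close>.\<close>

definition partial :: "2 \<Rightarrow> nat \<Rightarrow> (octonion \<times> octonion \<Rightarrow> 'b::real_normed_vector)
    \<Rightarrow> octonion \<times> octonion \<Rightarrow> 'b" where
  "partial j a F x = vector_derivative (\<lambda>t. F (x + t *\<^sub>R slot j (oe a))) (at 0)"

definition dbar :: "2 \<Rightarrow> (octonion \<times> octonion \<Rightarrow> octonion) \<Rightarrow> octonion \<times> octonion \<Rightarrow> octonion" where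
  "dbar j F x = (\<Sum>a<8. oe a \<cdot>\<^sub>o partial j a F x)"

definition dd :: "2 \<Rightarrow> (octonion \<times> octonion \<Rightarrow> octonion) \<Rightarrow> octonion \<times> octonion \<Rightarrow> octonion" where
  "dd j F x = (\<Sum>a<8. ocnj (oe a) \<cdot>\<^sub>o partial j a F x)"

definition laplace :: "2 \<Rightarrow> (octonion \<times> octonion \<Rightarrow> real) \<Rightarrow> octonion \<times> octonion \<Rightarrow> real" where
  "laplace j f x = (\<Sum>a<8. partial j a (partial j a f) x)"

definition D0 :: "(octonion \<times> octonion \<Rightarrow> real) \<Rightarrow> octonion \<times> octonion \<Rightarrow> octonion ^ 2 ^ 2" where
  "D0 f x = vector
     [vector [oct_of_real (laplace 1 f x), dbar 1 (dd 2 (\<lambda>y. oct_of_real (f y))) x],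
      vector [dbar 2 (dd 1 (\<lambda>y. oct_of_real (f y))) x, oct_of_real (laplace 2 f x)]]"

definition C2_on :: "'a::real_normed_vector set \<Rightarrow> ('a \<Rightarrow> 'b::real_normed_vector) \<Rightarrow> bool" where
  "C2_on U f \<longleftrightarrow> (\<exists>(f' :: 'a \<Rightarrow> 'a \<Rightarrow>\<^sub>L 'b) (f'' :: 'a \<Rightarrow> 'a \<Rightarrow>\<^sub>L 'a \<Rightarrow>\<^sub>L 'b).
     (\<forall>x\<in>U. (f has_derivative blinfun_apply (f' x)) (at x)) \<and>
     (\<forall>x\<in>U. (f' has_derivative blinfun_apply (f'' x)) (at x)) \<and>
     continuous_on U f'')"

text \<open>Functions on \<open>U\<close> are represented by total functions; only the values on \<open>U\<close> matter.\<close>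

definition oph_on :: "(octonion \<times> octonion) set \<Rightarrow> (octonion \<times> octonion \<Rightarrow> real) \<Rightarrow> bool" where
  "oph_on U f \<longleftrightarrow> open U \<and> C2_on U f \<and> (\<forall>x\<in>U. D0 f x = 0)"

end

theory Submission imports Defs "HOL-Complex_Analysis.Complex_Analysis"
begin

text \<open>
  The extension is written down by a formula in the first octonionic variable alone. An octonionic
  pluriharmonic \<open>f\<close> is harmonic in \<open>x\<^sub>1\<close> for fixed \<open>x\<^sub>2\<close>. Let \<open>N\<close> be the Newton kernel of the 8-dimensional
  space of octonions and \<open>\<eta>\<close> a compactly supported cutoff in \<open>x\<^sub>1\<close> that is constant near \<open>x\<^sub>1\<close>. Green's identity shows that a
  function \<open>h\<close> harmonic near the support of \<open>\<eta>\<close> satisfies, with a dimensional constant \<open>C > 0\<close>,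
  \<open>C \<eta>(x\<^sub>1) h(x\<^sub>1) = \<integral> h(y) W\<^sub>\<eta>(x\<^sub>1, y) dy\<close>, where the density \<open>W\<^sub>\<eta>(x\<^sub>1, y) = N(y - x\<^sub>1) \<Delta>\<eta>(y) + 2 \<nabla>N(y - x\<^sub>1) \<nabla>\<eta>(y)\<close> is continuous and
  is supported where \<open>\<eta>\<close> is not locally constant (\<open>green_constant_exists\<close>). If \<open>\<eta> = 1\<close> near the slice of \<open>K\<close> and \<open>\<eta>\<close> has its
  support in the slice of \<open>\<Omega>\<close>, the density only sees \<open>\<Omega> - K\<close>, and

    \<open>F(x\<^sub>1, x\<^sub>2) = (1 - \<eta>(x\<^sub>1)) f(x\<^sub>1, x\<^sub>2) + C\<inverse> \<integral> f(y, x\<^sub>2) W\<^sub>\<eta>(x\<^sub>1, y) dy\<close>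

  is defined on all of \<open>\<Omega>\<close>. The reproducing formula for the difference of two cutoffs shows that \<open>F\<close> does not
  depend on \<open>\<eta>\<close> (\<open>hartogs_value_independent\<close>).

  Because the cutoff may be translated along with the point, \<open>F\<close> is near each point an average of translates of \<open>f\<close> with a fixed
  weight (\<open>extension_is_local_average\<close>). Second derivatives and linear equations with constant coefficients between them
  pass from \<open>f\<close> to \<open>F\<close>, the mixed equations in \<open>D0 F = 0\<close> along with the two Laplace equations.

  Over points \<open>x\<^sub>2\<close> outside the projection of \<open>K\<close> one may take \<open>\<eta> = 0\<close>, so \<open>F = f\<close> there. Such points exist because the projection
  of \<open>\<Omega>\<close> is open and that of \<open>K\<close> is compact. The difference \<open>F - f\<close> is separately harmonic on the connected set \<open>\<Omega> - K\<close>
  and vanishes on a nonempty open part of it, hence everywhere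
  (\<open>separately_harmonic_unique_continuation\<close>). Unique continuation rests on the same reproducing formula: along a ray
  the density is a rational function of the parameter, so harmonic functions extend holomorphically to a complex disc.
\<close>

section \<open>Directional derivatives and the Laplacian\<close>

text \<open>
  The direction \<open>b\<close> is arbitrary, so that slices of a function of two variables and the function itself
  share one calculus: a derivative along \<open>b\<close> in the first slot is a derivative along \<open>(b, 0)\<close>.
\<close>

definition has_pd :: "'a::euclidean_space \<Rightarrow> ('a \<Rightarrow> real) \<Rightarrow> real \<Rightarrow> 'a \<Rightarrow> bool" where
  "has_pd b f D x \<longleftrightarrow> ((\<lambda>t. f (x + t *\<^sub>R b)) has_real_derivative D) (at 0)"

definition pd :: "'a::euclidean_space \<Rightarrow> ('a \<Rightarrow> real) \<Rightarrow> 'a \<Rightarrow> real" where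
  "pd b f x = vector_derivative (\<lambda>t. f (x + t *\<^sub>R b)) (at 0)"

definition lap :: "('a::euclidean_space \<Rightarrow> real) \<Rightarrow> 'a \<Rightarrow> real" where
  "lap f x = (\<Sum>b\<in>Basis. pd b (pd b f) x)"

text \<open>
  Products, Laplacians and integrations by parts only see the function and its pure derivatives of order one and two.
\<close>

definition C2dir :: "'a::euclidean_space set \<Rightarrow> ('a \<Rightarrow> real) \<Rightarrow> bool" where
  "C2dir U f \<longleftrightarrow> continuous_on U f \<and>
    (\<forall>b\<in>Basis. continuous_on U (pd b f) \<and> continuous_on U (pd b (pd b f)) \<and>
      (\<forall>x\<in>U. has_pd b f (pd b f x) x \<and> has_pd b (pd b f) (pd b (pd b f) x) x))"

definition test_fn :: "'a::euclidean_space set \<Rightarrow> ('a \<Rightarrow> real) \<Rightarrow> bool" where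
  "test_fn S \<phi> \<longleftrightarrow> C2dir UNIV \<phi> \<and> (\<exists>A. compact A \<and> A \<subseteq> S \<and> (\<forall>x. x \<notin> A \<longrightarrow> \<phi> x = 0))"

lemma pd_eqI: "has_pd b f D x \<Longrightarrow> pd b f x = D"
  unfolding has_pd_def pd_def
  by (simp add: has_real_derivative_iff_has_vector_derivative vector_derivative_at)

lemma has_pd_cong:
  assumes "open U" "x \<in> U" "\<And>y. y \<in> U \<Longrightarrow> f y = g y"
  shows "has_pd b f D x \<longleftrightarrow> has_pd b g D x"
proof -
  have "((\<lambda>t. x + t *\<^sub>R b) \<longlongrightarrow> x + 0 *\<^sub>R b) (at 0)" by (intro tendsto_intros)
  then have "\<forall>\<^sub>F t in at 0. x + t *\<^sub>R b \<in> U"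
    using assms(1,2) by (simp add: topological_tendstoD)
  then have "\<forall>\<^sub>F t in nhds 0. f (x + t *\<^sub>R b) = g (x + t *\<^sub>R b)"
    unfolding eventually_at_filter using assms(2,3)
    by (auto elim!: eventually_mono)
  then show ?thesis unfolding has_pd_def by (rule DERIV_cong_ev[OF refl _ refl])
qed

lemma pd_cong:
  assumes "open U" "x \<in> U" "\<And>y. y \<in> U \<Longrightarrow> f y = g y"
  shows "pd b f x = pd b g x"
proof -
  have "\<And>D. has_pd b f D x \<longleftrightarrow> has_pd b g D x" by (rule has_pd_cong[OF assms])
  then show ?thesis unfolding pd_def vector_derivative_def has_pd_def
    by (simp add: has_real_derivative_iff_has_vector_derivative)
qed

lemma lap_cong:
  assumes "open U" "x \<in> U" "\<And>y. y \<in> U \<Longrightarrow> f y = g y"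
  shows "lap f x = lap g x"
  unfolding lap_def
  by (intro sum.cong refl pd_cong[OF assms(1,2)] pd_cong[OF assms(1) _ assms(3)])

lemma has_pd_shift: "has_pd b (\<lambda>y. f (y + c)) D x \<longleftrightarrow> has_pd b f D (x + c)"
  by (simp add: has_pd_def add_ac)

lemma pd_shift: "pd b (\<lambda>y. f (y + c)) = (\<lambda>x. pd b f (x + c))"
  by (simp add: pd_def fun_eq_iff add_ac)

lemma lap_shift: "lap (\<lambda>y. f (y + c)) x = lap f (x + c)"
  by (simp add: lap_def pd_shift)

lemma has_pd_const [simp]: "has_pd b (\<lambda>_. c) 0 x"
  by (simp add: has_pd_def)

lemma pd_const [simp]: "pd b (\<lambda>_. c) = (\<lambda>_. 0)"
  by (rule ext) (simp add: pd_eqI)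

lemma lap_const [simp]: "lap (\<lambda>_. c) x = 0"
  by (simp add: lap_def)

lemma has_pd_mult:
  "has_pd b f D x \<Longrightarrow> has_pd b g E x \<Longrightarrow> has_pd b (\<lambda>x. f x * g x) (f x * E + D * g x) x"
  unfolding has_pd_def by (auto intro!: derivative_eq_intros)

lemma has_pd_diff:
  "has_pd b f D x \<Longrightarrow> has_pd b g E x \<Longrightarrow> has_pd b (\<lambda>x. f x - g x) (D - E) x"
  unfolding has_pd_def by (auto intro!: derivative_eq_intros)

lemma has_pd_compose:
  assumes "has_pd b f D x" "(\<phi> has_real_derivative E) (at (f x))"
  shows "has_pd b (\<lambda>x. \<phi> (f x)) (E * D) x"
  using DERIV_chain'[of "\<lambda>t. f (x + t *\<^sub>R b)" D 0 UNIV \<phi> E] assms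
  by (simp add: has_pd_def mult.commute)

lemma has_pd_along:
  assumes "has_pd b f D (x + t *\<^sub>R b)"
  shows "((\<lambda>t. f (x + t *\<^sub>R b)) has_real_derivative D) (at t)"
  using assms DERIV_shift[of "\<lambda>t. f (x + t *\<^sub>R b)" D 0 t]
  by (simp add: has_pd_def algebra_simps)

lemma open_slices:
  fixes U :: "('a::euclidean_space \<times> 'b::euclidean_space) set"
  assumes "open U"
  shows "open {y. (y, z) \<in> U}" and "open {z. (y, z) \<in> U}"
  using continuous_open_vimage[OF assms, of "\<lambda>y. (y, z)"] continuous_open_vimage[OF assms, of "\<lambda>z. (y, z)"]
  by (simp_all add: vimage_def continuous_on_Pair)

text \<open>
  Derivatives are usually known as explicit functions on an open set \<open>U\<close> only; openness makes the operator
  \<open>pd b (pd b f)\<close> see nothing but those values.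
\<close>

lemma C2dirI:
  assumes "open U" "continuous_on U f"
    and f1: "\<And>b x. b \<in> Basis \<Longrightarrow> x \<in> U \<Longrightarrow> has_pd b f (f1 b x) x"
    and f2: "\<And>b x. b \<in> Basis \<Longrightarrow> x \<in> U \<Longrightarrow> has_pd b (f1 b) (f2 b x) x"
    and "\<And>b. b \<in> Basis \<Longrightarrow> continuous_on U (f1 b)" "\<And>b. b \<in> Basis \<Longrightarrow> continuous_on U (f2 b)"
  shows "C2dir U f" "\<And>b x. b \<in> Basis \<Longrightarrow> x \<in> U \<Longrightarrow> pd b f x = f1 b x"
    "\<And>b x. b \<in> Basis \<Longrightarrow> x \<in> U \<Longrightarrow> pd b (pd b f) x = f2 b x"
proof -
  show 1: "pd b f x = f1 b x" if "b \<in> Basis" "x \<in> U" for b x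
    using f1[OF that] by (rule pd_eqI)
  have 2: "has_pd b (pd b f) (f2 b x) x" if "b \<in> Basis" "x \<in> U" for b x
    using f2[OF that] has_pd_cong[OF assms(1) that(2), of "pd b f" "f1 b"] 1 that by auto
  show 3: "pd b (pd b f) x = f2 b x" if "b \<in> Basis" "x \<in> U" for b x
    using 2[OF that] by (rule pd_eqI)
  show "C2dir U f"
    unfolding C2dir_def using assms 1 2 3
    by (auto cong: continuous_on_cong)
qed

lemma C2dirD:
  assumes "C2dir U f" "b \<in> Basis"
  shows "continuous_on U f" "continuous_on U (pd b f)" "continuous_on U (pd b (pd b f))"
    "x \<in> U \<Longrightarrow> has_pd b f (pd b f x) x" "x \<in> U \<Longrightarrow> has_pd b (pd b f) (pd b (pd b f) x) x"
  using assms unfolding C2dir_def by auto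

lemma C2dir_continuous_on: "C2dir U f \<Longrightarrow> continuous_on U f"
  by (simp add: C2dir_def)

lemma C2dir_lap_continuous_on: "C2dir U f \<Longrightarrow> continuous_on U (lap f)"
  unfolding lap_def [abs_def] by (intro continuous_intros) (auto simp: C2dir_def)

lemma C2dir_subset: "C2dir U f \<Longrightarrow> V \<subseteq> U \<Longrightarrow> C2dir V f"
  unfolding C2dir_def by (auto intro: continuous_on_subset)

lemma C2dir_shift:
  assumes "C2dir U f" and V: "\<And>x. x \<in> V \<Longrightarrow> x + c \<in> U"
  shows "C2dir V (\<lambda>x. f (x + c))"
  unfolding C2dir_def pd_shift has_pd_shift
  using assms by (auto simp: C2dir_def intro!: continuous_on_compose2[where f="\<lambda>x. x + c"] continuous_intros)

lemma C2dir_const: "open U \<Longrightarrow> C2dir U (\<lambda>_. c)"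
  by (rule C2dirI(1)[where ?f1.0="\<lambda>_ _. 0" and ?f2.0="\<lambda>_ _. 0"]) auto

lemma C2dir_diff:
  assumes "open U" and f: "C2dir U f" and g: "C2dir U g"
  shows "C2dir U (\<lambda>x. f x - g x)"
    and "b \<in> Basis \<Longrightarrow> x \<in> U \<Longrightarrow> pd b (\<lambda>x. f x - g x) x = pd b f x - pd b g x"
    and "x \<in> U \<Longrightarrow> lap (\<lambda>x. f x - g x) x = lap f x - lap g x"
proof -
  have cont: "continuous_on U (\<lambda>x. f x - g x)"
    using f g by (intro continuous_intros C2dir_continuous_on)
  have d: "has_pd b (\<lambda>x. f x - g x) (pd b f x - pd b g x) x"
      "has_pd b (\<lambda>x. pd b f x - pd b g x) (pd b (pd b f) x - pd b (pd b g) x) x"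
    if "b \<in> Basis" "x \<in> U" for b x
    using C2dirD(4,5)[OF f that] C2dirD(4,5)[OF g that] by (auto intro: has_pd_diff)
  have c: "continuous_on U (\<lambda>x. pd b f x - pd b g x)"
      "continuous_on U (\<lambda>x. pd b (pd b f) x - pd b (pd b g) x)" if "b \<in> Basis" for b
    using C2dirD(2,3)[OF f that] C2dirD(2,3)[OF g that] by (auto intro: continuous_intros)
  note * = C2dirI[OF \<open>open U\<close> cont d c, simplified]
  show "C2dir U (\<lambda>x. f x - g x)"
    "b \<in> Basis \<Longrightarrow> x \<in> U \<Longrightarrow> pd b (\<lambda>x. f x - g x) x = pd b f x - pd b g x"
    by (rule *; assumption)+
  show "x \<in> U \<Longrightarrow> lap (\<lambda>x. f x - g x) x = lap f x - lap g x"
    by (simp add: lap_def sum_subtractf *(3))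
qed

text \<open>
  For a cutoff times the Newton kernel, the middle term and the one with the Laplacian of the cutoff make up
  the \<open>green_density\<close> below; the remaining term is concentrated at the singularity.
\<close>

lemma C2dir_mult:
  assumes "open U" and f: "C2dir U f" and g: "C2dir U g"
  shows "C2dir U (\<lambda>x. f x * g x)"
    and "x \<in> U \<Longrightarrow> lap (\<lambda>x. f x * g x) x
      = f x * lap g x + 2 * (\<Sum>b\<in>Basis. pd b f x * pd b g x) + lap f x * g x"
proof -
  define f1 where "f1 b x = f x * pd b g x + pd b f x * g x" for b x
  define f2 where "f2 b x = (f x * pd b (pd b g) x + pd b f x * pd b g x) +
      (pd b f x * pd b g x + pd b (pd b f) x * g x)" for b x
  have cont: "continuous_on U (\<lambda>x. f x * g x)"
    using f g by (intro continuous_intros C2dir_continuous_on)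
  have d: "has_pd b (\<lambda>x. f x * g x) (f1 b x) x" "has_pd b (f1 b) (f2 b x) x"
    if "b \<in> Basis" "x \<in> U" for b x
  proof -
    note e = C2dirD(4,5)[OF f that] C2dirD(4,5)[OF g that]
    show "has_pd b (\<lambda>x. f x * g x) (f1 b x) x"
      unfolding f1_def by (rule has_pd_mult[OF e(1,3)])
    show "has_pd b (f1 b) (f2 b x) x"
      using has_pd_mult[OF e(1) e(4)] has_pd_mult[OF e(2) e(3)]
      unfolding f1_def f2_def has_pd_def by (rule DERIV_add)
  qed
  have c: "continuous_on U (f1 b)" "continuous_on U (f2 b)" if "b \<in> Basis" for b
    using C2dirD(1-3)[OF f that] C2dirD(1-3)[OF g that]
    unfolding f1_def[abs_def] f2_def[abs_def] by (auto intro!: continuous_on_add continuous_on_mult)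
  note * = C2dirI[OF \<open>open U\<close> cont d c]
  show "C2dir U (\<lambda>x. f x * g x)"
    by (rule *(1))
  show "x \<in> U \<Longrightarrow> lap (\<lambda>x. f x * g x) x
      = f x * lap g x + 2 * (\<Sum>b\<in>Basis. pd b f x * pd b g x) + lap f x * g x"
    by (simp add: lap_def *(3) f2_def sum.distrib sum_distrib_left sum_distrib_right)
qed

lemma pd_eq_0_off:
  assumes "closed A" "\<And>x. x \<notin> A \<Longrightarrow> f x = 0" "x \<notin> A"
  shows "pd b f x = 0"
  using pd_cong[of "- A" x f "\<lambda>_. 0" b] assms by (simp add: open_Compl)

lemma lap_eq_0_off:
  assumes "closed A" "\<And>x. x \<notin> A \<Longrightarrow> f x = 0" "x \<notin> A"
  shows "lap f x = 0"
  using lap_cong[of "- A" x f "\<lambda>_. 0"] assms by (simp add: open_Compl)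

text \<open>
  Extension by zero: \<open>h\<close> may be arbitrary outside \<open>w\<close> because \<open>\<beta>\<close> already vanishes before the boundary
  of \<open>w\<close> is reached. Most integrands below are of this form, since the given functions live
  only on open sets.
\<close>

lemma continuous_on_scaleR_off:
  fixes \<beta> :: "'a::topological_space \<Rightarrow> real" and h :: "'a \<Rightarrow> 'b::real_normed_vector"
  assumes "open D" "open w" "continuous_on w h" "continuous_on D \<beta>"
    and "closed A" "A \<inter> D \<subseteq> w" "w \<subseteq> D" "\<And>x. x \<in> D \<Longrightarrow> x \<notin> A \<Longrightarrow> \<beta> x = 0"
  shows "continuous_on D (\<lambda>x. \<beta> x *\<^sub>R h x)"
proof -
  have "continuous_on w (\<lambda>x. \<beta> x *\<^sub>R h x)"
    using assms(3,4,7) by (intro continuous_intros) (auto intro: continuous_on_subset)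
  moreover have "continuous_on (D \<inter> - A) (\<lambda>x. \<beta> x *\<^sub>R h x)"
    by (rule continuous_on_eq[of _ "\<lambda>_. 0"]) (use assms in auto)
  ultimately have "continuous_on (w \<union> D \<inter> - A) (\<lambda>x. \<beta> x *\<^sub>R h x)"
    using assms by (intro continuous_on_open_Un) auto
  moreover have "w \<union> D \<inter> - A = D" using assms by auto
  ultimately show ?thesis by simp
qed

lemma continuous_on_mult_off:
  fixes h \<beta> :: "'a::euclidean_space \<Rightarrow> real"
  assumes "open w" "continuous_on w h" "continuous_on UNIV \<beta>"
    and "closed A" "A \<subseteq> w" "\<And>x. x \<notin> A \<Longrightarrow> \<beta> x = 0"
  shows "continuous_on UNIV (\<lambda>x. h x * \<beta> x)"
  using continuous_on_scaleR_off[of UNIV w h \<beta> A] assms by (simp add: mult.commute)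

lemma integral_compact_support:
  fixes f :: "'a::euclidean_space \<Rightarrow> 'b::banach"
  assumes "continuous_on UNIV f" "A \<subseteq> cbox a b" "\<And>x. x \<notin> A \<Longrightarrow> f x = 0"
  shows "f integrable_on UNIV" and "integral UNIV f = integral (cbox a b) f"
proof -
  have "f integrable_on cbox a b"
    using assms by (intro integrable_continuous) (auto intro: continuous_on_subset)
  then have "(f has_integral integral (cbox a b) f) (cbox a b)" by (rule integrable_integral)
  then have "(f has_integral integral (cbox a b) f) UNIV"
    by (rule has_integral_on_superset) (use assms in auto)
  then show "f integrable_on UNIV" and "integral UNIV f = integral (cbox a b) f"
    by auto
qed

lemma integral_UNIV_shift:
  fixes f :: "'a::euclidean_space \<Rightarrow> 'b::euclidean_space"
  assumes f: "continuous_on UNIV f" and A: "A \<subseteq> cbox a b" "\<And>x. x \<notin> A \<Longrightarrow> f x = 0"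
  shows "integral UNIV (\<lambda>x. f (x + c)) = integral UNIV f"
proof -
  have "continuous_on UNIV (\<lambda>x. f (x + c))"
    by (intro continuous_on_compose2[OF f] continuous_intros) auto
  moreover have "f (x + c) = 0" if "x \<notin> cbox (a - c) (b - c)" for x
    by (rule A(2)) (use that A(1) in \<open>auto simp: mem_box algebra_simps\<close>)
  ultimately have "integral UNIV (\<lambda>x. f (x + c)) = integral (cbox (a - c) (b - c)) (\<lambda>x. f (x + c))"
    by (intro integral_compact_support(2)[of _ "cbox (a - c) (b - c)"]) auto
  also have "\<dots> = integral (cbox a b) f"
    by (rule integral_shift_cbox)
  also have "\<dots> = integral UNIV f"
    using integral_compact_support(2)[OF f A] by simp
  finally show ?thesis .
qed

section \<open>Cutoff functions\<close>

lemma C2dir_compose: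
  assumes "open U" and f: "C2dir U f"
    and \<phi>: "\<And>u. (\<phi> has_real_derivative \<phi>1 u) (at u)" "\<And>u. (\<phi>1 has_real_derivative \<phi>2 u) (at u)"
      "continuous_on UNIV \<phi>2"
  shows "C2dir U (\<lambda>x. \<phi> (f x))"
proof -
  have c\<phi>: "continuous_on UNIV \<phi>" "continuous_on UNIV \<phi>1"
    using DERIV_isCont[OF \<phi>(1)] DERIV_isCont[OF \<phi>(2)]
    by (simp_all add: continuous_at_imp_continuous_on)
  have chain: "has_pd b (\<lambda>x. \<psi> (f x)) (\<psi>' (f x) * pd b f x) x"
    if "b \<in> Basis" "x \<in> U" "\<And>u. (\<psi> has_real_derivative \<psi>' u) (at u)" for b x \<psi> \<psi>'
    by (rule has_pd_compose[OF C2dirD(4)[OF f that(1,2)] that(3)])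
  have comp: "continuous_on U (\<lambda>x. \<psi> (f x))" if "continuous_on UNIV \<psi>" for \<psi> :: "real \<Rightarrow> real"
    by (rule continuous_on_compose2[OF that C2dir_continuous_on[OF f]]) simp
  show ?thesis
  proof (rule C2dirI(1)[OF \<open>open U\<close>])
    fix b :: 'a and x assume b: "b \<in> Basis"
    { assume x: "x \<in> U"
      show "has_pd b (\<lambda>x. \<phi> (f x)) (\<phi>1 (f x) * pd b f x) x"
        by (rule chain[OF b x \<phi>(1)])
      show "has_pd b (\<lambda>x. \<phi>1 (f x) * pd b f x)
          (\<phi>1 (f x) * pd b (pd b f) x + \<phi>2 (f x) * pd b f x * pd b f x) x"
        by (rule has_pd_mult[OF chain[OF b x \<phi>(2)] C2dirD(5)[OF f b x]]) }
    show "continuous_on U (\<lambda>x. \<phi>1 (f x) * pd b f x)"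
      "continuous_on U (\<lambda>x. \<phi>1 (f x) * pd b (pd b f) x + \<phi>2 (f x) * pd b f x * pd b f x)"
      using C2dirD(1-3)[OF f b] comp \<phi>(3) c\<phi> by (auto intro!: continuous_on_add continuous_on_mult)
  qed (rule comp[OF c\<phi>(1)])
qed

lemma C2dir_add:
  assumes "open U" "C2dir U f" "C2dir U g"
  shows "C2dir U (\<lambda>x. f x + g x)"
  using C2dir_diff(1)[OF assms(1,2) C2dir_diff(1)[OF assms(1) C2dir_const[OF assms(1)] assms(3)], of 0]
  by simp

lemma C2dir_sum:
  assumes "open U" "finite I" "\<And>i. i \<in> I \<Longrightarrow> C2dir U (f i)"
  shows "C2dir U (\<lambda>x. \<Sum>i\<in>I. f i x)"
  using assms(2,3) by (induction rule: finite_induct) (auto intro: C2dir_add C2dir_const assms(1))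

text \<open>
  Powers of the positive part are the building blocks of the cutoff functions: the cube has two continuous
  derivatives, which is the regularity that test functions have here.
\<close>

lemma DERIV_pos_part_power:
  "((\<lambda>u::real. max 0 u ^ (n + 2)) has_real_derivative real (n + 2) * max 0 u ^ (n + 1)) (at u)"
proof (cases "u = 0")
  case True
  have "(\<lambda>h::real. max 0 h ^ (n + 2) / h) \<midarrow>0\<rightarrow> 0"
  proof (rule Lim_null_comparison)
    show "\<forall>\<^sub>F h in at 0. norm (max 0 h ^ (n + 2) / h) \<le> \<bar>h\<bar> ^ (n + 1)"
    proof (rule always_eventually, rule allI)
      fix h :: real
      show "norm (max 0 h ^ (n + 2) / h) \<le> \<bar>h\<bar> ^ (n + 1)"
      proof (cases "h > 0")
        case False
        then have "norm (max 0 h ^ (n + 2) / h) = 0" by simp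
        then show ?thesis by (simp only: zero_le_power abs_ge_zero)
      qed simp
    qed
    have "((\<lambda>h::real. \<bar>h\<bar> ^ (n + 1)) \<longlongrightarrow> \<bar>0\<bar> ^ (n + 1)) (at 0)" by (intro tendsto_intros)
    then show "((\<lambda>h::real. \<bar>h\<bar> ^ (n + 1)) \<longlongrightarrow> 0) (at 0)" by simp
  qed
  then show ?thesis using True by (simp add: DERIV_def)
next
  case False
  show ?thesis
  proof (cases "u > 0")
    case True
    have "((\<lambda>u. u ^ (n + 2)) has_real_derivative real (n + 2) * u ^ (n + 1)) (at u)"
      using DERIV_pow[of "n + 2" u] by (simp del: power_Suc)
    then have "((\<lambda>u::real. max 0 u ^ (n + 2)) has_real_derivative real (n + 2) * u ^ (n + 1)) (at u)"
      by (rule has_field_derivative_transform_within_open[of _ _ _ "{0<..}"]) (use True in auto)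
    then show ?thesis using True by simp
  next
    case neg: False
    have "((\<lambda>_. 0) has_real_derivative 0) (at u)" by simp
    then have "((\<lambda>u::real. max 0 u ^ (n + 2)) has_real_derivative 0) (at u)"
      by (rule has_field_derivative_transform_within_open[of _ _ _ "{..<0}"])
        (use neg False in \<open>auto simp: max_def\<close>)
    then show ?thesis using neg False by (simp add: max_def)
  qed
qed

lemma C2dir_pos_part_cube:
  assumes "open U" "C2dir U f"
  shows "C2dir U (\<lambda>x. max 0 (f x) ^ 3)"
proof (rule C2dir_compose[OF assms, where \<phi>="\<lambda>u. max 0 u ^ 3" and ?\<phi>1.0="\<lambda>u. 3 * max 0 u ^ 2"
      and ?\<phi>2.0="\<lambda>u. 3 * (2 * max 0 u)"])
  show "((\<lambda>u::real. max 0 u ^ 3) has_real_derivative 3 * max 0 u ^ 2) (at u)" for u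
    using DERIV_pos_part_power[of 1 u] by (simp add: numeral_eq_Suc)
  show "((\<lambda>u::real. 3 * max 0 u ^ 2) has_real_derivative 3 * (2 * max 0 u)) (at u)" for u
    using DERIV_cmult[OF DERIV_pos_part_power[of 0 u], of 3] by (simp add: numeral_eq_Suc)
  show "continuous_on UNIV (\<lambda>u::real. 3 * (2 * max 0 u))"
    by (intro continuous_intros)
qed

lemma has_pd_norm_square:
  "has_pd b (\<lambda>x. (x - c) \<bullet> (x - c)) (2 * ((x - c) \<bullet> b)) x"
proof -
  have "(x + t *\<^sub>R b - c) \<bullet> (x + t *\<^sub>R b - c)
      = (x - c) \<bullet> (x - c) + 2 * t * ((x - c) \<bullet> b) + t * t * (b \<bullet> b)" for t
  proof -
    have "x + t *\<^sub>R b - c = (x - c) + t *\<^sub>R b" by simp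
    then show ?thesis
      by (simp only: inner_add_left inner_add_right inner_scaleR_left inner_scaleR_right
          inner_commute[of b "x - c"]) (simp add: algebra_simps)
  qed
  then show ?thesis
    unfolding has_pd_def by (auto intro!: derivative_eq_intros)
qed

lemma has_pd_inner: "has_pd b (\<lambda>x. (x - c) \<bullet> v) (b \<bullet> v) x"
  unfolding has_pd_def by (auto intro!: derivative_eq_intros simp: inner_add_left inner_diff_left)

lemma C2dir_norm_square: "C2dir UNIV (\<lambda>x. (x - c) \<bullet> (x - c))"
proof (rule C2dirI(1))
  show "has_pd b (\<lambda>x. (x - c) \<bullet> (x - c)) (2 * ((x - c) \<bullet> b)) x" for b x
    by (rule has_pd_norm_square)
  show "has_pd b (\<lambda>x. 2 * ((x - c) \<bullet> b)) (0 * ((x - c) \<bullet> b) + 2 * (b \<bullet> b)) x" for b x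
    using has_pd_mult[OF has_pd_const[of b 2 x] has_pd_inner[of b c b x]] by (simp add: algebra_simps)
qed (auto intro!: continuous_intros)

text \<open>
  Cover \<open>k\<close> by finitely many balls contained in \<open>w\<close> and add up the cubes of \<open>max 0 (r\<^sup>2 - \<bar>x - c\<bar>\<^sup>2)\<close>. The sum \<open>S\<close>
  exceeds some \<open>s > 0\<close> on \<open>k\<close> and vanishes off the balls, and \<open>1 - (max 0 (1 - S/s))\<^sup>3\<close> flattens it to the value
  \<open>1\<close> wherever \<open>S \<ge> s\<close> while keeping the value \<open>0\<close> wherever \<open>S = 0\<close>.
\<close>

lemma cutoff_exists:
  fixes k w :: "'a::euclidean_space set"
  assumes "compact k" "open w" "k \<subseteq> w"
  obtains \<eta> V where "test_fn w \<eta>" "\<And>x. 0 \<le> \<eta> x" "open V" "k \<subseteq> V" "\<And>x. x \<in> V \<Longrightarrow> \<eta> x = 1"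
proof -
  have "\<forall>c\<in>k. \<exists>r>0. cball c r \<subseteq> w"
    using assms open_contains_cball by (metis subsetD)
  then obtain r where r: "\<And>c. c \<in> k \<Longrightarrow> r c > 0 \<and> cball c (r c) \<subseteq> w" by metis
  obtain D where D: "D \<subseteq> k" "finite D" "k \<subseteq> (\<Union>c\<in>D. ball c (r c))"
    using compactE_image[OF assms(1), of k "\<lambda>c. ball c (r c)"] r by (metis (no_types, lifting) UN_I centre_in_ball open_ball subsetI)
  define q where "q c x = (r c)\<^sup>2 - (x - c) \<bullet> (x - c)" for c x
  define S where "S x = (\<Sum>c\<in>D. max 0 (q c x) ^ 3)" for x
  have S: "C2dir UNIV S"
    unfolding S_def[abs_def] q_def
    by (intro C2dir_sum C2dir_pos_part_cube C2dir_diff(1) C2dir_norm_square C2dir_const D) auto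
  have S0: "S x \<ge> 0" for x unfolding S_def by (intro sum_nonneg) auto
  have Spos: "S x > 0" if x: "x \<in> k" for x
  proof -
    obtain c where c: "c \<in> D" "x \<in> ball c (r c)" using D x by auto
    have "dist x c < r c" using c by (simp add: dist_commute)
    then have "(x - c) \<bullet> (x - c) < (r c)\<^sup>2"
      by (metis dist_norm dot_square_norm norm_ge_zero power_strict_mono zero_less_numeral)
    then have "0 < max 0 (q c x) ^ 3" by (simp add: q_def)
    then show ?thesis unfolding S_def
      by (intro sum_pos2[OF D(2) c(1)]) auto
  qed
  obtain s where s: "s > 0" "\<And>x. x \<in> k \<Longrightarrow> s < S x"
  proof (cases "k = {}")
    case False
    obtain x0 where "x0 \<in> k" "\<And>x. x \<in> k \<Longrightarrow> S x0 \<le> S x"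
      using continuous_attains_inf[OF assms(1) False, of S] C2dir_continuous_on[OF S]
      by (meson continuous_on_subset subset_UNIV)
    with Spos[of x0] show ?thesis by (intro that[of "S x0 / 2"]) force+
  qed (use that[of 1] in auto)
  define \<eta> where "\<eta> x = 1 - max 0 (1 - S x * (1 / s)) ^ 3" for x
  have \<eta>: "C2dir UNIV \<eta>"
    unfolding \<eta>_def[abs_def]
    by (intro C2dir_diff(1) C2dir_pos_part_cube C2dir_mult(1) C2dir_const S) auto
  show thesis
  proof (rule that[of \<eta> "{x. s < S x}"])
    define A where "A = (\<Union>c\<in>D. cball c (r c))"
    have "compact A" unfolding A_def using D by (intro compact_UN) auto
    moreover have "A \<subseteq> w" unfolding A_def using D r by auto
    moreover have "\<eta> x = 0" if "x \<notin> A" for x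
    proof -
      have "max 0 (q c x) ^ 3 = 0" if "c \<in> D" for c
      proof -
        have "dist x c > r c" using that \<open>x \<notin> A\<close> by (auto simp: A_def dist_commute not_le)
        then have "(x - c) \<bullet> (x - c) \<ge> (r c)\<^sup>2"
          using r[of c] that D
          by (metis dist_norm dot_square_norm less_imp_le power_mono subsetD)
        then show ?thesis by (simp add: q_def)
      qed
      then have "S x = 0" by (simp add: S_def)
      then show ?thesis by (simp add: \<eta>_def)
    qed
    ultimately show "test_fn w \<eta>" using \<eta> unfolding test_fn_def by blast
    show "0 \<le> \<eta> x" for x
      using power_le_one[of "max 0 (1 - S x * (1 / s))" 3] S0[of x] s(1) by (simp add: \<eta>_def)
    show "open {x. s < S x}"
      using C2dir_continuous_on[OF S] by (intro open_Collect_less) (auto intro: continuous_intros)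
    show "k \<subseteq> {x. s < S x}" using s by auto
    show "\<eta> x = 1" if "x \<in> {x. s < S x}" for x
      using that s(1) by (simp add: \<eta>_def max_def field_simps)
  qed
qed

section \<open>Green's identity for compactly supported functions\<close>

text \<open>
  The integral of \<open>g (y + t b)\<close> over the whole space does not depend on \<open>t\<close>, and its derivative at \<open>t = 0\<close> is the
  integral of \<open>D\<close>.
\<close>

lemma integral_directional_derivative_eq_0:
  fixes g D :: "'a::euclidean_space \<Rightarrow> real"
  assumes g: "continuous_on UNIV g" and D: "continuous_on UNIV D" "\<And>x. has_pd b g (D x) x"
    and A: "compact A" "\<And>x. x \<notin> A \<Longrightarrow> g x = 0"
  shows "integral UNIV D = 0"
proof -
  \<comment> \<open>One box has to contain the supports of all translates with \<open>\<bar>t\<bar> \<le> 1\<close>.\<close>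
  define B where "B = (\<lambda>(x, t). x + t *\<^sub>R b) ` (A \<times> {-1..1})"
  have "compact B" unfolding B_def case_prod_beta
    by (intro compact_continuous_image compact_Times A compact_Icc continuous_intros)
  then obtain c where c: "B \<subseteq> cbox (- c) c"
    using bounded_subset_cbox_symmetric compact_imp_bounded by blast
  have AB: "A \<subseteq> cbox (- c) c"
  proof
    fix x assume "x \<in> A"
    then have "x + 0 *\<^sub>R b \<in> B" unfolding B_def by force
    then show "x \<in> cbox (- c) c" using c by auto
  qed
  define G where "G t = integral (cbox (- c) c) (\<lambda>y. g (y + t *\<^sub>R b))" for t
  have cg: "continuous_on UNIV (\<lambda>y. g (y + t *\<^sub>R b))" for t
    by (intro continuous_on_compose2[OF g] continuous_intros) auto
  have G: "G t = integral UNIV g" if "t \<in> {-1<..<1}" for t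
  proof -
    have "g (y + t *\<^sub>R b) = 0" if "y \<notin> cbox (- c) c" for y
    proof (rule A(2), rule)
      assume "y + t *\<^sub>R b \<in> A"
      then have "(y + t *\<^sub>R b) + (- t) *\<^sub>R b \<in> B"
        unfolding B_def using \<open>t \<in> {-1<..<1}\<close> by (intro image_eqI[of _ _ "(y + t *\<^sub>R b, - t)"]) auto
      then show False using that c by auto
    qed
    then have "G t = integral UNIV (\<lambda>y. g (y + t *\<^sub>R b))"
      unfolding G_def by (intro integral_compact_support(2)[symmetric, OF cg, of "cbox (- c) c"]) auto
    also have "\<dots> = integral UNIV g"
      by (rule integral_UNIV_shift[OF g AB A(2)])
    finally show ?thesis .
  qed
  have "(G has_real_derivative integral (cbox (- c) c) (\<lambda>y. D (y + 0 *\<^sub>R b))) (at 0 within {-1<..<1})"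
    unfolding G_def
  proof (rule leibniz_rule_field_derivative)
    show "((\<lambda>t. g (y + t *\<^sub>R b)) has_real_derivative D (y + t *\<^sub>R b)) (at t within {-1<..<1})" for y t
      using has_pd_along[OF D(2)] by (rule has_field_derivative_at_within)
    show "(\<lambda>y. g (y + t *\<^sub>R b)) integrable_on cbox (- c) c" for t
      using cg by (intro integrable_continuous) (auto intro: continuous_on_subset)
    show "continuous_on ({-1<..<1} \<times> cbox (- c) c) (\<lambda>(t, y). D (y + t *\<^sub>R b))"
      unfolding case_prod_beta by (intro continuous_on_compose2[OF D(1)] continuous_intros) auto
  qed auto
  then have "(G has_real_derivative integral (cbox (- c) c) D) (at 0)"
    by (simp add: at_within_open[of 0 "{-1<..<1}"])
  moreover have "(G has_real_derivative 0) (at 0)"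
    by (rule has_field_derivative_transform_within_open[of "\<lambda>_. integral UNIV g" _ _ "{-1<..<1}"])
      (auto simp: G)
  ultimately have "integral (cbox (- c) c) D = 0" by (rule DERIV_unique)
  moreover have "D x = 0" if "x \<notin> A" for x
    using pd_eqI[OF D(2)[of x]] pd_eq_0_off[OF compact_imp_closed[OF A(1)] A(2) that, where b=b] by simp
  ultimately show ?thesis
    using integral_compact_support(2)[OF D(1) AB] by simp
qed

text \<open>
  For each basis vector, \<open>h \<partial>\<^sub>b\<^sub>b \<phi> - \<phi> \<partial>\<^sub>b\<^sub>b h\<close> is the derivative along \<open>b\<close> of the compactly supported
  function \<open>h \<partial>\<^sub>b \<phi> - \<phi> \<partial>\<^sub>b h\<close>.
\<close>

lemma green_identity:
  fixes h \<phi> :: "'a::euclidean_space \<Rightarrow> real"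
  assumes "open w" and h: "C2dir w h" and "test_fn w \<phi>"
  shows "integral UNIV (\<lambda>x. h x * lap \<phi> x) = integral UNIV (\<lambda>x. lap h x * \<phi> x)"
proof -
  obtain A where A: "compact A" "A \<subseteq> w" "\<And>x. x \<notin> A \<Longrightarrow> \<phi> x = 0" and \<phi>: "C2dir UNIV \<phi>"
    using assms unfolding test_fn_def by blast
  obtain c where c: "A \<subseteq> cbox (- c) c"
    using A(1) bounded_subset_cbox_symmetric compact_imp_bounded by blast
  have clA: "closed A" using A(1) by (rule compact_imp_closed)
  have \<phi>1: "pd b \<phi> x = 0" if "x \<notin> A" for x b
    using pd_eq_0_off[OF clA A(3) that] .
  have \<phi>2: "pd b (pd b \<phi>) x = 0" if "x \<notin> A" for x b
    using pd_eq_0_off[OF clA \<phi>1 that] .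
  note glue = continuous_on_mult_off[OF \<open>open w\<close> _ _ clA A(2)]
  define D where "D b x = h x * pd b (pd b \<phi>) x - pd b (pd b h) x * \<phi> x" for b x
  have cont: "continuous_on UNIV (\<lambda>x. h x * pd b (pd b \<phi>) x)" "continuous_on UNIV (\<lambda>x. pd b (pd b h) x * \<phi> x)"
    "continuous_on UNIV (D b)"
    if "b \<in> Basis" for b
  proof -
    show "continuous_on UNIV (\<lambda>x. h x * pd b (pd b \<phi>) x)" "continuous_on UNIV (\<lambda>x. pd b (pd b h) x * \<phi> x)"
      using C2dirD(1-3)[OF h that] C2dirD(1-3)[OF \<phi> that] A(3) \<phi>2 by (auto intro!: glue)
    then show "continuous_on UNIV (D b)"
      unfolding D_def[abs_def] by (rule continuous_on_diff)
  qed
  have "integral UNIV (D b) = 0" if b: "b \<in> Basis" for b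
  proof (rule integral_directional_derivative_eq_0[where b=b and g="\<lambda>x. h x * pd b \<phi> x - pd b h x * \<phi> x"])
    show "continuous_on UNIV (D b)" by (rule cont[OF b])
    show "continuous_on UNIV (\<lambda>x. h x * pd b \<phi> x - pd b h x * \<phi> x)"
      using C2dirD(1-3)[OF h b] C2dirD(1-3)[OF \<phi> b] A(3) \<phi>1
      by (auto intro!: glue continuous_on_diff)
    show "has_pd b (\<lambda>x. h x * pd b \<phi> x - pd b h x * \<phi> x) (D b x) x" for x
    proof (cases "x \<in> A")
      case True
      then have x: "x \<in> w" using A by auto
      note h' = C2dirD(4,5)[OF h b x] and \<phi>' = C2dirD(4,5)[OF \<phi> b, of x, simplified]
      have "has_pd b (\<lambda>x. h x * pd b \<phi> x - pd b h x * \<phi> x)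
         ((h x * pd b (pd b \<phi>) x + pd b h x * pd b \<phi> x) - (pd b h x * pd b \<phi> x + pd b (pd b h) x * \<phi> x)) x"
        by (intro has_pd_diff has_pd_mult h' \<phi>')
      then show ?thesis by (simp add: D_def)
    next
      case False
      have "has_pd b (\<lambda>_. 0) 0 x" by simp
      then have "has_pd b (\<lambda>x. h x * pd b \<phi> x - pd b h x * \<phi> x) 0 x"
        using has_pd_cong[of "- A" x "\<lambda>x. h x * pd b \<phi> x - pd b h x * \<phi> x" "\<lambda>_. 0" b 0] False A(3) \<phi>1 clA by (simp add: open_Compl)
      then show ?thesis using False A(3) \<phi>2 by (simp add: D_def)
    qed
    show "h x * pd b \<phi> x - pd b h x * \<phi> x = 0" if "x \<notin> A" for x
      using that A(3) \<phi>1 by simp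
  qed (rule A(1))
  moreover have "integral UNIV (D b) = integral UNIV (\<lambda>x. h x * pd b (pd b \<phi>) x) - integral UNIV (\<lambda>x. pd b (pd b h) x * \<phi> x)"
    if b: "b \<in> Basis" for b
    unfolding D_def[abs_def]
    by (intro integral_diff integral_compact_support(1)[OF _ c] cont(1,2)[OF b]) (auto simp: A(3) \<phi>2)
  ultimately have "(\<Sum>b\<in>Basis. integral UNIV (\<lambda>x. h x * pd b (pd b \<phi>) x)) = (\<Sum>b\<in>Basis. integral UNIV (\<lambda>x. pd b (pd b h) x * \<phi> x))"
    by (intro sum.cong) auto
  also have "(\<Sum>b\<in>Basis. integral UNIV (\<lambda>x. h x * pd b (pd b \<phi>) x)) = integral UNIV (\<lambda>x. h x * lap \<phi> x)"
    unfolding lap_def sum_distrib_left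
    by (intro integral_sum[symmetric] integral_compact_support(1)[OF _ c] cont) (auto simp: \<phi>2)
  also have "(\<Sum>b\<in>Basis. integral UNIV (\<lambda>x. pd b (pd b h) x * \<phi> x)) = integral UNIV (\<lambda>x. lap h x * \<phi> x)"
    unfolding lap_def sum_distrib_right
    by (intro integral_sum[symmetric] integral_compact_support(1)[OF _ c] cont) (auto simp: A(3))
  finally show ?thesis .
qed

section \<open>The regularized Newton kernel\<close>

text \<open>
  In dimension \<open>2 m + 2\<close> the case \<open>e = 0\<close> is, up to a factor, the fundamental solution \<open>\<bar>z\<bar>\<^bsup>-2m\<^esup>\<close> of the Laplacian, with
  the default value \<open>0\<close> at the origin (for \<open>m \<ge> 1\<close>). A parameter \<open>e \<noteq> 0\<close> removes the singularity.
\<close>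

definition newton_kernel :: "nat \<Rightarrow> real \<Rightarrow> 'a::euclidean_space \<Rightarrow> real" where
  "newton_kernel m e z = inverse ((e\<^sup>2 + z \<bullet> z) ^ m)"

text \<open>
  The derivative of \<open>newton_kernel m e\<close> along \<open>b\<close>; an explicit formula, so that it makes sense at \<open>e = 0\<close> too.
\<close>

definition newton_kernel_pd :: "nat \<Rightarrow> real \<Rightarrow> 'a::euclidean_space \<Rightarrow> 'a \<Rightarrow> real" where
  "newton_kernel_pd m e b z = - 2 * real m * (z \<bullet> b) * inverse ((e\<^sup>2 + z \<bullet> z) ^ (m + 1))"

text \<open>
  Up to a factor this is the Laplacian of \<open>newton_kernel m e\<close> in dimension \<open>2 m + 2\<close>. There it is the rescaling
  \<open>e\<^bsup>-n\<^esup> g (z/e)\<close>, \<open>n = 2 m + 2\<close>, of a fixed positive function \<open>g\<close>, hence concentrates at the origin as \<open>e\<close> tends to \<open>0\<close>.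
\<close>

definition approx_delta :: "nat \<Rightarrow> real \<Rightarrow> 'a::euclidean_space \<Rightarrow> real" where
  "approx_delta m e z = e\<^sup>2 * inverse ((e\<^sup>2 + z \<bullet> z) ^ (m + 2))"

text \<open>
  The Laplacian in \<open>y\<close> of \<open>\<psi> y * newton_kernel m e (y - x)\<close> without the term in which the kernel is
  differentiated twice. For \<open>e = 0\<close> that term is zero off \<open>x\<close>; what remains vanishes wherever \<open>\<psi>\<close> is locally constant,
  so it has no singularity if \<open>\<psi>\<close> is constant near \<open>x\<close>. Integrated against this density, a harmonic function \<open>h\<close> on a
  neighbourhood of the support of \<open>\<psi>\<close> gives a dimensional constant times \<open>h x * \<psi> x\<close>.
\<close>

definition green_density :: "nat \<Rightarrow> real \<Rightarrow> ('a::euclidean_space \<Rightarrow> real) \<Rightarrow> 'a \<Rightarrow> 'a \<Rightarrow> real" where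
  "green_density m e \<psi> x y = newton_kernel m e (y - x) * lap \<psi> y + 2 * (\<Sum>b\<in>Basis. newton_kernel_pd m e b (y - x) * pd b \<psi> y)"

lemma DERIV_inverse_power:
  fixes s :: "'a::real_normed_field"
  assumes "s \<noteq> 0"
  shows "((\<lambda>s. inverse (s ^ m)) has_field_derivative - of_nat m * inverse (s ^ (m + 1))) (at s)"
proof (cases m)
  case (Suc n)
  have "((\<lambda>s::'a. s ^ m) has_field_derivative of_nat m * s ^ n) (at s)"
    using DERIV_power[OF DERIV_ident, of m s UNIV] by (simp add: Suc del: of_nat_Suc power_Suc)
  from DERIV_inverse_fun[OF this] show ?thesis
    using assms by (simp add: Suc field_simps del: of_nat_Suc)
qed simp

lemma has_pd_newton_kernel:
  fixes z :: "'a::euclidean_space"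
  assumes "e \<noteq> 0"
  shows "has_pd b (newton_kernel m e) (newton_kernel_pd m e b z) z"
    and "has_pd b (newton_kernel_pd m e b)
      (4 * real m * (real m + 1) * (z \<bullet> b)\<^sup>2 * inverse ((e\<^sup>2 + z \<bullet> z) ^ (m + 2))
        - 2 * real m * (b \<bullet> b) * inverse ((e\<^sup>2 + z \<bullet> z) ^ (m + 1))) z"
proof -
  have s: "e\<^sup>2 + z \<bullet> z \<noteq> 0" using assms by (simp add: add_nonneg_eq_0_iff)
  have "((\<lambda>t. e\<^sup>2 + ((z + t *\<^sub>R b) - 0) \<bullet> ((z + t *\<^sub>R b) - 0)) has_real_derivative 0 + 2 * ((z - 0) \<bullet> b)) (at 0)"
    using has_pd_norm_square[of b 0 z] unfolding has_pd_def by (intro DERIV_add DERIV_const)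
  then have d: "has_pd b (\<lambda>z. e\<^sup>2 + z \<bullet> z) (2 * (z \<bullet> b)) z" by (simp add: has_pd_def)
  have k: "has_pd b (\<lambda>z. inverse ((e\<^sup>2 + z \<bullet> z) ^ n)) (- real n * inverse ((e\<^sup>2 + z \<bullet> z) ^ (n + 1)) * (2 * (z \<bullet> b))) z" for n
    by (rule has_pd_compose[OF d DERIV_inverse_power[OF s]])
  show "has_pd b (newton_kernel m e) (newton_kernel_pd m e b z) z"
    using k[of m] unfolding newton_kernel_def[abs_def] newton_kernel_pd_def by (simp add: mult_ac)
  have i: "has_pd b (\<lambda>z. - 2 * real m * (z \<bullet> b)) (- 2 * real m * (b \<bullet> b)) z"
    using has_pd_mult[OF has_pd_const[of b "- 2 * real m" z] has_pd_inner[of b 0 b z]] by simp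
  have "- 2 * real m * (z \<bullet> b) * (- real (m + 1) * inverse ((e\<^sup>2 + z \<bullet> z) ^ (m + 1 + 1)) * (2 * (z \<bullet> b)))
      + - 2 * real m * (b \<bullet> b) * inverse ((e\<^sup>2 + z \<bullet> z) ^ (m + 1))
    = 4 * real m * (real m + 1) * (z \<bullet> b)\<^sup>2 * inverse ((e\<^sup>2 + z \<bullet> z) ^ (m + 2))
        - 2 * real m * (b \<bullet> b) * inverse ((e\<^sup>2 + z \<bullet> z) ^ (m + 1))"
    by (simp add: power2_eq_square algebra_simps del: power_Suc)
  then show "has_pd b (newton_kernel_pd m e b)
      (4 * real m * (real m + 1) * (z \<bullet> b)\<^sup>2 * inverse ((e\<^sup>2 + z \<bullet> z) ^ (m + 2))
        - 2 * real m * (b \<bullet> b) * inverse ((e\<^sup>2 + z \<bullet> z) ^ (m + 1))) z"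
    using has_pd_mult[OF i k[of "m + 1"]] unfolding newton_kernel_pd_def[abs_def] by metis
qed

text \<open>
  The dimension enters through the sum of the \<open>2 m + 2\<close> equal terms \<open>- 2 m (e\<^sup>2 + \<bar>z\<bar>\<^sup>2)\<^bsup>-m-1\<^esup>\<close>: it is exactly
  the value for which the contributions of \<open>\<bar>z\<bar>\<^sup>2\<close> cancel and only a multiple of \<open>e\<^sup>2\<close> is left.
\<close>

lemma C2dir_newton_kernel:
  assumes e: "e \<noteq> 0" and dim: "DIM('a::euclidean_space) = 2 * m + 2"
  shows "C2dir UNIV (newton_kernel m e :: 'a \<Rightarrow> real)"
    and "b \<in> Basis \<Longrightarrow> pd b (newton_kernel m e) (z :: 'a) = newton_kernel_pd m e b z"
    and "lap (newton_kernel m e) (z :: 'a) = - 4 * real m * (real m + 1) * approx_delta m e z"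
proof -
  define k2 where "k2 b z = 4 * real m * (real m + 1) * (z \<bullet> b)\<^sup>2 * inverse ((e\<^sup>2 + z \<bullet> z) ^ (m + 2))
        - 2 * real m * (b \<bullet> b) * inverse ((e\<^sup>2 + z \<bullet> z) ^ (m + 1))" for b z :: 'a
  have s: "e\<^sup>2 + z \<bullet> z \<noteq> 0" for z :: 'a using e by (simp add: add_nonneg_eq_0_iff)
  have c: "continuous_on UNIV (newton_kernel m e :: 'a \<Rightarrow> real)" "continuous_on UNIV (newton_kernel_pd m e b)" "continuous_on UNIV (k2 b)" for b :: 'a
    unfolding newton_kernel_def[abs_def] newton_kernel_pd_def[abs_def] k2_def[abs_def]
    using s by (auto intro!: continuous_intros)
  have d: "has_pd b (newton_kernel m e) (newton_kernel_pd m e b z) z" "has_pd b (newton_kernel_pd m e b) (k2 b z) z" for b z :: 'a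
    unfolding k2_def by (rule has_pd_newton_kernel[OF e])+
  note * = C2dirI[OF open_UNIV c(1) d c(2,3)]
  show "C2dir UNIV (newton_kernel m e :: 'a \<Rightarrow> real)" by (rule *(1))
  show "b \<in> Basis \<Longrightarrow> pd b (newton_kernel m e) (z :: 'a) = newton_kernel_pd m e b z" by (rule *(2)) auto
  have "lap (newton_kernel m e) z = (\<Sum>b\<in>Basis. k2 b z)"
    unfolding lap_def by (intro sum.cong refl *(3)) auto
  also have "\<dots> = (\<Sum>b\<in>Basis. 4 * real m * (real m + 1) * inverse ((e\<^sup>2 + z \<bullet> z) ^ (m + 2)) * ((z \<bullet> b) * (z \<bullet> b))
      - 2 * real m * inverse ((e\<^sup>2 + z \<bullet> z) ^ (m + 1)))"
    by (intro sum.cong refl) (simp add: k2_def power2_eq_square)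
  also have "\<dots> = 4 * real m * (real m + 1) * inverse ((e\<^sup>2 + z \<bullet> z) ^ (m + 2)) * (z \<bullet> z)
      - real (2 * m + 2) * (2 * real m * inverse ((e\<^sup>2 + z \<bullet> z) ^ (m + 1)))"
    by (simp only: sum_subtractf sum_distrib_left[symmetric] euclidean_inner[of z z, symmetric]) (simp add: dim)
  also have "inverse ((e\<^sup>2 + z \<bullet> z) ^ (m + 1)) = (e\<^sup>2 + z \<bullet> z) * inverse ((e\<^sup>2 + z \<bullet> z) ^ (m + 2))"
    using s[of z] by (simp add: power_add mult.assoc)
  also have "4 * real m * (real m + 1) * inverse ((e\<^sup>2 + z \<bullet> z) ^ (m + 2)) * (z \<bullet> z)
      - real (2 * m + 2) * (2 * real m * \<dots>) = - 4 * real m * (real m + 1) * approx_delta m e z"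
    unfolding approx_delta_def by (simp add: algebra_simps del: power_Suc)
  finally show "lap (newton_kernel m e) z = - 4 * real m * (real m + 1) * approx_delta m e z" .
qed

lemma lap_mult_newton_kernel:
  assumes e: "e \<noteq> 0" and dim: "DIM('a::euclidean_space) = 2 * m + 2" and \<psi>: "C2dir UNIV \<psi>"
  shows "C2dir UNIV (\<lambda>y. \<psi> y * newton_kernel m e (y - x :: 'a))"
    and "lap (\<lambda>y. \<psi> y * newton_kernel m e (y - x :: 'a)) y
      = green_density m e \<psi> x y - 4 * real m * (real m + 1) * (\<psi> y * approx_delta m e (y - x))"
proof -
  have k: "C2dir UNIV (\<lambda>y. newton_kernel m e (y + (- x)))"
    using C2dir_shift[OF C2dir_newton_kernel(1)[OF e dim]] by blast
  show "C2dir UNIV (\<lambda>y. \<psi> y * newton_kernel m e (y - x :: 'a))"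
    using C2dir_mult(1)[OF open_UNIV \<psi> k] by simp
  have "pd b (\<lambda>y. newton_kernel m e (y + (- x))) y = newton_kernel_pd m e b (y - x)" if "b \<in> Basis" for b
    using C2dir_newton_kernel(2)[OF e dim that] by (subst pd_shift) simp
  then show "lap (\<lambda>y. \<psi> y * newton_kernel m e (y - x :: 'a)) y
      = green_density m e \<psi> x y - 4 * real m * (real m + 1) * (\<psi> y * approx_delta m e (y - x))"
    using C2dir_mult(2)[OF open_UNIV \<psi> k, of y] lap_shift[of "newton_kernel m e" "- x" y]
      C2dir_newton_kernel(3)[OF e dim, of "y - x"]
    by (simp add: green_density_def mult.commute)
qed

lemma test_fn_locally_constant:
  assumes "\<And>y. y \<in> ball x r \<Longrightarrow> \<psi> y = \<psi> x" "y \<in> ball x r"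
  shows "pd b \<psi> y = 0" "lap \<psi> y = 0"
  using pd_cong[of "ball x r" y \<psi> "\<lambda>_. \<psi> x" b] lap_cong[of "ball x r" y \<psi> "\<lambda>_. \<psi> x"] assms
  by auto

lemma green_density_diff:
  assumes "C2dir UNIV f" "C2dir UNIV g"
  shows "green_density m e (\<lambda>y. f y - g y) x y = green_density m e f x y - green_density m e g x y"
proof -
  have "(\<Sum>b\<in>Basis. newton_kernel_pd m e b (y - x) * pd b (\<lambda>y. f y - g y) y)
      = (\<Sum>b\<in>Basis. newton_kernel_pd m e b (y - x) * pd b f y) - (\<Sum>b\<in>Basis. newton_kernel_pd m e b (y - x) * pd b g y)"
    by (simp add: C2dir_diff(2)[OF open_UNIV assms] right_diff_distrib sum_subtractf)
  then show ?thesis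
    by (simp add: green_density_def C2dir_diff(3)[OF open_UNIV assms] right_diff_distrib)
qed

lemma green_density_eq_0_off:
  assumes "closed A" "\<And>y. y \<notin> A \<Longrightarrow> \<psi> y = 0" "y \<notin> A"
  shows "green_density m e \<psi> x y = 0"
  using pd_eq_0_off[OF assms] lap_eq_0_off[OF assms] by (simp add: green_density_def)

text \<open>
  Joint continuity in \<open>(e, y)\<close>, including \<open>e = 0\<close>: near \<open>y = x\<close> the density is identically zero, and away from
  \<open>x\<close> the kernel is smooth in both arguments.
\<close>

lemma continuous_on_green_density:
  fixes x :: "'a::euclidean_space"
  assumes \<psi>: "C2dir UNIV \<psi>" and r: "r > 0" "\<And>y. y \<in> ball x r \<Longrightarrow> \<psi> y = \<psi> x"
  shows "continuous_on UNIV (\<lambda>(e, y). green_density m e \<psi> x y)"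
proof -
  have s: "(fst p)\<^sup>2 + (snd p - x) \<bullet> (snd p - x) \<noteq> 0" if "p \<in> UNIV \<times> (- {x})" for p :: "real \<times> 'a"
    using that by (auto simp: add_nonneg_eq_0_iff)
  have c: "continuous_on (UNIV \<times> (- {x})) (\<lambda>p. g (snd p))" if "continuous_on UNIV g" for g :: "'a \<Rightarrow> real"
    by (rule continuous_on_compose2[OF that]) (auto intro: continuous_intros)
  have 1: "continuous_on (UNIV \<times> (- {x})) (\<lambda>(e, y). green_density m e \<psi> x y)"
    unfolding case_prod_beta green_density_def newton_kernel_def newton_kernel_pd_def
    using C2dirD(2)[OF \<psi>] C2dir_lap_continuous_on[OF \<psi>] s
    by (intro continuous_intros c) (auto simp del: power_Suc)
  have "pd b \<psi> y = 0" "lap \<psi> y = 0" if "y \<in> ball x r" for b y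
    using test_fn_locally_constant[of x r \<psi> y] r(2) that by blast+
  then have "green_density m e \<psi> x y = 0" if "y \<in> ball x r" for e y
    using that by (simp add: green_density_def)
  then have 2: "continuous_on (UNIV \<times> ball x r) (\<lambda>(e, y). green_density m e \<psi> x y)"
    by (intro continuous_on_eq[OF continuous_on_const[of _ 0]]) auto
  have "continuous_on (UNIV \<times> (- {x}) \<union> UNIV \<times> ball x r) (\<lambda>(e, y). green_density m e \<psi> x y)"
    by (intro continuous_on_open_Un open_Times 1 2) auto
  moreover have "(UNIV :: real set) \<times> (- {x}) \<union> UNIV \<times> ball x r = UNIV"
    using r(1) by auto
  ultimately show ?thesis by simp
qed

lemma continuous_on_green_density_fixed:
  fixes x :: "'a::euclidean_space"
  assumes "C2dir UNIV \<psi>" "r > 0" "\<And>y. y \<in> ball x r \<Longrightarrow> \<psi> y = \<psi> x"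
  shows "continuous_on UNIV (green_density m e \<psi> x)"
proof -
  have "continuous_on UNIV (\<lambda>y::'a. (e, y))"
    by (intro continuous_on_Pair continuous_on_const continuous_on_id)
  from continuous_on_compose2[OF continuous_on_green_density[OF assms, of m] this] show ?thesis
    by simp
qed

lemma continuous_on_approx_delta: "e \<noteq> 0 \<Longrightarrow> continuous_on S (\<lambda>y. approx_delta m e (y - x))"
  unfolding approx_delta_def by (intro continuous_intros) (auto simp: add_nonneg_eq_0_iff)

lemma approx_delta_nonneg: "approx_delta m e z \<ge> 0"
  by (simp add: approx_delta_def)

section \<open>The reproducing formula for harmonic functions\<close>

text \<open>
  Green's identity for the harmonic \<open>h\<close> and the test function \<open>\<psi> y * newton_kernel m e (y - x)\<close>, which is regular
  as \<open>e \<noteq> 0\<close>.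
\<close>

lemma green_density_integral_regularized:
  fixes h \<psi> :: "'a::euclidean_space \<Rightarrow> real"
  assumes e: "e \<noteq> 0" and dim: "DIM('a) = 2 * m + 2"
    and h: "open w" "C2dir w h" "\<And>y. y \<in> w \<Longrightarrow> lap h y = 0"
    and \<psi>: "test_fn w \<psi>" and r: "r > 0" "\<And>y. y \<in> ball x r \<Longrightarrow> \<psi> y = \<psi> x"
  shows "integral UNIV (\<lambda>y. h y * green_density m e \<psi> x y)
    = 4 * real m * (real m + 1) * integral UNIV (\<lambda>y. (h y * \<psi> y) * approx_delta m e (y - x))"
proof -
  obtain A where A: "compact A" "A \<subseteq> w" "\<And>x. x \<notin> A \<Longrightarrow> \<psi> x = 0" and \<psi>2: "C2dir UNIV \<psi>"
    using \<psi> unfolding test_fn_def by blast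
  obtain c where c: "A \<subseteq> cbox (- c) c"
    using A(1) bounded_subset_cbox_symmetric compact_imp_bounded by blast
  note clA = compact_imp_closed[OF A(1)]
  define \<phi> where "\<phi> = (\<lambda>y. \<psi> y * newton_kernel m e (y - x))"
  note k = lap_mult_newton_kernel[OF e dim \<psi>2, of x, folded \<phi>_def]
  have "test_fn w \<phi>"
    unfolding test_fn_def using A k(1) by (intro conjI exI[of _ A]) (auto simp: \<phi>_def)
  then have "integral UNIV (\<lambda>y. h y * lap \<phi> y) = integral UNIV (\<lambda>y. lap h y * \<phi> y)"
    by (rule green_identity[OF h(1,2)])
  also have "(\<lambda>y. lap h y * \<phi> y) = (\<lambda>_. 0)"
    using h(3) A by (fastforce simp: \<phi>_def)
  finally have 0: "integral UNIV (\<lambda>y. h y * lap \<phi> y) = 0" by simp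
  have "continuous_on UNIV (green_density m e \<psi> x)"
    using continuous_on_green_density_fixed[OF \<psi>2 r(1), of x m e] r(2) by blast
  then have c1: "continuous_on UNIV (\<lambda>y. h y * green_density m e \<psi> x y)"
    by (rule continuous_on_mult_off[OF h(1) C2dir_continuous_on[OF h(2)] _ clA A(2)])
      (rule green_density_eq_0_off[OF clA A(3)])
  have "continuous_on UNIV (\<lambda>y. h y * \<psi> y)"
    by (rule continuous_on_mult_off[OF h(1) C2dir_continuous_on[OF h(2)] C2dir_continuous_on[OF \<psi>2] clA A(2,3)])
  then have c2: "continuous_on UNIV (\<lambda>y. (h y * \<psi> y) * approx_delta m e (y - x))"
    by (rule continuous_on_mult[OF _ continuous_on_approx_delta[OF e]])
  have "(\<lambda>y. h y * lap \<phi> y) = (\<lambda>y. h y * green_density m e \<psi> x y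
      - (4 * real m * (real m + 1)) * ((h y * \<psi> y) * approx_delta m e (y - x)))"
    by (auto simp: k(2) algebra_simps)
  with 0 have "0 = integral UNIV (\<lambda>y. h y * green_density m e \<psi> x y
      - (4 * real m * (real m + 1)) * ((h y * \<psi> y) * approx_delta m e (y - x)))" by simp
  also have "\<dots> = integral UNIV (\<lambda>y. h y * green_density m e \<psi> x y)
      - integral UNIV (\<lambda>y. (4 * real m * (real m + 1)) * ((h y * \<psi> y) * approx_delta m e (y - x)))"
    by (intro integral_diff integrable_on_mult_right integral_compact_support(1)[OF c1 c] integral_compact_support(1)[OF c2 c])
      (auto simp: A(3) green_density_eq_0_off[OF clA A(3)])
  finally show ?thesis by simp
qed

lemma green_density_integral_tendsto:
  fixes h \<psi> :: "'a::euclidean_space \<Rightarrow> real"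
  assumes h: "open w" "continuous_on w h"
    and \<psi>: "test_fn w \<psi>" and r: "r > 0" "\<And>y. y \<in> ball x r \<Longrightarrow> \<psi> y = \<psi> x"
  shows "((\<lambda>e. integral UNIV (\<lambda>y. h y * green_density m e \<psi> x y)) \<longlongrightarrow> integral UNIV (\<lambda>y. h y * green_density m 0 \<psi> x y)) (at_right 0)"
proof -
  obtain A where A: "compact A" "A \<subseteq> w" "\<And>x. x \<notin> A \<Longrightarrow> \<psi> x = 0" and \<psi>2: "C2dir UNIV \<psi>"
    using \<psi> unfolding test_fn_def by blast
  obtain c where c: "A \<subseteq> cbox (- c) c"
    using A(1) bounded_subset_cbox_symmetric compact_imp_bounded by blast
  note clA = compact_imp_closed[OF A(1)]
  have "continuous_on UNIV (\<lambda>p :: real \<times> 'a. h (snd p) * (case p of (e, y) \<Rightarrow> green_density m e \<psi> x y))"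
  proof (rule continuous_on_mult_off[of "UNIV \<times> w" _ _ "UNIV \<times> A"])
    show "continuous_on (UNIV \<times> w) (\<lambda>p :: real \<times> 'a. h (snd p))"
      by (rule continuous_on_compose2[OF h(2)]) (auto intro: continuous_intros)
  qed (use A(2) in \<open>auto intro!: open_Times h(1) continuous_on_green_density[OF \<psi>2 r] closed_Times clA green_density_eq_0_off[OF clA A(3)]\<close>)
  then have "continuous_on (UNIV \<times> cbox (- c) c) (\<lambda>(e, y). h y * green_density m e \<psi> x y)"
    by (rule continuous_on_subset[THEN continuous_on_eq]) auto
  then have "continuous_on UNIV (\<lambda>e. integral (cbox (- c) c) (\<lambda>y. h y * green_density m e \<psi> x y))"
    by (rule integral_continuous_on_param)
  moreover have "integral (cbox (- c) c) (\<lambda>y. h y * green_density m e \<psi> x y) = integral UNIV (\<lambda>y. h y * green_density m e \<psi> x y)" for e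
    by (rule integral_compact_support(2)[symmetric, OF _ c])
      (auto intro!: continuous_on_mult_off[OF h continuous_on_green_density_fixed[OF \<psi>2 r] clA A(2)] simp: green_density_eq_0_off[OF clA A(3)])
  ultimately have "isCont (\<lambda>e. integral UNIV (\<lambda>y. h y * green_density m e \<psi> x y)) 0"
    by (simp add: continuous_on_eq_continuous_at)
  then show ?thesis
    unfolding isCont_def by (rule filterlim_mono) (auto simp: at_le)
qed

text \<open>
  For one cutoff \<open>\<eta>\<close> around the origin, the integrals of \<open>\<eta> * approx_delta m e\<close> converge by Green's identity with \<open>h = 1\<close>; the limit
  \<open>C\<close> is positive because on the ball of radius \<open>e\<close> the integrand is at least a constant times \<open>e\<^bsup>-n\<^esup>\<close>, \<open>n = 2 m + 2\<close>. A general \<open>g\<close> is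
  compared with \<open>g x\<close> times the translate of \<open>\<eta>\<close>: the difference \<open>f\<close> vanishes at \<open>x\<close>, and off a fixed ball
  around \<open>x\<close> the kernel is of order \<open>e\<^sup>2\<close>.
\<close>

lemma approx_delta_converges:
  assumes dim: "DIM('a::euclidean_space) = 2 * m + 2" and m: "m \<ge> 1"
  obtains C where "C > 0"
    "\<And>(g :: 'a \<Rightarrow> real) x A. continuous_on UNIV g \<Longrightarrow> compact A \<Longrightarrow> (\<And>y. y \<notin> A \<Longrightarrow> g y = 0) \<Longrightarrow>
      ((\<lambda>e. integral UNIV (\<lambda>y. g y * approx_delta m e (y - x))) \<longlongrightarrow> C * g x) (at_right 0)"
proof -
  obtain \<eta> :: "'a \<Rightarrow> real" and V where \<eta>: "test_fn UNIV \<eta>" "\<And>x. 0 \<le> \<eta> x"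
    and V: "cball 0 1 \<subseteq> V" "\<And>x. x \<in> V \<Longrightarrow> \<eta> x = 1"
    by (rule cutoff_exists[of "cball (0 :: 'a) 1" UNIV]) auto
  have \<eta>1: "\<eta> y = 1" if "norm y \<le> 1" for y using V that by auto
  obtain A0 where A0: "compact A0" "\<And>y. y \<notin> A0 \<Longrightarrow> \<eta> y = 0" and \<eta>2: "C2dir UNIV \<eta>"
    using \<eta>(1) unfolding test_fn_def by blast
  note c\<eta> = C2dir_continuous_on[OF \<eta>2]
  have box: "\<exists>c. B \<subseteq> cbox (- c) c" if "compact B" for B :: "'a set"
    using bounded_subset_cbox_symmetric[OF compact_imp_bounded[OF that]] by metis
  obtain c0 where c0: "A0 \<subseteq> cbox (- c0) c0" using box[OF A0(1)] by blast
  define I where "I e = integral UNIV (\<lambda>y. \<eta> y * approx_delta m e y)" for e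
  define M where "M = 4 * real m * (real m + 1)"
  have "M > 0" using m by (simp add: M_def)
  define C where "C = integral UNIV (\<lambda>y. 1 * green_density m 0 \<eta> 0 y) / M"
  have cont: "continuous_on UNIV (\<lambda>y. \<eta> y * approx_delta m e y)" if "e \<noteq> 0" for e
    using continuous_on_mult[OF c\<eta> continuous_on_approx_delta[OF that, of UNIV m 0]] by simp
  have int: "(\<lambda>y. \<eta> y * approx_delta m e y) integrable_on UNIV" if "e \<noteq> 0" for e
    by (rule integral_compact_support(1)[OF cont[OF that] c0]) (simp add: A0)
  have eq: "integral UNIV (\<lambda>y. 1 * green_density m e \<eta> 0 y) = M * I e" if "e \<noteq> 0" for e
    using green_density_integral_regularized[OF that dim open_UNIV, of "\<lambda>_. 1" \<eta> 1 0] \<eta>(1) \<eta>1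
    by (simp add: M_def I_def C2dir_const)
  have "((\<lambda>e. integral UNIV (\<lambda>y. 1 * green_density m e \<eta> 0 y) / M) \<longlongrightarrow> C) (at_right 0)"
    unfolding C_def using \<eta>(1) \<eta>1 \<open>M > 0\<close>
    by (intro tendsto_divide tendsto_const green_density_integral_tendsto[of UNIV _ _ 1]) auto
  then have I: "(I \<longlongrightarrow> C) (at_right 0)"
    by (rule Lim_transform_eventually)
      (use \<open>M > 0\<close> eq in \<open>auto simp: eventually_at_filter\<close>)
  define v where "v = measure lborel (ball (0 :: 'a) 1)"
  have v: "v > 0" unfolding v_def by (rule content_ball_pos) simp
  have lower: "v / 2 ^ (m + 2) \<le> I e" if e: "0 < e" "e < 1" for e
  proof -
    define \<kappa> where "\<kappa> = e\<^sup>2 * inverse ((2 * e\<^sup>2) ^ (m + 2))"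
    have "(indicator (ball (0 :: 'a) e) has_integral measure lborel (ball (0 :: 'a) e)) UNIV"
      using lmeasurable_iff_indicator_has_integral[of "ball (0 :: 'a) e" "measure lborel (ball (0 :: 'a) e)"] by simp
    then have 1: "((\<lambda>y :: 'a. indicator (ball 0 e) y * \<kappa>) has_integral measure lborel (ball (0 :: 'a) e) * \<kappa>) UNIV"
      by (rule has_integral_mult_left)
    have 2: "((\<lambda>y :: 'a. \<eta> y * approx_delta m e y) has_integral I e) UNIV"
      unfolding I_def using int[of e] e by (intro integrable_integral) auto
    have "measure lborel (ball (0 :: 'a) e) * \<kappa> \<le> I e"
    proof (rule has_integral_le[OF 1 2])
      fix y :: 'a
      show "indicator (ball 0 e) y * \<kappa> \<le> \<eta> y * approx_delta m e y"
      proof (cases "norm y < e")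
        case True
        then have "y \<bullet> y \<le> e\<^sup>2" by (simp add: dot_square_norm power_mono)
        then have "(e\<^sup>2 + y \<bullet> y) ^ (m + 2) \<le> (2 * e\<^sup>2) ^ (m + 2)"
          by (intro power_mono) auto
        moreover have "0 < (e\<^sup>2 + y \<bullet> y) ^ (m + 2)" using e by (intro zero_less_power) (simp add: add_pos_nonneg)
        ultimately have "\<kappa> \<le> approx_delta m e y"
          unfolding \<kappa>_def approx_delta_def by (intro mult_left_mono le_imp_inverse_le) auto
        then show ?thesis using True \<eta>1[of y] e by simp
      qed (simp add: \<eta>(2) approx_delta_nonneg)
    qed
    moreover have "measure lborel (ball (0 :: 'a) e) = e ^ (2 * m + 2) * v"
      using content_ball_conv_unit_ball[of e "0 :: 'a"] e by (simp add: v_def dim)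
    moreover have "e ^ (2 * m + 2) * v * \<kappa> = v / 2 ^ (m + 2)"
    proof -
      have "(2 * e\<^sup>2) ^ (m + 2) = 2 ^ (m + 2) * (e ^ (2 * m + 2) * e\<^sup>2)"
        by (simp add: power_mult_distrib power_mult[symmetric] power_add[symmetric] del: power_Suc)
      then show ?thesis using e by (simp add: \<kappa>_def divide_simps del: power_Suc)
    qed
    ultimately show ?thesis by simp
  qed
  have "C \<ge> v / 2 ^ (m + 2)"
  proof (rule tendsto_lowerbound[OF I])
    show "\<forall>\<^sub>F e in at_right 0. v / 2 ^ (m + 2) \<le> I e"
      using lower eventually_at_right_real[of 0 "1::real"] by (auto elim!: eventually_mono)
  qed simp
  moreover have "v / 2 ^ (m + 2) > 0" using v by simp
  ultimately have C: "C > 0" by linarith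
  show thesis
  proof (rule that[OF C])
    fix g :: "'a \<Rightarrow> real" and x A
    assume g: "continuous_on UNIV g" and A: "compact A" "\<And>y. y \<notin> A \<Longrightarrow> g y = 0"
    define f where "f y = g y - g x * \<eta> (y - x)" for y
    define A1 where "A1 = A \<union> (+) x ` A0"
    have "compact A1" unfolding A1_def by (intro compact_Un A(1) compact_translation A0(1))
    then obtain c where c: "A1 \<subseteq> cbox (- c) c" using box[OF \<open>compact A1\<close>] by blast
    have s1: "\<eta> (y - x) = 0" "f y = 0" "g y = 0" if "y \<notin> A1" for y
    proof -
      have "y - x \<notin> A0"
      proof
        assume "y - x \<in> A0"
        then have "x + (y - x) \<in> (+) x ` A0" by (rule imageI)
        then show False using that by (simp add: A1_def)
      qed
      then show "\<eta> (y - x) = 0" by (rule A0(2))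
      moreover show "g y = 0" using that by (intro A(2)) (auto simp: A1_def)
      ultimately show "f y = 0" by (simp add: f_def)
    qed
    have c\<eta>x: "continuous_on UNIV (\<lambda>y. \<eta> (y - x))"
      by (rule continuous_on_compose2[OF c\<eta>]) (auto intro: continuous_intros)
    have cf: "continuous_on UNIV f" unfolding f_def[abs_def]
      by (intro continuous_intros g c\<eta>x)
    have ints: "(\<lambda>y. \<eta> (y - x) * approx_delta m e (y - x)) integrable_on UNIV"
      "(\<lambda>y. f y * approx_delta m e (y - x)) integrable_on UNIV" if "e \<noteq> 0" for e
      using continuous_on_mult[OF c\<eta>x continuous_on_approx_delta[OF that]] continuous_on_mult[OF cf continuous_on_approx_delta[OF that]]
      by (auto intro!: integral_compact_support(1)[OF _ c] simp: s1)
    have ints3: "(\<lambda>y. \<bar>f y\<bar>) integrable_on UNIV"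
      using cf by (auto intro!: integral_compact_support(1)[OF _ c] continuous_on_rabs simp: s1)
    have Ix: "integral UNIV (\<lambda>y. \<eta> (y - x) * approx_delta m e (y - x)) = I e" if "e \<noteq> 0" for e
      using integral_UNIV_shift[OF cont[OF that] c0, of "- x"] A0(2) by (simp add: I_def)
    have f0: "((\<lambda>e. integral UNIV (\<lambda>y. f y * approx_delta m e (y - x))) \<longlongrightarrow> 0) (at_right 0)"
    proof (rule tendstoI)
      fix \<epsilon> :: real assume "\<epsilon> > 0"
      define \<theta> where "\<theta> = \<epsilon> / (2 * (C + 1))"
      have \<theta>: "\<theta> > 0" using \<open>\<epsilon> > 0\<close> C by (simp add: \<theta>_def)
      have "f x = 0" by (simp add: f_def \<eta>1)
      moreover have "isCont f x" using cf by (simp add: continuous_on_eq_continuous_at)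
      ultimately obtain \<delta>0 where \<delta>0: "\<delta>0 > 0" "\<And>y. dist y x < \<delta>0 \<Longrightarrow> \<bar>f y\<bar> < \<theta>"
        using \<theta> unfolding continuous_at_eps_delta by (auto simp: dist_real_def)
      define \<delta> where "\<delta> = min \<delta>0 1"
      have \<delta>: "\<delta> > 0" "\<delta> \<le> 1" "\<And>y. dist y x < \<delta> \<Longrightarrow> \<bar>f y\<bar> < \<theta>" using \<delta>0 by (auto simp: \<delta>_def)
      define B where "B = inverse ((\<delta>\<^sup>2) ^ (m + 2))"
      have B: "B > 0" using \<delta> by (simp add: B_def)
      define N where "N = integral UNIV (\<lambda>y. \<bar>f y\<bar>)"
      have "((\<lambda>e. e\<^sup>2 * B * N) \<longlongrightarrow> 0\<^sup>2 * B * N) (at_right (0::real))" by (intro tendsto_intros)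
      then have ev1: "\<forall>\<^sub>F e in at_right 0. e\<^sup>2 * B * N < \<epsilon> / 2"
        using \<open>\<epsilon> > 0\<close> by (intro order_tendstoD(2)) auto
      have ev2: "\<forall>\<^sub>F e in at_right 0. I e < C + 1" by (rule order_tendstoD(2)[OF I]) simp
      show "\<forall>\<^sub>F e in at_right 0. dist (integral UNIV (\<lambda>y. f y * approx_delta m e (y - x))) 0 < \<epsilon>"
        using ev1 ev2 eventually_at_right_less[of 0]
      proof eventually_elim
        case (elim e)
        then have e: "e \<noteq> 0" by simp
        have "norm (integral UNIV (\<lambda>y. f y * approx_delta m e (y - x)))
          \<le> integral UNIV (\<lambda>y. \<theta> * (\<eta> (y - x) * approx_delta m e (y - x)) + e\<^sup>2 * B * \<bar>f y\<bar>)"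
        proof (rule integral_norm_bound_integral)
          show "(\<lambda>y. \<theta> * (\<eta> (y - x) * approx_delta m e (y - x)) + e\<^sup>2 * B * \<bar>f y\<bar>) integrable_on UNIV"
            by (intro integrable_add integrable_on_mult_right ints ints3 e)
          fix y
          show "norm (f y * approx_delta m e (y - x)) \<le> \<theta> * (\<eta> (y - x) * approx_delta m e (y - x)) + e\<^sup>2 * B * \<bar>f y\<bar>"
          proof (cases "dist y x < \<delta>")
            case True
            then have "\<eta> (y - x) = 1" using \<delta> by (intro \<eta>1) (simp add: dist_norm)
            moreover have "\<bar>f y\<bar> * approx_delta m e (y - x) \<le> \<theta> * approx_delta m e (y - x)"
              using \<delta>(3)[OF True] by (intro mult_right_mono approx_delta_nonneg) simp
            moreover have "0 \<le> e\<^sup>2 * B * \<bar>f y\<bar>" using B by simp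
            ultimately show ?thesis by (simp add: abs_mult approx_delta_nonneg)
          next
            case False
            then have "\<delta>\<^sup>2 \<le> (y - x) \<bullet> (y - x)"
              using \<delta> by (simp add: dot_square_norm dist_norm power_mono)
            then have "(\<delta>\<^sup>2) ^ (m + 2) \<le> (e\<^sup>2 + (y - x) \<bullet> (y - x)) ^ (m + 2)"
              by (intro power_mono add_increasing) auto
            then have "approx_delta m e (y - x) \<le> e\<^sup>2 * B"
              unfolding approx_delta_def B_def using \<delta> by (intro mult_left_mono le_imp_inverse_le) auto
            then have "\<bar>f y\<bar> * approx_delta m e (y - x) \<le> \<bar>f y\<bar> * (e\<^sup>2 * B)"
              by (intro mult_left_mono) auto
            moreover have "0 \<le> \<theta> * (\<eta> (y - x) * approx_delta m e (y - x))"
              using \<theta> \<eta>(2) by (intro mult_nonneg_nonneg approx_delta_nonneg) auto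
            ultimately show ?thesis by (simp add: abs_mult approx_delta_nonneg mult_ac)
          qed
        qed (rule ints(2)[OF e])
        also have "\<dots> = \<theta> * I e + e\<^sup>2 * B * N"
          using ints[OF e] ints3 by (simp add: integral_add integrable_on_mult_right Ix[OF e] N_def)
        also have "\<dots> < \<theta> * (C + 1) + \<epsilon> / 2"
          using elim \<theta> by (intro add_strict_mono mult_strict_left_mono) auto
        also have "\<dots> = \<epsilon>" using C by (simp add: \<theta>_def field_simps)
        finally show ?case by simp
      qed
    qed
    have "integral UNIV (\<lambda>y. f y * approx_delta m e (y - x)) + g x * I e = integral UNIV (\<lambda>y. g y * approx_delta m e (y - x))"
      if e: "e \<noteq> 0" for e
    proof -
      have "(\<lambda>y. g y * approx_delta m e (y - x)) = (\<lambda>y. f y * approx_delta m e (y - x) + g x * (\<eta> (y - x) * approx_delta m e (y - x)))"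
        by (auto simp: f_def algebra_simps)
      then show ?thesis
        using ints[OF e] by (simp add: integral_add integrable_on_mult_right Ix[OF e])
    qed
    then have "\<forall>\<^sub>F e in at_right 0. integral UNIV (\<lambda>y. f y * approx_delta m e (y - x)) + g x * I e
        = integral UNIV (\<lambda>y. g y * approx_delta m e (y - x))"
      by (simp add: eventually_at_filter)
    moreover have "((\<lambda>e. integral UNIV (\<lambda>y. f y * approx_delta m e (y - x)) + g x * I e) \<longlongrightarrow> 0 + g x * C) (at_right 0)"
      by (intro tendsto_intros f0 I)
    ultimately show "((\<lambda>e. integral UNIV (\<lambda>y. g y * approx_delta m e (y - x))) \<longlongrightarrow> C * g x) (at_right 0)"
      using Lim_transform_eventually by (fastforce simp: mult.commute)
  qed
qed

text \<open>
  The normalizing constant of the reproducing formula depends only on the dimension. It is characterized by the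
  formula rather than by a value, since it arises as the limit of integrals of \<open>approx_delta\<close>.
\<close>

definition green_constant :: "'a::euclidean_space itself \<Rightarrow> nat \<Rightarrow> real \<Rightarrow> bool" where
  "green_constant _ m C \<longleftrightarrow> C > 0 \<and>
    (\<forall>w (h :: 'a \<Rightarrow> real) \<psi> r x. open w \<longrightarrow> C2dir w h \<longrightarrow> (\<forall>y\<in>w. lap h y = 0) \<longrightarrow> test_fn w \<psi> \<longrightarrow>
      r > 0 \<longrightarrow> (\<forall>y\<in>ball x r. \<psi> y = \<psi> x) \<longrightarrow>
      integral UNIV (\<lambda>y. h y * green_density m 0 \<psi> x y) = C * (h x * \<psi> x))"

text \<open>
  Let \<open>e\<close> tend to \<open>0\<close> in \<open>green_density_integral_regularized\<close>.
\<close>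

lemma green_constant_exists:
  assumes dim: "DIM('a::euclidean_space) = 2 * m + 2" and m: "m \<ge> 1"
  shows "\<exists>C. green_constant TYPE('a) m C"
proof -
  obtain C where C: "C > 0"
    "\<And>(g :: 'a \<Rightarrow> real) x A. continuous_on UNIV g \<Longrightarrow> compact A \<Longrightarrow> (\<And>y. y \<notin> A \<Longrightarrow> g y = 0) \<Longrightarrow>
      ((\<lambda>e. integral UNIV (\<lambda>y. g y * approx_delta m e (y - x))) \<longlongrightarrow> C * g x) (at_right 0)"
    using approx_delta_converges[OF dim m] by blast
  define M where "M = 4 * real m * (real m + 1)"
  have "M > 0" using m by (simp add: M_def)
  have "green_constant TYPE('a) m (M * C)"
    unfolding green_constant_def
  proof (intro conjI allI impI)
    fix w and h :: "'a \<Rightarrow> real" and \<psi> x and r :: real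
    assume a: "open w" "C2dir w h" "\<forall>y\<in>w. lap h y = 0" and \<psi>: "test_fn w \<psi>"
      and b: "r > 0" "\<forall>y\<in>ball x r. \<psi> y = \<psi> x"
    note h = a(1,2) bspec[OF a(3)] and r = b(1) bspec[OF b(2)]
    obtain A where A: "compact A" "A \<subseteq> w" "\<And>x. x \<notin> A \<Longrightarrow> \<psi> x = 0" and \<psi>2: "C2dir UNIV \<psi>"
      using \<psi> unfolding test_fn_def by blast
    have "continuous_on UNIV (\<lambda>y. h y * \<psi> y)"
      by (rule continuous_on_mult_off[OF h(1) C2dir_continuous_on[OF h(2)] C2dir_continuous_on[OF \<psi>2]
            compact_imp_closed[OF A(1)] A(2,3)])
    then have "((\<lambda>e. M * integral UNIV (\<lambda>y. (h y * \<psi> y) * approx_delta m e (y - x))) \<longlongrightarrow> M * (C * (h x * \<psi> x))) (at_right 0)"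
      by (intro tendsto_intros C(2)[OF _ A(1)]) (simp_all add: A(3))
    moreover have "integral UNIV (\<lambda>y. h y * green_density m e \<psi> x y) = M * integral UNIV (\<lambda>y. (h y * \<psi> y) * approx_delta m e (y - x))"
      if "e \<noteq> 0" for e
      unfolding M_def by (rule green_density_integral_regularized[OF that dim h \<psi> r])
    then have "\<forall>\<^sub>F e in at_right 0. M * integral UNIV (\<lambda>y. (h y * \<psi> y) * approx_delta m e (y - x)) = integral UNIV (\<lambda>y. h y * green_density m e \<psi> x y)"
      by (simp add: eventually_at_filter)
    ultimately have "((\<lambda>e. integral UNIV (\<lambda>y. h y * green_density m e \<psi> x y)) \<longlongrightarrow> M * (C * (h x * \<psi> x))) (at_right 0)"
      by (rule Lim_transform_eventually)
    from tendsto_unique[OF _ this green_density_integral_tendsto[OF h(1) C2dir_continuous_on[OF h(2)] \<psi> r]]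
    show "integral UNIV (\<lambda>y. h y * green_density m 0 \<psi> x y) = M * C * (h x * \<psi> x)"
      by (simp add: mult.assoc)
  qed (use C \<open>M > 0\<close> in auto)
  then show ?thesis ..
qed

lemma green_constantD:
  fixes h :: "'a::euclidean_space \<Rightarrow> real"
  assumes "green_constant TYPE('a) m C" "open w" "C2dir w h" "\<And>y. y \<in> w \<Longrightarrow> lap h y = 0" "test_fn w \<psi>"
    and "r > 0" "\<And>y. y \<in> ball x r \<Longrightarrow> \<psi> y = \<psi> x"
  shows "integral UNIV (\<lambda>y. h y * green_density m 0 \<psi> x y) = C * (h x * \<psi> x)"
  by (rule assms(1)[unfolded green_constant_def, THEN conjunct2, rule_format, OF assms(2-7)])

lemma green_constant_pos: "green_constant TYPE('a::euclidean_space) m C \<Longrightarrow> C > 0"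
  by (simp only: green_constant_def)

section \<open>Unique continuation\<close>

text \<open>
  The squared distance from \<open>y\<close> to the point \<open>a + t v\<close>, as a polynomial in a complex parameter \<open>t\<close>.
\<close>

definition complex_sq_dist :: "'a::euclidean_space \<Rightarrow> 'a \<Rightarrow> complex \<Rightarrow> 'a \<Rightarrow> complex" where
  "complex_sq_dist a v t y = of_real ((y - a) \<bullet> (y - a)) - 2 * t * of_real (v \<bullet> (y - a)) + t\<^sup>2 * of_real (v \<bullet> v)"

lemma complex_sq_dist_of_real:
  "complex_sq_dist a v (of_real t) y = of_real ((y - (a + t *\<^sub>R v)) \<bullet> (y - (a + t *\<^sub>R v)))"
proof -
  have "(w - t *\<^sub>R v) \<bullet> (w - t *\<^sub>R v) = w \<bullet> w - 2 * t * (v \<bullet> w) + t\<^sup>2 * (v \<bullet> v)" for w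
    by (simp add: inner_diff_left inner_diff_right inner_commute[of w v] power2_eq_square algebra_simps)
  from this[of "y - a"] show ?thesis
    by (simp add: complex_sq_dist_def diff_diff_eq)
qed

text \<open>
  With \<open>D = \<bar>y - a\<bar>\<close> and \<open>s = \<bar>t\<bar> \<bar>v\<bar> < D/3\<close> the terms containing \<open>t\<close> are at most \<open>2 s D + s\<^sup>2 < D\<^sup>2\<close> in modulus.
\<close>

lemma complex_sq_dist_nonzero:
  assumes "norm t * norm v < norm (y - a) / 3"
  shows "complex_sq_dist a v t y \<noteq> 0"
proof
  define D where "D = norm (y - a)"
  define s where "s = norm t * norm v"
  have s: "0 \<le> s" "s < D / 3" using assms by (simp_all add: s_def D_def)
  assume "complex_sq_dist a v t y = 0"
  then have "of_real ((y - a) \<bullet> (y - a)) = 2 * t * of_real (v \<bullet> (y - a)) - t\<^sup>2 * of_real (v \<bullet> v)"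
    by (simp add: complex_sq_dist_def algebra_simps)
  then have "norm (of_real ((y - a) \<bullet> (y - a)) :: complex) \<le> norm (2 * t * of_real (v \<bullet> (y - a))) + norm (t\<^sup>2 * of_real (v \<bullet> v))"
    by (metis norm_triangle_ineq4)
  then have "D\<^sup>2 \<le> 2 * norm t * \<bar>v \<bullet> (y - a)\<bar> + (norm t)\<^sup>2 * (norm v)\<^sup>2"
    by (simp add: D_def norm_mult norm_power dot_square_norm)
  also have "2 * norm t * \<bar>v \<bullet> (y - a)\<bar> \<le> 2 * norm t * (norm v * D)"
    unfolding D_def by (intro mult_left_mono Cauchy_Schwarz_ineq2) auto
  also have "2 * norm t * (norm v * D) + (norm t)\<^sup>2 * (norm v)\<^sup>2 = 2 * s * D + s\<^sup>2"
    by (simp add: s_def power_mult_distrib)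
  also have "\<dots> \<le> 2 * (D / 3) * D + (D / 3)\<^sup>2"
    using s by (intro add_mono mult_right_mono power_mono) auto
  also have "\<dots> < D\<^sup>2" using s by (simp add: power2_eq_square)
  finally show False by simp
qed

text \<open>
  On the disc \<open>\<bar>t\<bar> < 2\<close> the condition \<open>\<bar>v\<bar> < r/8\<close> gives \<open>\<bar>t\<bar> \<bar>v\<bar> < r/4\<close>, so the kernel is regular for
  \<open>\<bar>y - a\<bar> > 3 r/4\<close>, while the coefficients vanish for \<open>\<bar>y - a\<bar> < r\<close>. The two regions overlap, which makes the
  integrand continuous everywhere.
\<close>

lemma holomorphic_integral_complex_sq_dist:
  fixes \<alpha> \<beta> :: "'a::euclidean_space \<Rightarrow> real" and n :: nat
  assumes "continuous_on UNIV \<alpha>" "continuous_on UNIV \<beta>" and r: "r > 0" "norm v < r / 8"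
    and zero: "\<And>y. y \<in> ball a r \<Longrightarrow> \<alpha> y = 0" "\<And>y. y \<in> ball a r \<Longrightarrow> \<beta> y = 0"
  defines "F \<equiv> \<lambda>t y. (of_real (\<alpha> y) + t * of_real (\<beta> y)) * inverse (complex_sq_dist a v t y ^ n)"
  shows "(\<lambda>t. integral (cbox c d) (F t)) holomorphic_on ball 0 2"
    and "t \<in> ball 0 2 \<Longrightarrow> F t integrable_on cbox c d"
proof -
  define Q where "Q t y = - 2 * of_real (v \<bullet> (y - a)) + 2 * t * of_real (v \<bullet> v)" for t :: complex and y
  define F' where "F' t y = of_real (\<beta> y) * inverse (complex_sq_dist a v t y ^ n)
    + (of_real (\<alpha> y) + t * of_real (\<beta> y)) * (- of_nat n * inverse (complex_sq_dist a v t y ^ (n + 1)) * Q t y)" for t y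
  define O1 where "O1 = (ball 0 2 :: complex set) \<times> {y. 3 * r / 4 < norm (y - a)}"
  define O2 where "O2 = (ball 0 2 :: complex set) \<times> ball a r"
  have op: "open O1" "open O2" "O1 \<union> O2 = ball 0 2 \<times> UNIV"
    using r by (auto simp: O1_def O2_def dist_norm norm_minus_commute
        intro!: open_Times open_Collect_less continuous_intros)
  have nz: "complex_sq_dist a v t y \<noteq> 0" if "(t, y) \<in> O1" for t y
  proof (rule complex_sq_dist_nonzero)
    have "norm t * norm v \<le> 2 * (r / 8)"
      using that r by (intro mult_mono) (auto simp: O1_def)
    also have "\<dots> < norm (y - a) / 3" using that by (simp add: O1_def)
    finally show "norm t * norm v < norm (y - a) / 3" .
  qed
  have c: "continuous_on X (\<lambda>p. g (snd p))" if "continuous_on UNIV g" for g :: "'a \<Rightarrow> real" and X :: "(complex \<times> 'a) set"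
    by (rule continuous_on_compose2[OF that]) (auto intro: continuous_intros)
  have cq: "continuous_on X (\<lambda>p. complex_sq_dist a v (fst p) (snd p))" "continuous_on X (\<lambda>p. Q (fst p) (snd p))" for X
    unfolding complex_sq_dist_def Q_def by (intro continuous_intros)+
  have F1: "continuous_on O1 (\<lambda>(t, y). F t y)" "continuous_on O1 (\<lambda>(t, y). F' t y)"
    unfolding F_def F'_def case_prod_beta
    by (intro continuous_intros cq c assms(1,2); use nz in force)+
  have F2: "continuous_on O2 (\<lambda>(t, y). F t y)" "continuous_on O2 (\<lambda>(t, y). F' t y)"
    by (rule continuous_on_eq[OF continuous_on_const[of _ 0]]; auto simp: F_def F'_def O2_def zero)+
  have cF: "continuous_on (ball 0 2 \<times> UNIV) (\<lambda>(t, y). F t y)"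
    and cF': "continuous_on (ball 0 2 \<times> UNIV) (\<lambda>(t, y). F' t y)"
    unfolding op(3)[symmetric] by (intro continuous_on_open_Un op F1 F2)+
  have int: "F t integrable_on cbox c d" if "t \<in> ball 0 2" for t
  proof (rule integrable_continuous)
    have "continuous_on (cbox c d) (\<lambda>y. (t, y))" by (intro continuous_intros)
    moreover have "Pair t ` cbox c d \<subseteq> ball 0 2 \<times> UNIV" using that by auto
    ultimately show "continuous_on (cbox c d) (F t)" using continuous_on_compose2[OF cF] by fastforce
  qed
  then show "t \<in> ball 0 2 \<Longrightarrow> F t integrable_on cbox c d" .
  have dF: "((\<lambda>t. F t y) has_field_derivative F' t y) (at t within ball 0 2)"
    if t: "t \<in> ball 0 2" for t y
    proof (cases "y \<in> ball a r")
      case True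
      then show ?thesis by (simp add: F_def F'_def zero)
    next
      case False
      then have "(t, y) \<in> O1" using t r by (simp add: O1_def dist_norm norm_minus_commute)
      then have "complex_sq_dist a v t y \<noteq> 0" by (rule nz)
      moreover have "((\<lambda>t. complex_sq_dist a v t y) has_field_derivative Q t y) (at t within ball 0 2)"
        unfolding complex_sq_dist_def Q_def by (auto intro!: derivative_eq_intros)
      ultimately have i: "((\<lambda>t. inverse (complex_sq_dist a v t y ^ n)) has_field_derivative
          - of_nat n * inverse (complex_sq_dist a v t y ^ (n + 1)) * Q t y) (at t within ball 0 2)"
        by (intro DERIV_chain2[OF DERIV_inverse_power])
      have "((\<lambda>t. of_real (\<alpha> y) + t * of_real (\<beta> y)) has_field_derivative of_real (\<beta> y)) (at t within ball 0 2)"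
        by (auto intro!: derivative_eq_intros)
      from DERIV_mult[OF this i] show ?thesis
        unfolding F_def F'_def by (rule DERIV_cong) (simp only: mult.commute)
    qed
  show "(\<lambda>t. integral (cbox c d) (F t)) holomorphic_on ball 0 2"
  proof (rule leibniz_rule_holomorphic[OF dF int])
    show "continuous_on (ball 0 2 \<times> cbox c d) (\<lambda>(t, y). F' t y)"
      by (rule continuous_on_subset[OF cF']) auto
  qed auto
qed

text \<open>
  Real analyticity along rays: with a cutoff \<open>\<eta>\<close> equal to \<open>1\<close> on the ball of radius \<open>R/3\<close>, the reproducing formula expresses
  \<open>h (a + t v)\<close> as an integral whose integrand is rational in \<open>t\<close>, hence as the restriction of a function \<open>H\<close>
  that is holomorphic on \<open>\<bar>t\<bar> < 2\<close>. It vanishes for small real \<open>t\<close>, so also at \<open>t = 1\<close>. The radius \<open>R/24\<close> comes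
  from \<open>\<bar>v\<bar> < (R/3)/8\<close>.
\<close>

lemma harmonic_zero_near_centre:
  fixes h :: "'a::euclidean_space \<Rightarrow> real"
  assumes dim: "DIM('a) = 2 * m + 2" and m: "m \<ge> 1"
    and h: "C2dir (ball a R) h" "\<And>y. y \<in> ball a R \<Longrightarrow> lap h y = 0"
    and \<delta>: "\<delta> > 0" "\<And>y. y \<in> ball a \<delta> \<Longrightarrow> h y = 0"
    and x: "x \<in> ball a (R / 24)"
  shows "h x = 0"
proof -
  obtain C where C: "green_constant TYPE('a) m C" using green_constant_exists[OF dim m] by blast
  have R: "R > 0" using x by (simp, smt (verit) zero_le_dist)
  define v where "v = x - a"
  have v: "norm v < (R / 3) / 8" using x by (simp add: v_def dist_norm norm_minus_commute)
  obtain \<eta> V where \<eta>: "test_fn (ball a R) \<eta>" "cball a (R / 3) \<subseteq> V" "\<And>x. x \<in> V \<Longrightarrow> \<eta> x = 1"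
    by (rule cutoff_exists[of "cball a (R / 3)" "ball a R"]) (use R in auto)
  have \<eta>1: "\<eta> y = 1" if "dist a y \<le> R / 3" for y using \<eta> that by auto
  obtain A where A: "compact A" "A \<subseteq> ball a R" "\<And>x. x \<notin> A \<Longrightarrow> \<eta> x = 0" and \<eta>2: "C2dir UNIV \<eta>"
    using \<eta>(1) unfolding test_fn_def by blast
  note clA = compact_imp_closed[OF A(1)]
  obtain c where c: "A \<subseteq> cbox (- c) c"
    using bounded_subset_cbox_symmetric[OF compact_imp_bounded[OF A(1)]] by metis
  note pd0 = pd_eq_0_off[OF clA A(3)] and lap0 = lap_eq_0_off[OF clA A(3)]
  have loc: "pd b \<eta> y = 0" "lap \<eta> y = 0" if "y \<in> ball a (R / 3)" for b y
    using test_fn_locally_constant[of a "R / 3" \<eta> y] that \<eta>1 R by auto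
  \<comment> \<open>The gradient term of the density at the point \<open>a + t v\<close> is affine in \<open>t\<close>: it is proportional to \<open>G1 - t G2\<close>.\<close>
  define G1 where "G1 y = (\<Sum>b\<in>Basis. ((y - a) \<bullet> b) * pd b \<eta> y)" for y
  define G2 where "G2 y = (\<Sum>b\<in>Basis. (v \<bullet> b) * pd b \<eta> y)" for y
  note glue = continuous_on_mult_off[OF open_ball C2dir_continuous_on[OF h(1)] _ clA A(2)]
  have G: "continuous_on UNIV G1" "continuous_on UNIV G2"
    unfolding G1_def G2_def using C2dirD(2)[OF \<eta>2] by (auto intro!: continuous_intros)
  have cont: "continuous_on UNIV (\<lambda>y. h y * lap \<eta> y)" "continuous_on UNIV (\<lambda>y. - 4 * real m * (h y * G1 y))"
      "continuous_on UNIV (\<lambda>y. 4 * real m * (h y * G2 y))"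
    by (intro continuous_on_mult continuous_on_const glue C2dir_lap_continuous_on[OF \<eta>2] G;
        simp add: G1_def G2_def pd0 lap0)+
  define F1 where "F1 t y = (of_real (h y * lap \<eta> y) + t * of_real 0) * inverse (complex_sq_dist a v t y ^ m)" for t y
  define F2 where "F2 t y = (of_real (- 4 * real m * (h y * G1 y)) + t * of_real (4 * real m * (h y * G2 y)))
      * inverse (complex_sq_dist a v t y ^ (m + 1))" for t y
  define H where "H t = integral (cbox (- c) c) (F1 t) + integral (cbox (- c) c) (F2 t)" for t
  have zero: "h y * lap \<eta> y = 0" "- 4 * real m * (h y * G1 y) = 0" "4 * real m * (h y * G2 y) = 0"
    if "y \<in> ball a (R / 3)" for y
    using loc[OF that] by (simp_all add: G1_def G2_def)
  have R3: "R / 3 > 0" using R by simp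
  have hol1: "(\<lambda>t. integral (cbox (- c) c) (F1 t)) holomorphic_on ball 0 2"
      "t \<in> ball 0 2 \<Longrightarrow> F1 t integrable_on cbox (- c) c" for t
    unfolding F1_def[abs_def]
    by (rule holomorphic_integral_complex_sq_dist[OF cont(1) continuous_on_const R3 v zero(1) refl]; assumption)+
  have hol2: "(\<lambda>t. integral (cbox (- c) c) (F2 t)) holomorphic_on ball 0 2"
      "t \<in> ball 0 2 \<Longrightarrow> F2 t integrable_on cbox (- c) c" for t
    unfolding F2_def[abs_def]
    by (rule holomorphic_integral_complex_sq_dist[OF cont(2,3) R3 v zero(2,3)]; assumption)+
  have hol: "H holomorphic_on ball 0 2"
    unfolding H_def by (intro holomorphic_on_add hol1(1) hol2(1))
  have H: "H (of_real t) = of_real (C * h (a + t *\<^sub>R v))" if t: "0 \<le> t" "t < 2" for t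
  proof -
    define x' where "x' = a + t *\<^sub>R v"
    have "t * norm v \<le> 2 * ((R / 3) / 8)" using t v by (intro mult_mono) auto
    then have d: "dist a x' \<le> R / 12" using t by (simp add: x'_def dist_norm)
    have near: "\<eta> y = \<eta> x'" if "y \<in> ball x' (R / 12)" for y
    proof -
      have "dist a y \<le> R / 3" using d that R dist_triangle[of a y x'] by simp
      then show ?thesis using \<eta>1[of y] \<eta>1[of x'] d R by simp
    qed
    have R12: "R / 12 > 0" using R by simp
    have "integral UNIV (\<lambda>y. h y * green_density m 0 \<eta> x' y) = C * (h x' * \<eta> x')"
      by (rule green_constantD[OF C open_ball h \<eta>(1) R12 near])
    also have "\<eta> x' = 1" using \<eta>1 d R by simp
    finally have rep: "integral UNIV (\<lambda>y. h y * green_density m 0 \<eta> x' y) = C * h x'" by simp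
    have eq: "F1 (of_real t) y + F2 (of_real t) y = of_real (h y * green_density m 0 \<eta> x' y)" for y
    proof -
      define q where "q = (y - x') \<bullet> (y - x')"
      have cq: "complex_sq_dist a v (of_real t) y = of_real q" unfolding q_def x'_def by (rule complex_sq_dist_of_real)
      have yx: "(y - x') \<bullet> b = (y - a) \<bullet> b - t * (v \<bullet> b)" for b
        by (simp add: x'_def inner_diff_left inner_add_left)
      have "(\<Sum>b\<in>Basis. newton_kernel_pd m 0 b (y - x') * pd b \<eta> y)
          = (\<Sum>b\<in>Basis. (- 2 * real m * inverse (q ^ (m + 1))) * (((y - a) \<bullet> b) * pd b \<eta> y - t * ((v \<bullet> b) * pd b \<eta> y)))"
      proof (intro sum.cong refl)
        fix b
        have "newton_kernel_pd m 0 b (y - x') = - 2 * real m * ((y - a) \<bullet> b - t * (v \<bullet> b)) * inverse (q ^ (m + 1))"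
          unfolding newton_kernel_pd_def yx q_def by simp
        then show "newton_kernel_pd m 0 b (y - x') * pd b \<eta> y
            = (- 2 * real m * inverse (q ^ (m + 1))) * (((y - a) \<bullet> b) * pd b \<eta> y - t * ((v \<bullet> b) * pd b \<eta> y))"
          by algebra
      qed
      also have "\<dots> = - 2 * real m * inverse (q ^ (m + 1)) * (G1 y - t * G2 y)"
        by (simp only: sum_distrib_left[symmetric] sum_subtractf G1_def G2_def)
      finally have "green_density m 0 \<eta> x' y = inverse (q ^ m) * lap \<eta> y
          + 2 * (- 2 * real m * inverse (q ^ (m + 1)) * (G1 y - t * G2 y))"
        by (simp add: green_density_def newton_kernel_def q_def[symmetric])
      moreover have "h y * (inverse (q ^ m) * lap \<eta> y + 2 * (- 2 * real m * inverse (q ^ (m + 1)) * (G1 y - t * G2 y)))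
        = (h y * lap \<eta> y + t * 0) * inverse (q ^ m)
          + (- 4 * real m * (h y * G1 y) + t * (4 * real m * (h y * G2 y))) * inverse (q ^ (m + 1))"
        by algebra
      ultimately have "h y * green_density m 0 \<eta> x' y = (h y * lap \<eta> y + t * 0) * inverse (q ^ m)
          + (- 4 * real m * (h y * G1 y) + t * (4 * real m * (h y * G2 y))) * inverse (q ^ (m + 1))"
        by (simp only:)
      then show ?thesis
        unfolding F1_def F2_def cq by (simp only: of_real_add of_real_mult of_real_inverse of_real_power)
    qed
    have t2: "complex_of_real t \<in> ball 0 2" using t by simp
    have "H (of_real t) = integral (cbox (- c) c) (\<lambda>y. F1 (of_real t) y + F2 (of_real t) y)"
      unfolding H_def by (rule integral_add[symmetric, OF hol1(2)[OF t2] hol2(2)[OF t2]])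
    also have "\<dots> = integral (cbox (- c) c) (\<lambda>y. of_real (h y * green_density m 0 \<eta> x' y))"
      by (simp only: eq)
    also have "\<dots> = of_real (integral (cbox (- c) c) (\<lambda>y. h y * green_density m 0 \<eta> x' y))"
    proof -
      have "continuous_on UNIV (green_density m 0 \<eta> x')"
        using continuous_on_green_density_fixed[OF \<eta>2 R12, of x' m 0] near by blast
      then have cl: "continuous_on UNIV (\<lambda>y. h y * green_density m 0 \<eta> x' y)"
        by (rule glue) (rule green_density_eq_0_off[OF clA A(3)])
      then have "(\<lambda>y. h y * green_density m 0 \<eta> x' y) integrable_on cbox (- c) c"
        by (intro integrable_continuous) (rule continuous_on_subset, auto)
      from integral_linear[OF this bounded_linear_of_real[where 'a=complex]]
      show ?thesis by (simp add: o_def)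
    qed
    also have "integral (cbox (- c) c) (\<lambda>y. h y * green_density m 0 \<eta> x' y) = integral UNIV (\<lambda>y. h y * green_density m 0 \<eta> x' y)"
    proof -
      have "continuous_on UNIV (green_density m 0 \<eta> x')"
        using continuous_on_green_density_fixed[OF \<eta>2 R12, of x' m 0] near by blast
      then have cl: "continuous_on UNIV (\<lambda>y. h y * green_density m 0 \<eta> x' y)"
        by (rule glue) (rule green_density_eq_0_off[OF clA A(3)])
      show ?thesis
        by (rule integral_compact_support(2)[symmetric, OF cl c]) (simp add: green_density_eq_0_off[OF clA A(3)])
    qed
    finally show ?thesis using rep by (simp add: x'_def)
  qed
  define \<tau> where "\<tau> = min 2 (\<delta> / (norm v + 1))"
  have \<tau>: "\<tau> > 0" "\<tau> \<le> 2" using \<delta>(1) by (auto simp: \<tau>_def divide_pos_pos add_nonneg_pos)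
  have "H 1 = 0"
  proof (rule analytic_continuation[OF hol open_ball connected_ball, of "complex_of_real ` {0<..<\<tau>}" 0])
    show "complex_of_real ` {0<..<\<tau>} \<subseteq> ball 0 2" using \<tau> by auto
    show "0 islimpt complex_of_real ` {0<..<\<tau>}"
    proof (subst islimpt_approachable, intro allI impI)
      fix e :: real assume e: "e > 0"
      define s where "s = min e \<tau> / 2"
      have "0 < s" "s < e" "s < \<tau>" using e \<tau> by (auto simp: s_def)
      then show "\<exists>x'\<in>complex_of_real ` {0<..<\<tau>}. x' \<noteq> 0 \<and> dist x' 0 < e"
        by (intro bexI[of _ "complex_of_real s"]) auto
    qed
    fix z assume "z \<in> complex_of_real ` {0<..<\<tau>}"
    then obtain t where t: "0 < t" "t < \<tau>" "z = of_real t" by auto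
    have "t * norm v < \<delta>"
    proof -
      have "t * norm v \<le> t * (norm v + 1)" using t by (intro mult_left_mono) auto
      also have "\<dots> < \<delta> / (norm v + 1) * (norm v + 1)"
        using t by (intro mult_strict_right_mono) (auto simp: \<tau>_def add_nonneg_pos)
      also have "\<dots> = \<delta>" by (simp add: add_nonneg_eq_0_iff)
      finally show ?thesis .
    qed
    then have "h (a + t *\<^sub>R v) = 0" using t by (intro \<delta>(2)) (simp add: dist_norm)
    then show "H z = 0" using H[of t] t \<tau> by simp
  qed auto
  then have "of_real (C * h x) = (0 :: complex)" using H[of 1] by (simp add: v_def)
  then show ?thesis using green_constant_pos[OF C] by simp
qed

text \<open>
  Near a point where \<open>g\<close> vanishes identically, the previous lemma enlarges the zero set in the first variable and then,
  for each first coordinate so obtained, in the second. The enlarged radius depends only on the distance to the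
  boundary of \<open>U\<close>, so the interior of the zero set is relatively closed in \<open>U\<close>.
\<close>

lemma separately_harmonic_unique_continuation:
  fixes g :: "'a::euclidean_space \<times> 'a \<Rightarrow> real"
  assumes dim: "DIM('a) = 2 * m + 2" and m: "m \<ge> 1"
    and U: "open U" "connected U"
    and g1: "\<And>z. C2dir {y. (y, z) \<in> U} (\<lambda>y. g (y, z))" "\<And>y z. (y, z) \<in> U \<Longrightarrow> lap (\<lambda>y. g (y, z)) y = 0"
    and g2: "\<And>y. C2dir {z. (y, z) \<in> U} (\<lambda>z. g (y, z))" "\<And>y z. (y, z) \<in> U \<Longrightarrow> lap (\<lambda>z. g (y, z)) z = 0"
    and O: "open O'" "O' \<subseteq> U" "O' \<noteq> {}" "\<And>p. p \<in> O' \<Longrightarrow> g p = 0"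
    and p: "p \<in> U"
  shows "g p = 0"
proof -
  define S where "S = interior {p \<in> U. g p = 0}"
  have S: "open S" "S \<subseteq> U" "\<And>p. p \<in> S \<Longrightarrow> g p = 0"
    unfolding S_def using interior_subset by auto
  have "O' \<subseteq> S" unfolding S_def using O by (intro interior_maximal) auto
  \<comment> \<open>The radius works for every point \<open>q\<close> of \<open>S\<close> nearby, no matter how small the neighbourhood of \<open>q\<close> in \<open>S\<close> is.\<close>
  have key: "\<exists>\<rho>>0. ball p \<rho> \<subseteq> U \<and> (ball p \<rho> \<inter> S \<noteq> {} \<longrightarrow> p \<in> S)" if "p \<in> U" for p
  proof -
    obtain R0 where R0: "R0 > 0" "ball p R0 \<subseteq> U" by (rule openE[OF U(1) \<open>p \<in> U\<close>])
    define R where "R = R0 / 4"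
    have R: "R > 0" using R0 by (simp add: R_def)
    have "p \<in> S" if q: "q \<in> ball p (R / 24)" "q \<in> S" for q
    proof -
      obtain a b where ab: "q = (a, b)" by fastforce
      obtain a0 b0 where p: "p = (a0, b0)" by fastforce
      have inU: "(y, z) \<in> U" if "y \<in> ball a R" "z \<in> ball b R" for y z
      proof -
        have "dist q (y, z) \<le> dist a y + dist b z"
          unfolding ab dist_Pair_Pair by (rule sqrt_sum_squares_le_sum) auto
        then have "dist p (y, z) < R0"
          using that q(1) dist_triangle[of p "(y, z)" q] R by (simp add: R_def)
        then show ?thesis using R0(2) by auto
      qed
      obtain \<delta>0 where \<delta>0: "\<delta>0 > 0" "ball q \<delta>0 \<subseteq> S" by (rule openE[OF S(1) q(2)])
      define \<delta> where "\<delta> = min (\<delta>0 / 2) R"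
      have \<delta>: "\<delta> > 0" "\<delta> \<le> R" using \<delta>0 R by (auto simp: \<delta>_def)
      have zero: "g (y, z) = 0" if "y \<in> ball a \<delta>" "z \<in> ball b \<delta>" for y z
      proof -
        have "dist q (y, z) \<le> dist a y + dist b z"
          unfolding ab dist_Pair_Pair by (rule sqrt_sum_squares_le_sum) auto
        then have "(y, z) \<in> ball q \<delta>0" using that by (simp add: \<delta>_def)
        then show ?thesis using \<delta>0(2) S(3) by blast
      qed
      have z1: "g (y, z) = 0" if y: "y \<in> ball a (R / 24)" and z: "z \<in> ball b \<delta>" for y z
      proof (rule harmonic_zero_near_centre[OF dim m, where R = R and a = a and \<delta> = \<delta>
            and h = "\<lambda>y. g (y, z)" and x = y])
        have zR: "z \<in> ball b R" using z \<delta> by simp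
        show "C2dir (ball a R) (\<lambda>y. g (y, z))"
          by (rule C2dir_subset[OF g1(1)[of z]]) (use inU zR in auto)
        show "lap (\<lambda>y. g (y, z)) y = 0" if "y \<in> ball a R" for y
          using g1(2) inU[OF that zR] .
        show "g (y, z) = 0" if "y \<in> ball a \<delta>" for y using zero that z .
      qed (use \<delta> y in auto)
      have z2: "g (y, z) = 0" if y: "y \<in> ball a (R / 24)" and z: "z \<in> ball b (R / 24)" for y z
      proof (rule harmonic_zero_near_centre[OF dim m, where R = R and a = b and \<delta> = \<delta>
            and h = "\<lambda>z. g (y, z)" and x = z])
        have yR: "y \<in> ball a R" using y R by simp
        show "C2dir (ball b R) (\<lambda>z. g (y, z))"
          by (rule C2dir_subset[OF g2(1)[of y]]) (use inU yR in auto)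
        show "lap (\<lambda>z. g (y, z)) z = 0" if "z \<in> ball b R" for z
          using g2(2) inU[OF yR that] .
        show "g (y, z) = 0" if "z \<in> ball b \<delta>" for z using z1 y that .
      qed (use \<delta> z in auto)
      have "ball a (R / 24) \<times> ball b (R / 24) \<subseteq> S"
        unfolding S_def
      proof (rule interior_maximal)
        show "ball a (R / 24) \<times> ball b (R / 24) \<subseteq> {p \<in> U. g p = 0}"
          using z2 inU R by auto
      qed (intro open_Times open_ball)
      moreover have "dist a a0 < R / 24" "dist b b0 < R / 24"
        using q(1) dist_fst_le[of q p] dist_snd_le[of q p] by (auto simp: ab p dist_commute)
      ultimately show ?thesis unfolding p by auto
    qed
    then show ?thesis using R R0 by (intro exI[of _ "R / 24"]) (auto simp: R_def)
  qed
  have "open (U - S)"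
  proof (subst open_subopen, rule ballI)
    fix p assume "p \<in> U - S"
    with key[of p] obtain \<rho> where "\<rho> > 0" "ball p \<rho> \<subseteq> U" "ball p \<rho> \<inter> S = {}" by auto
    then show "\<exists>T. open T \<and> p \<in> T \<and> T \<subseteq> U - S"
      by (intro exI[of _ "ball p \<rho>"]) auto
  qed
  then have "S = {} \<or> U - S = {}"
    using connectedD[OF U(2) S(1), of "U - S"] S(2) by auto
  then have "p \<in> S" using \<open>O' \<subseteq> S\<close> O(3) p by auto
  then show ?thesis by (rule S(3))
qed

section \<open>Twice differentiable functions and averages of translates\<close>

text \<open>
  The witnesses in \<open>C2_on\<close>, made explicit: the differential operators of the theorem are linear in \<open>f''\<close>.
\<close>

definition C2_data :: "'a::real_normed_vector set \<Rightarrow> ('a \<Rightarrow> 'b::real_normed_vector)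
    \<Rightarrow> ('a \<Rightarrow> 'a \<Rightarrow>\<^sub>L 'b) \<Rightarrow> ('a \<Rightarrow> 'a \<Rightarrow>\<^sub>L 'a \<Rightarrow>\<^sub>L 'b) \<Rightarrow> bool" where
  "C2_data U f f' f'' \<longleftrightarrow>
     (\<forall>x\<in>U. (f has_derivative blinfun_apply (f' x)) (at x)) \<and>
     (\<forall>x\<in>U. (f' has_derivative blinfun_apply (f'' x)) (at x)) \<and> continuous_on U f''"

lemma C2_on_iff_data: "C2_on U f \<longleftrightarrow> (\<exists>f' f''. C2_data U f f' f'')"
  by (simp add: C2_on_def C2_data_def)

text \<open>
  The local witnesses agree with the Frechet derivatives, which are defined globally.
\<close>

lemma C2_on_local:
  assumes "\<And>x. x \<in> U \<Longrightarrow> \<exists>V. open V \<and> x \<in> V \<and> C2_on V f"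
  shows "C2_on U f"
proof -
  define f' where "f' x = Blinfun (frechet_derivative f (at x))" for x
  define f'' where "f'' x = Blinfun (frechet_derivative f' (at x))" for x
  have *: "(f has_derivative blinfun_apply (f' x)) (at x) \<and> (f' has_derivative blinfun_apply (f'' x)) (at x) \<and> isCont f'' x"
    if x: "x \<in> U" for x
  proof -
    obtain V g' g'' where V: "open V" "x \<in> V" "C2_data V f g' g''"
      using assms[OF x] unfolding C2_on_iff_data by blast
    have 1: "f' y = g' y" if "y \<in> V" for y
      using V(3) that frechet_derivative_at[of f "blinfun_apply (g' y)" y]
      by (simp add: C2_data_def f'_def) (metis blinfun_apply_inverse)
    have 2: "(f' has_derivative blinfun_apply (g'' y)) (at y)" if "y \<in> V" for y
    proof -
      have "(g' has_derivative blinfun_apply (g'' y)) (at y)" using V(3) that by (simp add: C2_data_def)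
      then show ?thesis
        by (rule has_derivative_transform_within_open[OF _ V(1) that]) (simp add: 1)
    qed
    have 3: "f'' y = g'' y" if "y \<in> V" for y
      using frechet_derivative_at[OF 2[OF that]] by (simp add: f''_def) (metis blinfun_apply_inverse)
    have "continuous_on V g''" using V(3) by (simp add: C2_data_def)
    then have "continuous_on V f''" by (rule continuous_on_eq) (simp add: 3)
    then have "isCont f'' x" using V by (simp add: continuous_on_eq_continuous_at)
    moreover have "(f has_derivative blinfun_apply (f' x)) (at x)"
      using V 1[OF V(2)] by (simp add: C2_data_def)
    moreover have "(f' has_derivative blinfun_apply (f'' x)) (at x)"
      using 2[OF V(2)] 3[OF V(2)] by simp
    ultimately show ?thesis by blast
  qed
  then have "C2_data U f f' f''"
    unfolding C2_data_def by (auto intro: continuous_at_imp_continuous_on)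
  then show ?thesis unfolding C2_on_iff_data by blast
qed

lemma C2_data_has_pd:
  fixes f :: "'a::euclidean_space \<Rightarrow> real"
  assumes "open U" "C2_data U f f' f''" "x \<in> U"
  shows "has_pd u f (f' x u) x" "has_pd v (\<lambda>y. f' y u) (f'' x v u) x"
    "pd u f x = f' x u" "pd v (pd u f) x = f'' x v u"
proof -
  have 1: "has_pd u f (f' x u) x" if "x \<in> U" for x u
  proof -
    have "(f has_derivative f' x) (at (x + 0 *\<^sub>R u))" using assms(2) that by (simp add: C2_data_def)
    moreover have "((\<lambda>t. x + t *\<^sub>R u) has_derivative (\<lambda>t. t *\<^sub>R u)) (at 0)"
      by (auto intro!: derivative_eq_intros)
    ultimately have "((\<lambda>t. f (x + t *\<^sub>R u)) has_derivative (\<lambda>t. f' x (t *\<^sub>R u))) (at 0)"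
      by (rule has_derivative_compose[rotated])
    then show ?thesis
      by (simp add: has_pd_def has_field_derivative_def blinfun.scaleR_right mult_commute_abs)
  qed
  show "has_pd u f (f' x u) x" by (rule 1[OF assms(3)])
  show 2: "has_pd v (\<lambda>y. f' y u) (f'' x v u) x"
  proof -
    have "(f' has_derivative f'' x) (at (x + 0 *\<^sub>R v))" using assms(2,3) by (simp add: C2_data_def)
    moreover have "((\<lambda>t. x + t *\<^sub>R v) has_derivative (\<lambda>t. t *\<^sub>R v)) (at 0)"
      by (auto intro!: derivative_eq_intros)
    ultimately have "((\<lambda>t. f' (x + t *\<^sub>R v)) has_derivative (\<lambda>t. f'' x (t *\<^sub>R v))) (at 0)"
      by (rule has_derivative_compose[rotated])
    then have "((\<lambda>t. f' (x + t *\<^sub>R v) u) has_derivative (\<lambda>t. f'' x (t *\<^sub>R v) u)) (at 0)"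
      by (rule bounded_linear.has_derivative[OF blinfun.bounded_linear_left])
    then show ?thesis
      by (simp add: has_pd_def has_field_derivative_def blinfun.scaleR_right blinfun.scaleR_left mult_commute_abs)
  qed
  show "pd u f x = f' x u" using 1[OF assms(3)] by (rule pd_eqI)
  have "pd v (pd u f) x = pd v (\<lambda>y. f' y u) x"
    by (rule pd_cong[OF assms(1,3)]) (rule pd_eqI[OF 1])
  then show "pd v (pd u f) x = f'' x v u" using pd_eqI[OF 2] by simp
qed

lemma C2_data_continuous:
  assumes "C2_data U f f' f''"
  shows "continuous_on U f" "continuous_on U f'" "continuous_on U f''"
  using assms unfolding C2_data_def
  by (auto intro!: continuous_at_imp_continuous_on has_derivative_continuous)

text \<open>
  An average of translates is differentiated by differentiating what is averaged, with the same continuous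
  weight. Applied to a function and to its derivative, this gives two
  derivatives at once.
\<close>

lemma has_derivative_translate_average:
  fixes \<phi> :: "'a::euclidean_space \<times> 'b::euclidean_space \<Rightarrow> 'c::banach"
    and \<phi>' :: "'a \<times> 'b \<Rightarrow> ('a \<times> 'b) \<Rightarrow>\<^sub>L 'c"
  assumes U: "open U" and \<phi>: "\<And>x. x \<in> U \<Longrightarrow> (\<phi> has_derivative \<phi>' x) (at x)" "continuous_on U \<phi>'"
    and w: "continuous_on UNIV w" "closed A" "\<And>y. y \<notin> A \<Longrightarrow> w y = 0"
    and AU: "\<And>y h. y \<in> A \<Longrightarrow> h \<in> ball 0 \<delta> \<Longrightarrow> (y, b) + h \<in> U"
  shows "continuous_on (ball 0 \<delta>) (\<lambda>h. integral (cbox c d) (\<lambda>y. w y *\<^sub>R \<phi>' ((y, b) + h)))"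
    and "h \<in> ball 0 \<delta> \<Longrightarrow> (\<lambda>y. w y *\<^sub>R \<phi>' ((y, b) + h)) integrable_on cbox c d"
    and "h \<in> ball 0 \<delta> \<Longrightarrow> ((\<lambda>h. integral (cbox c d) (\<lambda>y. w y *\<^sub>R \<phi> ((y, b) + h))) has_derivative
      integral (cbox c d) (\<lambda>y. w y *\<^sub>R \<phi>' ((y, b) + h))) (at h)"
proof -
  let ?B = "ball 0 \<delta> :: ('a \<times> 'b) set"
  have cont: "continuous_on (?B \<times> UNIV) (\<lambda>(h, y). w y *\<^sub>R g ((y, b) + h))"
    if g: "continuous_on U g" for g :: "'a \<times> 'b \<Rightarrow> 'd::real_normed_vector"
    unfolding case_prod_beta
  proof (rule continuous_on_scaleR_off[where w = "(?B \<times> UNIV) \<inter> (\<lambda>p. (snd p, b) + fst p) -` U" and A = "UNIV \<times> A"])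
    have "open ((\<lambda>p :: ('a \<times> 'b) \<times> 'a. (snd p, b) + fst p) -` U)"
      by (intro open_vimage U continuous_intros)
    then show "open ((?B \<times> UNIV) \<inter> (\<lambda>p. (snd p, b) + fst p) -` U)"
      by (intro open_Int open_Times) auto
    show "continuous_on ((?B \<times> UNIV) \<inter> (\<lambda>p. (snd p, b) + fst p) -` U) (\<lambda>p. g ((snd p, b) + fst p))"
      by (rule continuous_on_compose2[OF g]) (auto intro!: continuous_intros)
    show "continuous_on (?B \<times> UNIV) (\<lambda>p. w (snd p))"
      by (rule continuous_on_compose2[OF w(1)]) (auto intro: continuous_intros)
    show "UNIV \<times> A \<inter> ?B \<times> UNIV \<subseteq> (?B \<times> UNIV) \<inter> (\<lambda>p. (snd p, b) + fst p) -` U"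
      using AU by auto
  qed (auto intro!: open_Times closed_Times w)
  have sub: "?B \<times> cbox c d \<subseteq> ?B \<times> UNIV" by auto
  have int: "(\<lambda>y. w y *\<^sub>R g ((y, b) + h)) integrable_on cbox c d"
    if g: "continuous_on U g" and h: "h \<in> ?B" for g :: "'a \<times> 'b \<Rightarrow> 'd::banach" and h
  proof (rule integrable_continuous)
    have "continuous_on (cbox c d) (\<lambda>y. (h, y))" by (intro continuous_intros)
    moreover have "Pair h ` cbox c d \<subseteq> ?B \<times> UNIV" using h by auto
    ultimately show "continuous_on (cbox c d) (\<lambda>y. w y *\<^sub>R g ((y, b) + h))"
      using continuous_on_compose2[OF cont[OF g]] by fastforce
  qed
  have c\<phi>: "continuous_on U \<phi>"
    using \<phi>(1) by (auto intro!: continuous_at_imp_continuous_on has_derivative_continuous)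
  show "continuous_on ?B (\<lambda>h. integral (cbox c d) (\<lambda>y. w y *\<^sub>R \<phi>' ((y, b) + h)))"
    by (rule integral_continuous_on_param[OF continuous_on_subset[OF cont[OF \<phi>(2)] sub]])
  show "h \<in> ?B \<Longrightarrow> (\<lambda>y. w y *\<^sub>R \<phi>' ((y, b) + h)) integrable_on cbox c d"
    by (rule int[OF \<phi>(2)])
  assume h: "h \<in> ?B"
  have "((\<lambda>h. integral (cbox c d) (\<lambda>y. w y *\<^sub>R \<phi> ((y, b) + h))) has_derivative
      integral (cbox c d) (\<lambda>y. w y *\<^sub>R \<phi>' ((y, b) + h))) (at h within ?B)"
  proof (rule leibniz_rule[OF _ int[OF c\<phi>] continuous_on_subset[OF cont[OF \<phi>(2)] sub] h convex_ball])
    fix h y assume h: "h \<in> ?B"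
    show "((\<lambda>h. w y *\<^sub>R \<phi> ((y, b) + h)) has_derivative blinfun_apply (w y *\<^sub>R \<phi>' ((y, b) + h))) (at h within ?B)"
    proof (cases "y \<in> A")
      case True
      have "((\<lambda>h. (y, b) + h) has_derivative (\<lambda>u. u)) (at h within ?B)"
        by (auto intro!: derivative_eq_intros)
      from has_derivative_compose[OF this \<phi>(1)[OF AU[OF True h]]]
      have "((\<lambda>h. \<phi> ((y, b) + h)) has_derivative blinfun_apply (\<phi>' ((y, b) + h))) (at h within ?B)" by simp
      then have "((\<lambda>h. w y *\<^sub>R \<phi> ((y, b) + h)) has_derivative (\<lambda>u. w y *\<^sub>R blinfun_apply (\<phi>' ((y, b) + h)) u)) (at h within ?B)"
        by (rule has_derivative_scaleR_right)
      then show ?thesis by (simp only: scaleR_blinfun.rep_eq)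
    next
      case False
      then show ?thesis by (simp add: w(3) zero_blinfun.rep_eq)
    qed
  qed
  then show "((\<lambda>h. integral (cbox c d) (\<lambda>y. w y *\<^sub>R \<phi> ((y, b) + h))) has_derivative
      integral (cbox c d) (\<lambda>y. w y *\<^sub>R \<phi>' ((y, b) + h))) (at h)"
    by (simp only: at_within_open[OF h open_ball])
qed

lemma C2_data_add:
  assumes "C2_data U f f' f''" "C2_data U g g' g''"
  shows "C2_data U (\<lambda>x. f x + g x) (\<lambda>x. f' x + g' x) (\<lambda>x. f'' x + g'' x)"
  using assms unfolding C2_data_def
  by (auto intro!: continuous_on_add has_derivative_add simp: plus_blinfun.rep_eq)

lemma C2_data_scaleR:
  assumes "C2_data U f f' f''"
  shows "C2_data U (\<lambda>x. c *\<^sub>R f x) (\<lambda>x. c *\<^sub>R f' x) (\<lambda>x. c *\<^sub>R f'' x)"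
  using assms unfolding C2_data_def
  by (auto intro!: continuous_on_scaleR has_derivative_scaleR_right simp: scaleR_blinfun.rep_eq)

lemma C2_data_shift:
  assumes "C2_data U f f' f''" "\<And>x. x \<in> V \<Longrightarrow> x + c \<in> U"
  shows "C2_data V (\<lambda>x. f (x + c)) (\<lambda>x. f' (x + c)) (\<lambda>x. f'' (x + c))"
proof -
  have *: "((\<lambda>x. g (x + c)) has_derivative blinfun_apply (g' (x + c))) (at x)"
    if "x \<in> V" "\<And>x. x \<in> U \<Longrightarrow> (g has_derivative blinfun_apply (g' x)) (at x)"
    for x and g :: "'a \<Rightarrow> 'c::real_normed_vector" and g'
  proof -
    have "((\<lambda>x. x + c) has_derivative (\<lambda>u. u)) (at x)" by (auto intro!: derivative_eq_intros)
    from has_derivative_compose[OF this that(2)[OF assms(2)[OF that(1)]]] show ?thesis by simp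
  qed
  have "continuous_on V (\<lambda>x. f'' (x + c))"
    using assms by (intro continuous_on_compose2[of U f'' V "\<lambda>x. x + c"] continuous_intros) (auto simp: C2_data_def)
  moreover have "((\<lambda>x. f (x + c)) has_derivative blinfun_apply (f' (x + c))) (at x)"
      "((\<lambda>x. f' (x + c)) has_derivative blinfun_apply (f'' (x + c))) (at x)" if "x \<in> V" for x
    using assms(1) by (auto simp: C2_data_def intro!: *[OF that])
  ultimately show ?thesis unfolding C2_data_def by blast
qed

lemma C2_data_cong:
  assumes "open U" "C2_data U f f' f''" "\<And>x. x \<in> U \<Longrightarrow> g x = f x"
  shows "C2_data U g f' f''"
proof -
  have "(g has_derivative blinfun_apply (f' x)) (at x)" if "x \<in> U" for x
  proof -
    have "(f has_derivative blinfun_apply (f' x)) (at x)" using assms(2) that by (simp add: C2_data_def)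
    then show ?thesis
      by (rule has_derivative_transform_within_open[OF _ assms(1) that]) (simp add: assms(3))
  qed
  then show ?thesis using assms(2) by (simp add: C2_data_def)
qed

lemma C2_data_zero: "C2_data U (\<lambda>_. 0) (\<lambda>_. 0) (\<lambda>_. 0)"
  by (simp add: C2_data_def zero_blinfun.rep_eq)

lemma C2_data_translate_average:
  fixes f :: "'a::euclidean_space \<times> 'b::euclidean_space \<Rightarrow> 'c::banach"
  assumes U: "open U" and f: "C2_data U f f' f''"
    and w: "continuous_on UNIV w" "closed A" "\<And>y. y \<notin> A \<Longrightarrow> w y = 0"
    and AU: "\<And>y h. y \<in> A \<Longrightarrow> h \<in> ball 0 \<delta> \<Longrightarrow> (y, b) + h \<in> U"
  shows "C2_data (ball 0 \<delta>) (\<lambda>h. integral (cbox c d) (\<lambda>y. w y *\<^sub>R f ((y, b) + h)))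
    (\<lambda>h. integral (cbox c d) (\<lambda>y. w y *\<^sub>R f' ((y, b) + h)))
    (\<lambda>h. integral (cbox c d) (\<lambda>y. w y *\<^sub>R f'' ((y, b) + h)))"
    and "h \<in> ball 0 \<delta> \<Longrightarrow> (\<lambda>y. w y *\<^sub>R f'' ((y, b) + h)) integrable_on cbox c d"
proof -
  have d: "\<And>x. x \<in> U \<Longrightarrow> (f has_derivative f' x) (at x)" "\<And>x. x \<in> U \<Longrightarrow> (f' has_derivative f'' x) (at x)"
    using f by (auto simp: C2_data_def)
  note 1 = has_derivative_translate_average[OF U d(1) C2_data_continuous(2)[OF f] w AU]
  note 2 = has_derivative_translate_average[OF U d(2) C2_data_continuous(3)[OF f] w AU]
  show "C2_data (ball 0 \<delta>) (\<lambda>h. integral (cbox c d) (\<lambda>y. w y *\<^sub>R f ((y, b) + h)))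
    (\<lambda>h. integral (cbox c d) (\<lambda>y. w y *\<^sub>R f' ((y, b) + h)))
    (\<lambda>h. integral (cbox c d) (\<lambda>y. w y *\<^sub>R f'' ((y, b) + h)))"
    unfolding C2_data_def by (intro conjI ballI 1(3) 2(3) 2(1))
  show "h \<in> ball 0 \<delta> \<Longrightarrow> (\<lambda>y. w y *\<^sub>R f'' ((y, b) + h)) integrable_on cbox c d"
    by (rule 2(2))
qed

section \<open>The octonionic operators in terms of the second derivative\<close>

lemma linear_omult_right: "linear (\<lambda>x. c \<cdot>\<^sub>o x)"
  by (rule linearI) (auto simp: omult_def qmult_def qcnj_def prod_eq_iff algebra_simps scaleR_conv_of_real)

lemma omult_ocnj_oct_of_real: "c \<cdot>\<^sub>o oct_of_real r = r *\<^sub>R c"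
  using linear_scale[OF linear_omult_right, of c r "oe 0"] by (simp add: oct_of_real_def oe_0_right)

lemma slot_simps [simp]: "slot 1 v = (v, 0)" "slot 2 v = (0, v)"
  by (simp_all add: slot_def)

text \<open>
  The off-diagonal entries of \<open>D0 f x\<close> as linear functions of the second derivative of \<open>f\<close> at \<open>x\<close>; \<open>laplace_symbol\<close>
  does the same for the diagonal ones.
\<close>

definition mixed_symbol :: "2 \<Rightarrow> 2 \<Rightarrow> ((octonion \<times> octonion) \<Rightarrow>\<^sub>L (octonion \<times> octonion) \<Rightarrow>\<^sub>L real) \<Rightarrow> octonion" where
  "mixed_symbol j k B = (\<Sum>b<8. oe b \<cdot>\<^sub>o (\<Sum>a<8. B (slot j (oe b)) (slot k (oe a)) *\<^sub>R ocnj (oe a)))"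

definition laplace_symbol :: "2 \<Rightarrow> ((octonion \<times> octonion) \<Rightarrow>\<^sub>L (octonion \<times> octonion) \<Rightarrow>\<^sub>L real) \<Rightarrow> real" where
  "laplace_symbol j B = (\<Sum>a<8. B (slot j (oe a)) (slot j (oe a)))"

lemma bounded_linear_mixed_symbol: "bounded_linear (mixed_symbol j k)"
  unfolding mixed_symbol_def
  by (intro bounded_linear_sum bounded_linear_compose[OF linear_conv_bounded_linear[THEN iffD1, OF linear_omult_right]]
      bounded_linear_compose[OF bounded_linear_scaleR_left]
      bounded_linear_compose[OF blinfun.bounded_linear_left blinfun.bounded_linear_left])

lemma bounded_linear_laplace_symbol: "bounded_linear (laplace_symbol j)"
  unfolding laplace_symbol_def
  by (intro bounded_linear_sum bounded_linear_compose[OF blinfun.bounded_linear_left blinfun.bounded_linear_left])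

lemma partial_eq_pd: "partial j a f = pd (slot j (oe a)) f"
  by (simp add: fun_eq_iff partial_def pd_def)

lemma laplace_eq_symbol:
  assumes "open U" "C2_data U f f' f''" "x \<in> U"
  shows "laplace j f x = laplace_symbol j (f'' x)"
  by (simp add: laplace_def laplace_symbol_def partial_eq_pd C2_data_has_pd(4)[OF assms])

text \<open>
  As \<open>f\<close> is real-valued, the inner operator only produces real multiples of the conjugate units, and these
  pass through the octonion product.
\<close>

lemma dbar_dd_eq_symbol:
  assumes "open U" "C2_data U f f' f''" "x \<in> U"
  shows "dbar j (dd k (\<lambda>y. oct_of_real (f y))) x = mixed_symbol j k (f'' x)"
proof -
  define G where "G y = (\<Sum>a<8. f' y (slot k (oe a)) *\<^sub>R ocnj (oe a))" for y
  have "partial k a (\<lambda>y. oct_of_real (f y)) y = oct_of_real (f' y (slot k (oe a)))" if "y \<in> U" for y a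
  proof -
    have "((\<lambda>t. f (y + t *\<^sub>R slot k (oe a))) has_vector_derivative f' y (slot k (oe a))) (at 0)"
      using C2_data_has_pd(1)[OF assms(1,2) that, of "slot k (oe a)"]
      by (simp add: has_pd_def has_real_derivative_iff_has_vector_derivative)
    from bounded_linear.has_vector_derivative[OF bounded_linear_scaleR_left this, of "oe 0"]
    show ?thesis unfolding partial_def oct_of_real_def by (rule vector_derivative_at)
  qed
  then have G: "dd k (\<lambda>y. oct_of_real (f y)) y = G y" if "y \<in> U" for y
    using that by (simp add: dd_def G_def omult_ocnj_oct_of_real)
  have "partial j b (dd k (\<lambda>y. oct_of_real (f y))) x = (\<Sum>a<8. f'' x (slot j (oe b)) (slot k (oe a)) *\<^sub>R ocnj (oe a))" for b
  proof -
    define v where "v = slot j (oe b)"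
    have "((\<lambda>t. f' (x + t *\<^sub>R v) u) has_vector_derivative f'' x v u) (at 0)" for u
      using C2_data_has_pd(2)[OF assms, of v u]
      by (simp add: has_pd_def has_real_derivative_iff_has_vector_derivative)
    then have "((\<lambda>t. G (x + t *\<^sub>R v)) has_vector_derivative (\<Sum>a<8. f'' x v (slot k (oe a)) *\<^sub>R ocnj (oe a))) (at 0)"
      unfolding G_def
      by (intro has_vector_derivative_sum bounded_linear.has_vector_derivative[OF bounded_linear_scaleR_left])
    moreover have "open ((\<lambda>t. x + t *\<^sub>R v) -` U)"
      by (intro continuous_open_vimage assms(1) continuous_intros)
    ultimately have "((\<lambda>t. dd k (\<lambda>y. oct_of_real (f y)) (x + t *\<^sub>R v)) has_vector_derivative
        (\<Sum>a<8. f'' x v (slot k (oe a)) *\<^sub>R ocnj (oe a))) (at 0)"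
      by (rule has_vector_derivative_transform_within_open) (use assms(3) in \<open>auto simp: G\<close>)
    then show ?thesis unfolding partial_def v_def by (rule vector_derivative_at)
  qed
  then show ?thesis by (simp add: dbar_def mixed_symbol_def)
qed

lemma D0_eq_0_iff:
  assumes "open U" "C2_data U f f' f''" "x \<in> U"
  shows "D0 f x = 0 \<longleftrightarrow> laplace_symbol 1 (f'' x) = 0 \<and> laplace_symbol 2 (f'' x) = 0 \<and> mixed_symbol 1 2 (f'' x) = 0 \<and> mixed_symbol 2 1 (f'' x) = 0"
proof -
  have "oct_of_real r = 0 \<longleftrightarrow> r = 0" for r
    by (simp add: oct_of_real_def oe_def zero_prod_def)
  then show ?thesis
    by (auto simp: D0_def vec_eq_iff forall_2 laplace_eq_symbol[OF assms] dbar_dd_eq_symbol[OF assms])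
qed

lemma sum_oe: "(\<Sum>a<8. g (oe a)) = (\<Sum>b\<in>Basis. g b)"
  using sum.reindex[OF oe_inj, of g] by (simp add: oe_Basis)

text \<open>
  The diagonal entries alone say that an octonionic pluriharmonic function is harmonic in each of the two octonionic
  variables separately.
\<close>

lemma oph_on_slices:
  assumes "oph_on U f"
  shows "C2dir {y. (y, z) \<in> U} (\<lambda>y. f (y, z))" "(y, z) \<in> U \<Longrightarrow> lap (\<lambda>y. f (y, z)) y = 0"
    and "C2dir {z. (y, z) \<in> U} (\<lambda>z. f (y, z))" "(y, z) \<in> U \<Longrightarrow> lap (\<lambda>z. f (y, z)) z = 0"
proof -
  obtain f' f'' where d: "C2_data U f f' f''" and U: "open U" and D0: "\<And>x. x \<in> U \<Longrightarrow> D0 f x = 0"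
    using assms unfolding oph_on_def C2_on_iff_data by blast
  note pd = C2_data_has_pd(1,2)[OF U d]
  have L: "laplace_symbol 1 (f'' x) = 0" "laplace_symbol 2 (f'' x) = 0" if "x \<in> U" for x
    using D0[OF that] D0_eq_0_iff[OF U d that] by auto
  note c = C2_data_continuous[OF d]
  have c1: "continuous_on {y. (y, z) \<in> U} (\<lambda>y. g (y, z))" if "continuous_on U g" for z and g :: "_ \<Rightarrow> 'c::topological_space"
    by (rule continuous_on_compose2[OF that]) (auto intro!: continuous_on_Pair)
  have c2: "continuous_on {z. (y, z) \<in> U} (\<lambda>z. g (y, z))" if "continuous_on U g" for y and g :: "_ \<Rightarrow> 'c::topological_space"
    by (rule continuous_on_compose2[OF that]) (auto intro!: continuous_on_Pair)
  have p1: "has_pd b (\<lambda>y. f (y, z)) (f' (y, z) (b, 0)) y" "has_pd b (\<lambda>y. f' (y, z) (b, 0)) (f'' (y, z) (b, 0) (b, 0)) y"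
    if "(y, z) \<in> U" for b y z
    using pd[OF that, of "(b, 0)"] by (simp_all add: has_pd_def)
  have p2: "has_pd b (\<lambda>z. f (y, z)) (f' (y, z) (0, b)) z" "has_pd b (\<lambda>z. f' (y, z) (0, b)) (f'' (y, z) (0, b) (0, b)) z"
    if "(y, z) \<in> U" for b y z
    using pd[OF that, of "(0, b)"] by (simp_all add: has_pd_def)
  have r1: "C2dir {y. (y, z) \<in> U} (\<lambda>y. f (y, z))"
     "\<And>b y. b \<in> Basis \<Longrightarrow> y \<in> {y. (y, z) \<in> U} \<Longrightarrow> pd b (pd b (\<lambda>y. f (y, z))) y = f'' (y, z) (b, 0) (b, 0)" for z
    by (rule C2dirI[OF open_slices(1)[OF U], where ?f1.0 = "\<lambda>b y. f' (y, z) (b, 0)" and ?f2.0 = "\<lambda>b y. f'' (y, z) (b, 0) (b, 0)"];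
      use p1 in \<open>auto intro!: c1 c continuous_intros\<close>)+
  have r2: "C2dir {z. (y, z) \<in> U} (\<lambda>z. f (y, z))"
     "\<And>b z. b \<in> Basis \<Longrightarrow> z \<in> {z. (y, z) \<in> U} \<Longrightarrow> pd b (pd b (\<lambda>z. f (y, z))) z = f'' (y, z) (0, b) (0, b)" for y
    by (rule C2dirI[OF open_slices(2)[OF U], where ?f1.0 = "\<lambda>b z. f' (y, z) (0, b)" and ?f2.0 = "\<lambda>b z. f'' (y, z) (0, b) (0, b)"];
      use p2 in \<open>auto intro!: c2 c continuous_intros\<close>)+
  show "C2dir {y. (y, z) \<in> U} (\<lambda>y. f (y, z))" "C2dir {z. (y, z) \<in> U} (\<lambda>z. f (y, z))" by (rule r1 r2)+
  show "lap (\<lambda>y. f (y, z)) y = 0" if "(y, z) \<in> U"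
    using L(1)[OF that] that sum_oe[of "\<lambda>b. f'' (y, z) (b, 0) (b, 0)"] by (simp add: lap_def r1 laplace_symbol_def)
  show "lap (\<lambda>z. f (y, z)) z = 0" if "(y, z) \<in> U"
    using L(2)[OF that] that sum_oe[of "\<lambda>b. f'' (y, z) (0, b) (0, b)"] by (simp add: lap_def r2 laplace_symbol_def)
qed

section \<open>Hartogs extension\<close>

text \<open>
  A cutoff in the first variable, for the slice through \<open>p\<close>. Being constant near the base point makes
  \<open>green_density m 0 \<eta> (fst p)\<close> nonsingular.
\<close>

definition cutoff_at :: "('a::euclidean_space \<times> 'b::euclidean_space) set \<Rightarrow> ('a \<times> 'b) set \<Rightarrow> ('a \<Rightarrow> real) \<Rightarrow> 'a \<times> 'b \<Rightarrow> bool" where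
  "cutoff_at \<Omega> K \<eta> p \<longleftrightarrow> test_fn {y. (y, snd p) \<in> \<Omega>} \<eta> \<and>
     (\<exists>V. open V \<and> {y. (y, snd p) \<in> K} \<subseteq> V \<and> (\<forall>y\<in>V. \<eta> y = 1)) \<and>
     (\<exists>r>0. \<forall>y\<in>ball (fst p) r. \<eta> y = \<eta> (fst p))"

text \<open>
  For a function harmonic in the first variable on the whole slice of \<open>\<Omega>\<close>, the integral contributes \<open>\<eta> (fst p) * f p\<close>
  and the value is \<open>f p\<close>. In general the density lives where \<open>\<eta>\<close> is not locally constant,
  that is, inside \<open>\<Omega> - K\<close>, so the formula makes sense at points of \<open>K\<close>, where \<open>\<eta> (fst p) = 1\<close> removes the
  arbitrary value \<open>f p\<close>.
\<close>

definition hartogs_value :: "nat \<Rightarrow> real \<Rightarrow> ('a::euclidean_space \<times> 'b::euclidean_space \<Rightarrow> real) \<Rightarrow> ('a \<Rightarrow> real) \<Rightarrow> 'a \<times> 'b \<Rightarrow> real" where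
  "hartogs_value m C f \<eta> p = (1 - \<eta> (fst p)) * f p + integral UNIV (\<lambda>y. f (y, snd p) * green_density m 0 \<eta> (fst p) y) / C"

lemma compact_slice:
  fixes K :: "('a::euclidean_space \<times> 'b::euclidean_space) set"
  assumes "compact K"
  shows "compact {y. (y, z) \<in> K}"
proof -
  have "compact (fst ` (K \<inter> UNIV \<times> {z}))"
    by (intro compact_continuous_image continuous_intros compact_Int_closed assms closed_Times closed_UNIV closed_singleton)
  moreover have "fst ` (K \<inter> UNIV \<times> {z}) = {y. (y, z) \<in> K}" by force
  ultimately show ?thesis by simp
qed

text \<open>
  If the base point lies in the slice of \<open>K\<close>, the cutoff is \<open>1\<close> near it anyway. Otherwise the base point is removed
  from the open set that has to contain the support.
\<close>

lemma cutoff_at_exists: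
  assumes "open \<Omega>" "compact K" "K \<subseteq> \<Omega>"
  shows "\<exists>\<eta>. cutoff_at \<Omega> K \<eta> p"
proof -
  define k where "k = {y. (y, snd p) \<in> K}"
  define w where "w = {y. (y, snd p) \<in> \<Omega>} - (if fst p \<in> k then {} else {fst p})"
  have "compact k" unfolding k_def by (rule compact_slice[OF assms(2)])
  moreover have "open w" unfolding w_def using open_slices(1)[OF assms(1)] by (auto intro: open_delete)
  moreover have "k \<subseteq> w" using assms(3) by (auto simp: w_def k_def)
  ultimately obtain \<eta> V where "test_fn w \<eta>" "\<And>x. 0 \<le> \<eta> x" "open V" "k \<subseteq> V" "\<And>x. x \<in> V \<Longrightarrow> \<eta> x = 1"
    using cutoff_exists[of k w] by metis
  note \<eta> = this(1,3-5)
  obtain A where A: "compact A" "A \<subseteq> w" "\<And>x. x \<notin> A \<Longrightarrow> \<eta> x = 0" and \<eta>2: "C2dir UNIV \<eta>"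
    using \<eta>(1) unfolding test_fn_def by blast
  have "\<exists>r>0. \<forall>y\<in>ball (fst p) r. \<eta> y = \<eta> (fst p)"
  proof (cases "fst p \<in> k")
    case True
    then have "fst p \<in> V" using \<eta> by auto
    obtain r where r: "r > 0" "ball (fst p) r \<subseteq> V" by (rule openE[OF \<eta>(2) \<open>fst p \<in> V\<close>])
    then show ?thesis using \<eta>(4) \<open>fst p \<in> V\<close> by (intro exI[of _ r]) auto
  next
    case False
    then have "fst p \<in> - A" using A(2) by (auto simp: w_def)
    moreover have "open (- A)" using compact_imp_closed[OF A(1)] by (simp add: open_Compl)
    ultimately obtain r where r: "r > 0" "ball (fst p) r \<subseteq> - A" by (metis openE)
    then show ?thesis using A(3) \<open>fst p \<in> - A\<close> by (intro exI[of _ r]) auto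
  qed
  moreover have "test_fn {y. (y, snd p) \<in> \<Omega>} \<eta>"
    unfolding test_fn_def using A \<eta>2 by (auto simp: w_def)
  moreover have "\<exists>V. open V \<and> {y. (y, snd p) \<in> K} \<subseteq> V \<and> (\<forall>y\<in>V. \<eta> y = 1)"
    using \<eta> unfolding k_def by blast
  ultimately show ?thesis unfolding cutoff_at_def by blast
qed

lemma cutoff_at_green_density:
  assumes "cutoff_at \<Omega> K \<eta> p"
  obtains B where "compact B" "B \<subseteq> {y. (y, snd p) \<in> \<Omega> - K}" "\<And>e y. y \<notin> B \<Longrightarrow> green_density m e \<eta> (fst p) y = 0"
    "\<And>e. continuous_on UNIV (green_density m e \<eta> (fst p))"
proof -
  obtain A V r where A: "compact A" "A \<subseteq> {y. (y, snd p) \<in> \<Omega>}" "\<And>x. x \<notin> A \<Longrightarrow> \<eta> x = 0" and \<eta>: "C2dir UNIV \<eta>"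
    and V: "open V" "{y. (y, snd p) \<in> K} \<subseteq> V" "\<And>y. y \<in> V \<Longrightarrow> \<eta> y = 1"
    and r: "r > 0" "\<And>y. y \<in> ball (fst p) r \<Longrightarrow> \<eta> y = \<eta> (fst p)"
    using assms unfolding cutoff_at_def test_fn_def by blast
  show thesis
  proof (rule that[of "A - V"])
    show "compact (A - V)" by (rule compact_diff[OF A(1) V(1)])
    show "A - V \<subseteq> {y. (y, snd p) \<in> \<Omega> - K}" using A(2) V(2) by auto
    show "green_density m e \<eta> (fst p) y = 0" if "y \<notin> A - V" for e y
    proof (cases "y \<in> V")
      case True
      then have "pd b \<eta> y = 0" "lap \<eta> y = 0" for b
        using pd_cong[OF V(1) True, of \<eta> "\<lambda>_. 1" b] lap_cong[OF V(1) True, of \<eta> "\<lambda>_. 1"] V(3) by auto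
      then show ?thesis by (simp add: green_density_def)
    next
      case False
      then show ?thesis using that green_density_eq_0_off[OF compact_imp_closed[OF A(1)] A(3)] by auto
    qed
    show "continuous_on UNIV (green_density m e \<eta> (fst p))" for e
      using continuous_on_green_density_fixed[OF \<eta> r(1), of "fst p" m e] r(2) by blast
  qed
qed

lemma compact_translates_stay_inside:
  fixes A :: "'a::euclidean_space set"
  assumes "compact A" "open U" "A \<subseteq> U"
  obtains \<delta> where "\<delta> > 0" "\<And>x h. x \<in> A \<Longrightarrow> h \<in> ball 0 \<delta> \<Longrightarrow> x + h \<in> U"
proof -
  have "closed (- U)" "A \<inter> - U = {}" using assms by (auto simp: closed_Compl)
  then obtain \<delta> where \<delta>: "\<delta> > 0" "\<And>x y. x \<in> A \<Longrightarrow> y \<in> - U \<Longrightarrow> \<delta> \<le> dist x y"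
    using separate_compact_closed[OF assms(1)] by metis
  show thesis
  proof (rule that[OF \<delta>(1)], rule ccontr)
    fix x h assume "x \<in> A" "h \<in> ball 0 \<delta>" "x + h \<notin> U"
    then show False using \<delta>(2)[of x "x + h"] by (simp add: dist_norm)
  qed
qed

text \<open>
  A cutoff for \<open>p\<close>, translated along with the base point, serves all nearby base points: its support, and the
  set where it differs from \<open>1\<close>, have positive distance from the complement of \<open>\<Omega>\<close> and from \<open>K\<close> respectively.
\<close>

lemma cutoff_at_shift:
  fixes p :: "'a::euclidean_space \<times> 'b::euclidean_space"
  assumes "open \<Omega>" "compact K" and \<eta>: "cutoff_at \<Omega> K \<eta> p"
  obtains \<delta> where "\<delta> > 0" "\<And>h. h \<in> ball 0 \<delta> \<Longrightarrow> cutoff_at \<Omega> K (\<lambda>y. \<eta> (y - fst h)) (p + h)"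
proof -
  obtain A V r where A: "compact A" "A \<subseteq> {y. (y, snd p) \<in> \<Omega>}" "\<And>x. x \<notin> A \<Longrightarrow> \<eta> x = 0" and \<eta>2: "C2dir UNIV \<eta>"
    and V: "open V" "{y. (y, snd p) \<in> K} \<subseteq> V" "\<And>y. y \<in> V \<Longrightarrow> \<eta> y = 1"
    and r: "r > 0" "\<And>y. y \<in> ball (fst p) r \<Longrightarrow> \<eta> y = \<eta> (fst p)"
    using \<eta> unfolding cutoff_at_def test_fn_def by blast
  have "compact (A \<times> {snd p})" "A \<times> {snd p} \<subseteq> \<Omega>" using A by (auto intro: compact_Times)
  then obtain \<delta>1 where \<delta>1: "\<delta>1 > 0" "\<And>x h. x \<in> A \<times> {snd p} \<Longrightarrow> h \<in> ball 0 \<delta>1 \<Longrightarrow> x + h \<in> \<Omega>"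
    using compact_translates_stay_inside[OF _ assms(1)] by metis
  have "closed ((- V) \<times> {snd p})" using V(1) by (intro closed_Times) (auto simp: closed_Compl)
  moreover have "K \<inter> (- V) \<times> {snd p} = {}" using V(2) by auto
  ultimately obtain \<delta>2 where \<delta>2: "\<delta>2 > 0" "\<And>x y. x \<in> K \<Longrightarrow> y \<in> (- V) \<times> {snd p} \<Longrightarrow> \<delta>2 \<le> dist x y"
    using separate_compact_closed[OF assms(2)] by metis
  show thesis
  proof (rule that[of "min \<delta>1 \<delta>2"])
    fix h :: "'a \<times> 'b" assume h: "h \<in> ball 0 (min \<delta>1 \<delta>2)"
    have "C2dir UNIV (\<lambda>y. \<eta> (y - fst h))"
      using C2dir_shift[OF \<eta>2, of UNIV "- fst h"] by simp
    moreover have "compact ((+) (fst h) ` A)" by (rule compact_translation[OF A(1)])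
    moreover have "(+) (fst h) ` A \<subseteq> {y. (y, snd (p + h)) \<in> \<Omega>}"
    proof clarify
      fix y assume "y \<in> A"
      then have "(y, snd p) + h \<in> \<Omega>" using h by (intro \<delta>1(2)) auto
      then show "(fst h + y, snd (p + h)) \<in> \<Omega>" by (simp add: plus_prod_def add.commute)
    qed
    moreover have "\<eta> (y - fst h) = 0" if "y \<notin> (+) (fst h) ` A" for y
    proof (rule A(3), rule)
      assume "y - fst h \<in> A"
      then have "fst h + (y - fst h) \<in> (+) (fst h) ` A" by (rule imageI)
      then show False using that by simp
    qed
    ultimately have 1: "test_fn {y. (y, snd (p + h)) \<in> \<Omega>} (\<lambda>y. \<eta> (y - fst h))"
      unfolding test_fn_def by blast
    define W where "W = (\<lambda>y. y - fst h) -` V"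
    have 2: "open W \<and> {y. (y, snd (p + h)) \<in> K} \<subseteq> W \<and> (\<forall>y\<in>W. \<eta> (y - fst h) = 1)"
    proof (intro conjI ballI)
      show "open W" unfolding W_def
        by (intro open_vimage V(1) continuous_intros)
      show "{y. (y, snd (p + h)) \<in> K} \<subseteq> W"
      proof (rule subsetI, rule ccontr)
        fix y assume "y \<in> {y. (y, snd (p + h)) \<in> K}" "y \<notin> W"
        then have y: "(y, snd (p + h)) \<in> K" "y - fst h \<notin> V" by (simp_all add: W_def)
        have "\<delta>2 \<le> dist (y, snd (p + h)) (y - fst h, snd p)"
          by (rule \<delta>2(2)[OF y(1)]) (use y(2) in auto)
        also have "(y, snd (p + h)) - (y - fst h, snd p) = h"
          by (simp add: prod_eq_iff)
        then have "dist (y, snd (p + h)) (y - fst h, snd p) = norm h" by (simp only: dist_norm)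
        finally show False using h by simp
      qed
      show "\<eta> (y - fst h) = 1" if "y \<in> W" for y
        using that V(3) by (simp add: W_def)
    qed
    have "\<eta> (y - fst h) = \<eta> (fst (p + h) - fst h)" if "y \<in> ball (fst (p + h)) r" for y
    proof -
      have "fst (p + h) - y = fst p - (y - fst h)" by simp
      then have "y - fst h \<in> ball (fst p) r" using that by (simp only: mem_ball dist_norm)
      then show ?thesis using r(2) by simp
    qed
    then have 3: "\<exists>r>0. \<forall>y\<in>ball (fst (p + h)) r. \<eta> (y - fst h) = \<eta> (fst (p + h) - fst h)"
      using r(1) by blast
    show "cutoff_at \<Omega> K (\<lambda>y. \<eta> (y - fst h)) (p + h)"
      unfolding cutoff_at_def using 1 2 3 by (intro conjI exI[of _ W]) auto
  qed (use \<delta>1 \<delta>2 in auto)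
qed

lemma continuous_on_slice:
  "continuous_on U f \<Longrightarrow> continuous_on {y. (y, z) \<in> U} (\<lambda>y. f (y, z))"
  by (rule continuous_on_compose2[of U f _ "\<lambda>y. (y, z)"]) (auto intro!: continuous_on_Pair)

lemma hartogs_value_integrand:
  assumes "open \<Omega>" "compact K" "continuous_on (\<Omega> - K) f" "cutoff_at \<Omega> K \<eta> p"
  obtains c where "continuous_on UNIV (\<lambda>y. f (y, snd p) * green_density m 0 \<eta> (fst p) y)"
    "\<And>y. y \<notin> cbox (- c) c \<Longrightarrow> green_density m 0 \<eta> (fst p) y = 0"
    "(\<lambda>y. f (y, snd p) * green_density m 0 \<eta> (fst p) y) integrable_on UNIV"
proof -
  obtain B where B: "compact B" "B \<subseteq> {y. (y, snd p) \<in> \<Omega> - K}" "\<And>e y. y \<notin> B \<Longrightarrow> green_density m e \<eta> (fst p) y = 0"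
    "\<And>e. continuous_on UNIV (green_density m e \<eta> (fst p))"
    using cutoff_at_green_density[OF assms(4), of m] by blast
  obtain c where c: "B \<subseteq> cbox (- c) c"
    using bounded_subset_cbox_symmetric[OF compact_imp_bounded[OF B(1)]] by metis
  have "open (\<Omega> - K)" using assms(1,2) by (simp add: compact_imp_closed open_Diff)
  then have "continuous_on UNIV (\<lambda>y. f (y, snd p) * green_density m 0 \<eta> (fst p) y)"
    by (intro continuous_on_mult_off[OF open_slices(1) continuous_on_slice[OF assms(3)] B(4) compact_imp_closed[OF B(1)] B(2,3)])
  then show thesis
    using c B(3) by (intro that integral_compact_support(1)[of _ B]) auto
qed

text \<open>
  The difference of two cutoffs is a test function on the slice of \<open>\<Omega> - K\<close>, where \<open>f\<close> is harmonic, so the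
  reproducing formula evaluates the difference of the integrals.
\<close>

lemma hartogs_value_independent:
  fixes f :: "'a::euclidean_space \<times> 'b::euclidean_space \<Rightarrow> real"
  assumes C: "green_constant TYPE('a) m C"
    and \<Omega>: "open \<Omega>" "compact K" and f: "continuous_on (\<Omega> - K) f"
    and harm: "C2dir {y. (y, snd p) \<in> \<Omega> - K} (\<lambda>y. f (y, snd p))"
      "\<And>y. (y, snd p) \<in> \<Omega> - K \<Longrightarrow> lap (\<lambda>y. f (y, snd p)) y = 0"
    and \<eta>1: "cutoff_at \<Omega> K \<eta>1 p" and \<eta>2: "cutoff_at \<Omega> K \<eta>2 p"
  shows "hartogs_value m C f \<eta>1 p = hartogs_value m C f \<eta>2 p"
proof -
  obtain A V r where A: "compact A" "A \<subseteq> {y. (y, snd p) \<in> \<Omega>}" "\<And>x. x \<notin> A \<Longrightarrow> \<eta>1 x = 0" and c1: "C2dir UNIV \<eta>1"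
    and V: "open V" "{y. (y, snd p) \<in> K} \<subseteq> V" "\<And>y. y \<in> V \<Longrightarrow> \<eta>1 y = 1"
    and r: "r > 0" "\<And>y. y \<in> ball (fst p) r \<Longrightarrow> \<eta>1 y = \<eta>1 (fst p)"
    using \<eta>1 unfolding cutoff_at_def test_fn_def by blast
  obtain A' V' r' where A': "compact A'" "A' \<subseteq> {y. (y, snd p) \<in> \<Omega>}" "\<And>x. x \<notin> A' \<Longrightarrow> \<eta>2 x = 0" and c2: "C2dir UNIV \<eta>2"
    and V': "open V'" "{y. (y, snd p) \<in> K} \<subseteq> V'" "\<And>y. y \<in> V' \<Longrightarrow> \<eta>2 y = 1"
    and r': "r' > 0" "\<And>y. y \<in> ball (fst p) r' \<Longrightarrow> \<eta>2 y = \<eta>2 (fst p)"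
    using \<eta>2 unfolding cutoff_at_def test_fn_def by blast
  define \<psi> where "\<psi> = (\<lambda>y. \<eta>1 y - \<eta>2 y)"
  let ?w = "{y. (y, snd p) \<in> \<Omega> - K}"
  have ow: "open ?w" using \<Omega> by (intro open_slices(1)) (simp add: compact_imp_closed open_Diff)
  have "test_fn ?w \<psi>"
    unfolding test_fn_def
  proof (intro conjI exI)
    show "C2dir UNIV \<psi>" unfolding \<psi>_def by (rule C2dir_diff(1)[OF open_UNIV c1 c2])
    show "compact ((A \<union> A') - (V \<inter> V'))" by (intro compact_diff compact_Un open_Int A A' V V')
    show "(A \<union> A') - (V \<inter> V') \<subseteq> ?w" using A(2) A'(2) V(2) V'(2) by blast
    show "\<forall>x. x \<notin> (A \<union> A') - (V \<inter> V') \<longrightarrow> \<psi> x = 0"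
      using A(3) A'(3) V(3) V'(3) by (auto simp: \<psi>_def)
  qed
  from green_constantD[OF C ow harm(1) _ this, where r = "min r r'" and x = "fst p"]
  have *: "integral UNIV (\<lambda>y. f (y, snd p) * green_density m 0 \<psi> (fst p) y) = C * (f (fst p, snd p) * \<psi> (fst p))"
  proof
    show "min r r' > 0" using r r' by simp
    show "\<psi> y = \<psi> (fst p)" if "y \<in> ball (fst p) (min r r')" for y
      using that r(2)[of y] r'(2)[of y] by (simp add: \<psi>_def)
  qed (use harm(2) in auto)
  have l: "green_density m 0 \<psi> (fst p) y = green_density m 0 \<eta>1 (fst p) y - green_density m 0 \<eta>2 (fst p) y" for y
    unfolding \<psi>_def by (rule green_density_diff[OF c1 c2])
  have "integral UNIV (\<lambda>y. f (y, snd p) * green_density m 0 \<psi> (fst p) y)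
      = integral UNIV (\<lambda>y. f (y, snd p) * green_density m 0 \<eta>1 (fst p) y) - integral UNIV (\<lambda>y. f (y, snd p) * green_density m 0 \<eta>2 (fst p) y)"
    unfolding l right_diff_distrib
    by (rule integral_diff; rule hartogs_value_integrand[OF \<Omega> f \<eta>1, of m] hartogs_value_integrand[OF \<Omega> f \<eta>2, of m])
  with * have "integral UNIV (\<lambda>y. f (y, snd p) * green_density m 0 \<eta>1 (fst p) y)
    = integral UNIV (\<lambda>y. f (y, snd p) * green_density m 0 \<eta>2 (fst p) y) + C * (f p * \<psi> (fst p))" by simp
  then show ?thesis
    using green_constant_pos[OF C] by (simp add: hartogs_value_def \<psi>_def field_simps)
qed

text \<open>
  Translating the cutoff together with the base point moves the translation from the density to \<open>f\<close>.
\<close>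

lemma hartogs_value_shift:
  fixes f :: "'a::euclidean_space \<times> 'b::euclidean_space \<Rightarrow> real"
  assumes \<Omega>: "open \<Omega>" "compact K" and f: "continuous_on (\<Omega> - K) f"
    and h: "cutoff_at \<Omega> K (\<lambda>y. \<eta> (y - fst h)) (p + h)"
  shows "hartogs_value m C f (\<lambda>y. \<eta> (y - fst h)) (p + h) = (1 - \<eta> (fst p)) * f (p + h)
    + integral UNIV (\<lambda>y. f ((y, snd p) + h) * green_density m 0 \<eta> (fst p) y) / C"
proof -
  have l: "green_density m 0 (\<lambda>y. \<eta> (y - fst h)) (fst (p + h)) y = green_density m 0 \<eta> (fst p) (y - fst h)" for y
  proof -
    have "lap (\<lambda>y. \<eta> (y - fst h)) y = lap \<eta> (y - fst h)" "pd b (\<lambda>y. \<eta> (y - fst h)) y = pd b \<eta> (y - fst h)" for b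
      using lap_shift[of \<eta> "- fst h" y] fun_cong[OF pd_shift[of b \<eta> "- fst h"], of y] by auto
    then show ?thesis by (simp add: green_density_def algebra_simps)
  qed
  obtain c where c: "continuous_on UNIV (\<lambda>y. f (y, snd (p + h)) * green_density m 0 (\<lambda>y. \<eta> (y - fst h)) (fst (p + h)) y)"
    "\<And>y. y \<notin> cbox (- c) c \<Longrightarrow> green_density m 0 (\<lambda>y. \<eta> (y - fst h)) (fst (p + h)) y = 0"
    using hartogs_value_integrand[OF \<Omega> f h, of m] by blast
  have "integral UNIV (\<lambda>y. f (y + fst h, snd (p + h)) * green_density m 0 (\<lambda>y. \<eta> (y - fst h)) (fst (p + h)) (y + fst h))
    = integral UNIV (\<lambda>y. f (y, snd (p + h)) * green_density m 0 (\<lambda>y. \<eta> (y - fst h)) (fst (p + h)) y)"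
    by (rule integral_UNIV_shift[OF c(1) subset_refl[of "cbox (- c) c"]]) (subst c(2), assumption, simp)
  moreover have "(y, snd p) + h = (y + fst h, snd (p + h))" for y by (simp add: prod_eq_iff)
  moreover have "green_density m 0 (\<lambda>y. \<eta> (y - fst h)) (fst (p + h)) (y + fst h) = green_density m 0 \<eta> (fst p) y" for y
    by (simp only: l add_diff_cancel_right')
  ultimately show ?thesis by (simp add: hartogs_value_def)
qed

text \<open>
  Near \<open>p\<close> the extension is the sum of a multiple of \<open>f (p + h)\<close> and an average of values \<open>f ((y, b) + h)\<close> over points
  \<open>(y, b)\<close> of \<open>\<Omega> - K\<close> with a weight that does not depend on \<open>h\<close>. Hence it is twice continuously differentiable like \<open>f\<close>, and
  every linear relation \<open>L\<close> with constant coefficients between the second derivatives of \<open>f\<close> is inherited.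
\<close>

lemma extension_is_local_average:
  fixes f F :: "'a::euclidean_space \<times> 'b::euclidean_space \<Rightarrow> real"
  assumes \<Omega>: "open \<Omega>" "compact K" and f: "C2_data (\<Omega> - K) f f' f''"
    and F: "\<And>\<eta> q. cutoff_at \<Omega> K \<eta> q \<Longrightarrow> F q = hartogs_value m C f \<eta> q"
    and \<eta>: "cutoff_at \<Omega> K \<eta> p" and p: "p \<in> \<Omega>"
    and L: "bounded_linear (L :: _ \<Rightarrow> 'c::banach)" "\<And>x. x \<in> \<Omega> - K \<Longrightarrow> L (f'' x) = 0"
  obtains \<delta> F' F'' where "\<delta> > 0" "C2_data (ball p \<delta>) F F' F''" "L (F'' p) = 0"
proof -
  let ?U = "\<Omega> - K"
  define a b where "a = fst p" and "b = snd p"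
  have U: "open ?U" using \<Omega> by (simp add: compact_imp_closed open_Diff)
  obtain \<delta>1 where \<delta>1: "\<delta>1 > 0" "\<And>h. h \<in> ball 0 \<delta>1 \<Longrightarrow> cutoff_at \<Omega> K (\<lambda>y. \<eta> (y - fst h)) (p + h)"
    using cutoff_at_shift[OF \<Omega> \<eta>] by blast
  obtain B where B: "compact B" "B \<subseteq> {y. (y, b) \<in> ?U}" "\<And>y. y \<notin> B \<Longrightarrow> green_density m 0 \<eta> a y = 0"
    "continuous_on UNIV (green_density m 0 \<eta> a)"
    using cutoff_at_green_density[OF \<eta>, of m] unfolding a_def b_def by metis
  have "compact (B \<times> {b})" "B \<times> {b} \<subseteq> ?U" using B by (auto intro: compact_Times)
  then obtain \<delta>2 where \<delta>2: "\<delta>2 > 0" "\<And>x h. x \<in> B \<times> {b} \<Longrightarrow> h \<in> ball 0 \<delta>2 \<Longrightarrow> x + h \<in> ?U"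
    using compact_translates_stay_inside[OF _ U] by metis
  \<comment> \<open>The coefficient of \<open>f p\<close> is zero for \<open>p\<close> in \<open>K\<close>, so it only meets genuine values of \<open>f\<close>.\<close>
  define \<kappa> where "\<kappa> = 1 - \<eta> a"
  have \<kappa>U: "p \<in> ?U" if "\<kappa> \<noteq> 0"
  proof -
    obtain V where "{y. (y, b) \<in> K} \<subseteq> V" "\<forall>y\<in>V. \<eta> y = 1"
      using \<eta> unfolding cutoff_at_def b_def by blast
    moreover have "p = (a, b)" by (simp add: a_def b_def)
    ultimately show ?thesis using that p by (auto simp: \<kappa>_def)
  qed
  have "\<exists>\<delta>3>0. \<kappa> \<noteq> 0 \<longrightarrow> (\<forall>h\<in>ball 0 \<delta>3. h + p \<in> ?U)"
  proof (cases "\<kappa> = 0")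
    case False
    have "compact {p}" "{p} \<subseteq> ?U" using \<kappa>U[OF False] by auto
    then obtain \<delta>3 where "\<delta>3 > 0" "\<And>x h. x \<in> {p} \<Longrightarrow> h \<in> ball 0 \<delta>3 \<Longrightarrow> x + h \<in> ?U"
      using compact_translates_stay_inside[OF _ U] by metis
    then show ?thesis by (intro exI[of _ \<delta>3]) (auto simp: add.commute)
  qed (auto intro: exI[of _ 1])
  then obtain \<delta>3 where \<delta>3: "\<delta>3 > 0" "\<And>h. \<kappa> \<noteq> 0 \<Longrightarrow> h \<in> ball 0 \<delta>3 \<Longrightarrow> h + p \<in> ?U" by blast
  define \<delta> where "\<delta> = min \<delta>1 (min \<delta>2 \<delta>3)"
  have \<delta>: "\<delta> > 0" using \<delta>1 \<delta>2 \<delta>3 by (simp add: \<delta>_def)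
  obtain c where c: "B \<subseteq> cbox (- c) c"
    using bounded_subset_cbox_symmetric[OF compact_imp_bounded[OF B(1)]] by metis
  define w where "w y = green_density m 0 \<eta> a y / C" for y
  have w: "continuous_on UNIV w" "closed B" "\<And>y. y \<notin> B \<Longrightarrow> w y = 0"
    using B compact_imp_closed[OF B(1)] unfolding w_def[abs_def] divide_inverse
    by (auto intro!: continuous_on_mult continuous_on_const)
  have BU: "(y, b) + h \<in> ?U" if "y \<in> B" "h \<in> ball 0 \<delta>" for y h
    using \<delta>2(2)[of "(y, b)" h] that by (auto simp: \<delta>_def)
  let ?I = "\<lambda>g h. integral (cbox (- c) c) (\<lambda>y. w y *\<^sub>R g ((y, b) + h))"
  have Feq: "F (h + p) = \<kappa> *\<^sub>R f (h + p) + ?I f h" if h: "h \<in> ball 0 \<delta>" for h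
  proof -
    have ch: "cutoff_at \<Omega> K (\<lambda>y. \<eta> (y - fst h)) (p + h)" using h by (intro \<delta>1(2)) (simp add: \<delta>_def)
    have "F (p + h) = (1 - \<eta> a) * f (p + h) + integral UNIV (\<lambda>y. f ((y, b) + h) * green_density m 0 \<eta> a y) / C"
      unfolding F[OF ch] a_def b_def by (rule hartogs_value_shift[OF \<Omega> C2_data_continuous(1)[OF f] ch])
    also have "(\<lambda>y. f ((y, b) + h) * green_density m 0 \<eta> a y)
        = (\<lambda>y. if y \<in> cbox (- c) c then f ((y, b) + h) * green_density m 0 \<eta> a y else 0)"
      by (rule ext) (use B(3) c in auto)
    also have "integral UNIV \<dots> = integral (cbox (- c) c) (\<lambda>y. f ((y, b) + h) * green_density m 0 \<eta> a y)"
      by (rule integral_restrict_UNIV)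
    also have "\<dots> / C = ?I f h"
      by (subst integral_divide[symmetric]) (simp add: w_def mult.commute)
    finally show ?thesis by (simp add: \<kappa>_def add.commute)
  qed
  have k: "C2_data (ball 0 \<delta>) (\<lambda>h. \<kappa> *\<^sub>R f (h + p)) (\<lambda>h. \<kappa> *\<^sub>R f' (h + p)) (\<lambda>h. \<kappa> *\<^sub>R f'' (h + p))"
  proof (cases "\<kappa> = 0")
    case True
    then show ?thesis by (simp add: C2_data_zero)
  next
    case False
    show ?thesis
      by (rule C2_data_scaleR[OF C2_data_shift[OF f]], rule \<delta>3(2)[OF False]) (simp add: \<delta>_def)
  qed
  note avg = C2_data_translate_average[where \<delta> = \<delta> and c = "- c" and d = c, OF U f w BU]
  have "C2_data (ball 0 \<delta>) (\<lambda>h. \<kappa> *\<^sub>R f (h + p) + ?I f h) (\<lambda>h. \<kappa> *\<^sub>R f' (h + p) + ?I f' h) (\<lambda>h. \<kappa> *\<^sub>R f'' (h + p) + ?I f'' h)"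
    by (rule C2_data_add[OF k avg(1)])
  from C2_data_shift[OF this, of "ball p \<delta>" "- p"]
  have "C2_data (ball p \<delta>) (\<lambda>x. \<kappa> *\<^sub>R f (x + - p + p) + ?I f (x + - p)) (\<lambda>x. \<kappa> *\<^sub>R f' (x + - p + p) + ?I f' (x + - p))
    (\<lambda>x. \<kappa> *\<^sub>R f'' (x + - p + p) + ?I f'' (x + - p))"
    by (simp add: dist_norm norm_minus_commute)
  then have data: "C2_data (ball p \<delta>) F (\<lambda>x. \<kappa> *\<^sub>R f' (x + - p + p) + ?I f' (x + - p))
    (\<lambda>x. \<kappa> *\<^sub>R f'' (x + - p + p) + ?I f'' (x + - p))"
  proof (rule C2_data_cong[OF open_ball])
    fix x assume "x \<in> ball p \<delta>"
    then have "x + - p \<in> ball 0 \<delta>" by (simp add: dist_norm norm_minus_commute)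
    from Feq[OF this] show "F x = \<kappa> *\<^sub>R f (x + - p + p) + ?I f (x + - p)" by simp
  qed
  show thesis
  proof (rule that[OF \<delta> data])
    interpret L: bounded_linear L by (rule L(1))
    have "L (\<kappa> *\<^sub>R f'' p) = 0"
      using L(2)[OF \<kappa>U] by (cases "\<kappa> = 0") (auto simp: L.scaleR L.zero)
    moreover have "L (?I f'' 0) = 0"
    proof -
      have "(\<lambda>y. w y *\<^sub>R f'' ((y, b) + 0)) integrable_on cbox (- c) c"
        by (rule avg(2); (assumption | simp add: \<delta>))
      from integral_linear[OF this L(1)]
      have "L (?I f'' 0) = integral (cbox (- c) c) (\<lambda>y. L (w y *\<^sub>R f'' ((y, b) + 0)))"
        by (simp add: o_def)
      also have "(\<lambda>y. L (w y *\<^sub>R f'' ((y, b) + 0))) = (\<lambda>_. 0)"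
      proof
        fix y
        show "L (w y *\<^sub>R f'' ((y, b) + 0)) = 0"
          using w(3)[of y] B(2) L(2)[of "(y, b)"] by (cases "y \<in> B") (auto simp: L.scaleR L.zero)
      qed
      finally show ?thesis by simp
    qed
    ultimately show "L (\<kappa> *\<^sub>R f'' (p + - p + p) + ?I f'' (p + - p)) = 0"
      by (simp add: L.add)
  qed
qed

text \<open>
  Otherwise the projections of \<open>\<Omega>\<close> and \<open>K\<close> would coincide, and a nonempty set would be both open and compact.
\<close>

lemma open_points_off_compact_projection:
  fixes \<Omega> K :: "('a::euclidean_space \<times> 'b::euclidean_space) set"
  assumes "open \<Omega>" "compact K" "K \<subseteq> \<Omega>" "\<Omega> \<noteq> {}"
  shows "\<exists>p\<in>\<Omega>. snd p \<notin> snd ` K"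
proof (rule ccontr)
  assume "\<not> ?thesis"
  then have eq: "snd ` \<Omega> = snd ` K" using assms(3) by auto
  have "compact (snd ` K)" by (intro compact_continuous_image assms continuous_intros)
  moreover have "open (snd ` K)" using open_image_snd[OF assms(1)] eq by simp
  moreover have "snd ` K \<noteq> {}" using eq assms(4) by auto
  ultimately show False
    using clopen[of "snd ` K"] compact_imp_closed compact_imp_bounded not_bounded_UNIV by metis
qed

theorem corollary5p1:
  fixes \<Omega> K :: "(octonion \<times> octonion) set"
  assumes "open \<Omega>" and "bounded \<Omega>"
    and "compact K" and "K \<subseteq> \<Omega>"
    and "connected (\<Omega> - K)"
  shows "\<forall>f. oph_on (\<Omega> - K) f \<longrightarrow> (\<exists>F. oph_on \<Omega> F \<and> (\<forall>x\<in>\<Omega> - K. F x = f x))"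
proof (intro allI impI)
  fix f assume oph: "oph_on (\<Omega> - K) f"
  let ?U = "\<Omega> - K"
  have dim: "DIM(octonion) = 2 * 3 + 2" and three: "(3::nat) \<ge> 1" by simp_all
  obtain C where C: "green_constant TYPE(octonion) 3 C" using green_constant_exists[OF dim three] by blast
  obtain f' f'' where f: "C2_data ?U f f' f''" and U: "open ?U" and D0: "\<And>x. x \<in> ?U \<Longrightarrow> D0 f x = 0"
    using oph unfolding oph_on_def C2_on_iff_data by blast
  \<comment> \<open>The dimension of the octonions is \<open>2 m + 2\<close> for \<open>m = 3\<close>.\<close>
  define F where "F q = hartogs_value 3 C f (SOME \<eta>. cutoff_at \<Omega> K \<eta> q) q" for q
  have F: "F q = hartogs_value 3 C f \<eta> q" if "cutoff_at \<Omega> K \<eta> q" for \<eta> q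
    unfolding F_def
    by (rule hartogs_value_independent[OF C assms(1,3) C2_data_continuous(1)[OF f]
          oph_on_slices(1)[OF oph] oph_on_slices(2)[OF oph] someI[of "\<lambda>\<eta>. cutoff_at \<Omega> K \<eta> q", OF that] that])
  have loc: "\<exists>V. open V \<and> p \<in> V \<and> C2_on V F" "D0 F p = 0" if p: "p \<in> \<Omega>" for p
  proof -
    obtain \<eta> where \<eta>: "cutoff_at \<Omega> K \<eta> p" using cutoff_at_exists[OF assms(1,3,4)] by blast
    define L where "L B = (laplace_symbol 1 B, laplace_symbol 2 B, mixed_symbol 1 2 B, mixed_symbol 2 1 B)" for B
    have L: "bounded_linear L"
      unfolding L_def by (intro bounded_linear_Pair bounded_linear_laplace_symbol bounded_linear_mixed_symbol)
    have L0: "L (f'' x) = 0" if "x \<in> ?U" for x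
      using D0_eq_0_iff[OF U f that] D0[OF that] by (simp add: L_def zero_prod_def)
    obtain \<delta> F' F'' where \<delta>: "\<delta> > 0" "C2_data (ball p \<delta>) F F' F''" "L (F'' p) = 0"
      by (rule extension_is_local_average[OF assms(1,3) f F \<eta> p L L0])
    show "\<exists>V. open V \<and> p \<in> V \<and> C2_on V F"
      using \<delta> unfolding C2_on_iff_data by (intro exI[of _ "ball p \<delta>"]) auto
    show "D0 F p = 0"
      using D0_eq_0_iff[OF open_ball \<delta>(2), of p] \<delta>(1,3) by (simp add: L_def zero_prod_def)
  qed
  have oF: "oph_on \<Omega> F"
    unfolding oph_on_def using assms(1) loc C2_on_local[of \<Omega> F] by blast
  have "F x = f x" if x: "x \<in> ?U" for x
  proof -
    \<comment> \<open>Over points outside the projection of \<open>K\<close> the zero function is an admissible cutoff, and it gives the value \<open>f p\<close>.\<close>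
    define O' where "O' = ?U \<inter> UNIV \<times> (- (snd ` K))"
    define g where "g p = F p - f p" for p
    have "g x = 0"
    proof (rule separately_harmonic_unique_continuation[OF dim three U assms(5) _ _ _ _ _ _ _ _ x, of g O'])
      have F1: "C2dir {y. (y, z) \<in> ?U} (\<lambda>y. F (y, z))" for z
        by (rule C2dir_subset[OF oph_on_slices(1)[OF oF]]) auto
      have F2: "C2dir {z. (y, z) \<in> ?U} (\<lambda>z. F (y, z))" for y
        by (rule C2dir_subset[OF oph_on_slices(3)[OF oF]]) auto
      fix y z
      note d1 = C2dir_diff[OF open_slices(1)[OF U, of z] F1[of z] oph_on_slices(1)[OF oph, of z]]
      note d2 = C2dir_diff[OF open_slices(2)[OF U, of y] F2[of y] oph_on_slices(3)[OF oph, of y]]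
      show "C2dir {y. (y, z) \<in> ?U} (\<lambda>y. g (y, z))" "C2dir {z. (y, z) \<in> ?U} (\<lambda>z. g (y, z))"
        unfolding g_def by (rule d1(1) d2(1))+
      show "lap (\<lambda>y. g (y, z)) y = 0" "lap (\<lambda>z. g (y, z)) z = 0" if "(y, z) \<in> ?U"
        using d1(3)[of y] d2(3)[of z] that oph_on_slices(2,4)[OF oph that] oph_on_slices(2,4)[OF oF, of y z]
        unfolding g_def by auto
    next
      have "closed (snd ` K)"
        by (intro compact_imp_closed compact_continuous_image assms(3) continuous_intros)
      then show "open O'" unfolding O'_def
        by (intro open_Int U open_Times) (auto simp: open_Compl)
      show "O' \<subseteq> ?U" by (auto simp: O'_def)
      have "\<Omega> \<noteq> {}" using x by auto
      then obtain q where "q \<in> \<Omega>" "snd q \<notin> snd ` K"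
        using open_points_off_compact_projection[OF assms(1,3,4)] by blast
      then have "q \<in> O'" by (cases q) (force simp: O'_def)
      then show "O' \<noteq> {}" by blast
      fix p assume p: "p \<in> O'"
      have "test_fn {y. (y, snd p) \<in> \<Omega>} (\<lambda>_. 0)"
        unfolding test_fn_def by (auto intro!: C2dir_const)
      moreover have "{y. (y, snd p) \<in> K} = {}" using p by (force simp: O'_def)
      ultimately have "cutoff_at \<Omega> K (\<lambda>_. 0) p"
        unfolding cutoff_at_def by (auto intro!: exI[of _ 1] exI[of _ "{}"])
      then show "g p = 0"
        by (simp add: g_def F hartogs_value_def green_density_def)
    qed
    then show ?thesis by (simp add: g_def)
  qed
  with oF show "\<exists>F. oph_on \<Omega> F \<and> (\<forall>x\<in>\<Omega> - K. F x = f x)" by blast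
qed

end
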